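(* Let $N\ge 3$, $\alpha\in(0,2)$, and let $\varphi:[0,\infty)\to[0,\infty)$ be continuous and nondecreasing with $\varphi(0)=0$. The condition that $$\int_{\mathbb{R}^N}\frac{\rho(y)}{|x_0-y|^{N-\alpha}}\,dy<\infty\quad\text{for some }x_0\in\mathbb{R}^N$$ is not necessary for the existence of a nonnegative nontrivial bounded solution in the whole space $\mathbb{R}^N$ of the equation $\Delta^{\alpha/2}u=\rho\,\varphi(u)$. That is, there exists a nonnegative locally bounded Borel function $\rho$ on $\mathbb{R}^N$ such that this equation admits a nonnegative nontrivial bounded solution in $\mathbb{R}^N$, while $\int_{\mathbb{R}^N}\rho(y)|x-y|^{\alpha-N}\,dy=\infty$ for every $x\in\mathbb{R}^N$.
   Context: $\Delta^{\alpha/2}=-(-\Delta)^{\alpha/2}$ is the fractional Laplacian (Fourier multiplier $-|\xi|^\alpha$). A (nonnegative) solution of $\Delta^{\alpha/2}u=\rho\,\varphi(u)$ in the whole space is a real-valued (nonnegative) continuous function $u$ on $\mathbb{R}^N$ such that $\rho\varphi(u)$ is locally Lebesgue integrable and $\int_{\mathbb{R}^N}u\,\Delta^{\alpha/2}\theta\,dx=\int_{\mathbb{R}^N}\rho\,\varphi(u)\,\theta\,dx$ for every nonnegative $\theta\in C_c^\infty(\mathbb{R}^N)$. Nontrivial means not identically zero. *)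

theory Defs
  imports "HOL-Analysis.Analysis"
begin

text \<open>Integrals are over \<^const>\<open>lborel\<close>; for Borel \<open>\<rho>\<close>, continuous
  \<open>u \<ge> 0\<close> and \<open>\<phi>\<close> continuous on \<open>[0, \<infinity>)\<close> all integrands below are Borel measurable, so this agrees with
  integration against Lebesgue measure.\<close>

primrec cont_diff :: "nat \<Rightarrow> ('a::euclidean_space \<Rightarrow> real) \<Rightarrow> bool" where
  "cont_diff 0 f \<longleftrightarrow> continuous_on UNIV f"
| "cont_diff (Suc k) f \<longleftrightarrow>
     (\<forall>x. f differentiable (at x)) \<and> (\<forall>v. cont_diff k (\<lambda>x. frechet_derivative f (at x) v))"

definition test_function :: "('a::euclidean_space \<Rightarrow> real) \<Rightarrow> bool" where
  "test_function \<theta> \<longleftrightarrow> (\<forall>k. cont_diff k \<theta>) \<and> compact (closure {x. \<theta> x \<noteq> 0})"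

definition fourier :: "('a::euclidean_space \<Rightarrow> real) \<Rightarrow> 'a \<Rightarrow> complex" where
  "fourier \<theta> \<xi> = (\<integral>x. cis (- (\<xi> \<bullet> x)) * complex_of_real (\<theta> x) \<partial>lborel)"

text \<open>The operator \<open>\<Delta>\<^sup>\<alpha>\<^sup>/\<^sup>2\<close> with Fourier multiplier \<open>- |\<xi>|\<^sup>\<alpha>\<close>, for test functions.  The
  inverse Fourier integral is real, because the multiplier is real and even and \<open>\<theta>\<close> is real;
  \<^const>\<open>Re\<close> only changes its type.\<close>

definition frac_laplacian :: "real \<Rightarrow> ('a::euclidean_space \<Rightarrow> real) \<Rightarrow> 'a \<Rightarrow> real" where
  "frac_laplacian \<alpha> \<theta> x =
     Re ((\<integral>\<xi>. cis (\<xi> \<bullet> x) * complex_of_real (- (norm \<xi> powr \<alpha>)) * fourier \<theta> \<xi> \<partial>lborel)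
         / complex_of_real ((2 * pi) ^ DIM('a)))"

text \<open>Integrability of \<open>u \<cdot> \<Delta>\<^sup>\<alpha>\<^sup>/\<^sup>2 \<theta>\<close> is part of the weak formulation: a Bochner integral is
  \<open>0\<close> by convention where it does not exist.  For \<open>\<rho> \<cdot> \<phi>(u) \<cdot> \<theta>\<close> it follows from local
  integrability.  Only solutions \<open>u \<ge> 0\<close> are meaningful when \<open>\<phi>\<close> is given on \<open>[0, \<infinity>)\<close>.\<close>

definition solves_frac_eq ::
    "real \<Rightarrow> ('a::euclidean_space \<Rightarrow> real) \<Rightarrow> (real \<Rightarrow> real) \<Rightarrow> ('a \<Rightarrow> real) \<Rightarrow> bool" where
  "solves_frac_eq \<alpha> \<rho> \<phi> u \<longleftrightarrow>
     continuous_on UNIV u \<and>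
     (\<forall>K. compact K \<longrightarrow> set_integrable lborel K (\<lambda>x. \<rho> x * \<phi> (u x))) \<and>
     (\<forall>\<theta>. test_function \<theta> \<and> (\<forall>x. \<theta> x \<ge> 0) \<longrightarrow>
        integrable lborel (\<lambda>x. u x * frac_laplacian \<alpha> \<theta> x) \<and>
        (\<integral>x. u x * frac_laplacian \<alpha> \<theta> x \<partial>lborel) = (\<integral>x. \<rho> x * \<phi> (u x) * \<theta> x \<partial>lborel))"

end

theory Submission
  imports Defs "HOL-Probability.Probability"
begin

text \<open>If \<open>\<phi>\<close> vanishes at some \<open>c > 0\<close>, then \<open>\<rho> = 1\<close> and the constant \<open>u = c\<close> work, since constants are
  \<open>\<alpha>\<close>-harmonic and \<open>|x - y|\<^sup>\<alpha>\<^sup>-\<^sup>N\<close> has infinite integral.  Otherwise \<open>\<phi> > 0\<close> on \<open>(0, \<infinity>)\<close>, and it is \<open>u\<close> that is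
  constructed first: for every bounded continuous \<open>u > 0\<close> for which \<open>f = \<Delta>\<^sup>\<alpha>\<^sup>/\<^sup>2 u\<close> is bounded and nonnegative, the
  quotient \<open>\<rho> = f / \<phi>(u)\<close> is a locally bounded coefficient for which \<open>u\<close> is a solution.  This \<open>\<rho>\<close> is large
  where \<open>u\<close> is small but \<open>f\<close> is not.

  Such a \<open>u\<close> is \<open>1 - \<Sum>k. a\<^sub>k w((x - x\<^sub>k) / \<lambda>\<^sub>k)\<close>, where the bump \<open>w\<close> takes values in \<open>[0, 1]\<close>, equals \<open>1\<close> on the
  unit ball, decays at infinity and is superharmonic (\<open>superharmonic_bump\<close>).  On the ball
  \<open>B(x\<^sub>k, \<lambda>\<^sub>k)\<close> one has \<open>u \<le> 1 - a\<^sub>k\<close>, whereas \<open>f\<close> is at least a constant times \<open>\<lambda>\<^sub>k\<^sup>-\<^sup>\<alpha>\<close> however close \<open>a\<^sub>k\<close> is to \<open>1\<close>: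
  the operator is nonlocal and sees, from inside the plateau, that \<open>w\<close> is small far away.  Hence the
  \<open>k\<close>-th ball contributes to the Riesz potential of \<open>\<rho>\<close> at least a constant times
  \<open>(\<lambda>\<^sub>k / |x\<^sub>k|)\<^sup>N\<^sup>-\<^sup>\<alpha> / \<phi>(1 - a\<^sub>k)\<close>, and this tends to infinity if \<open>1 - a\<^sub>k\<close> is chosen small enough after
  \<open>r\<^sub>k = \<lambda>\<^sub>k / |x\<^sub>k|\<close>.  Since \<open>\<phi>\<close> may tend to \<open>0\<close> arbitrarily slowly, the remaining bumps must then contribute
  less than \<open>1 - a\<^sub>k\<close> near \<open>x\<^sub>k\<close>, or \<open>u\<close> would become negative.  A later bump contributes there a
  quantity controlled by its ratio \<open>r\<^sub>j\<close>, which is chosen after \<open>a\<^sub>k\<close>, and an earlier bump a quantity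
  controlled by \<open>|x\<^sub>j| / |x\<^sub>k|\<close>, which is small if \<open>|x\<^sub>k|\<close> is chosen large (\<open>scale_sequences\<close>, \<open>bump_interaction\<close>).

  All statements on \<open>\<Delta>\<^sup>\<alpha>\<^sup>/\<^sup>2\<close> are reduced to the heat semigroup \<open>H\<^sub>s\<close> by Bochner's subordination formula
  \<open>\<Delta>\<^sup>\<alpha>\<^sup>/\<^sup>2 \<theta> = m\<^sup>-\<^sup>1 \<integral>\<^sub>0\<^sup>\<infinity> (H\<^sub>s \<theta> - \<theta>) s\<^sup>-\<^sup>1\<^sup>-\<^sup>\<alpha>\<^sup>/\<^sup>2 ds\<close> (\<open>frac_laplacian_eq_heat\<close>), which comes from the Fourier multipliers by
  \<open>|\<xi>|\<^sup>\<alpha> = m\<^sup>-\<^sup>1 \<integral>\<^sub>0\<^sup>\<infinity> (1 - exp(-s|\<xi>|\<^sup>2)) s\<^sup>-\<^sup>1\<^sup>-\<^sup>\<alpha>\<^sup>/\<^sup>2 ds\<close>.  As \<open>H\<^sub>s\<close> is symmetric, the same formula applied to \<open>u\<close> itself gives the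
  right-hand side \<open>f\<close> of the weak equation (\<open>weak_frac_laplacian\<close>).  In this form the sign of \<open>f\<close> is
  clear: a function that is superharmonic for the ordinary Laplacian satisfies \<open>H\<^sub>s w \<le> w\<close>, and so it
  is superharmonic for all fractional ones.  In dimension \<open>N \<ge> 3\<close> nonconstant bounded functions of this
  kind exist because the heat kernel is integrable in time at infinity.\<close>

section \<open>Integrability criteria\<close>

lemma integrable_lborel_bound:
  fixes f :: "'a::euclidean_space \<Rightarrow> 'b::{banach, second_countable_topology}"
  assumes g: "integrable lborel g" and f: "f \<in> borel_measurable borel" and le: "\<And>x. norm (f x) \<le> g x"
  shows "integrable lborel f"
proof (rule Bochner_Integration.integrable_bound[OF g])
  show "AE x in lborel. norm (f x) \<le> norm (g x)" using order_trans[OF le abs_ge_self] by simp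
qed (use f in simp)

lemma integrable_bounded_mult:
  fixes f g :: "'a::euclidean_space \<Rightarrow> 'b::{real_normed_field, banach, second_countable_topology}"
  assumes f: "integrable lborel f" and g[measurable]: "g \<in> borel_measurable borel" and b: "\<And>x. norm (g x) \<le> M"
  shows "integrable lborel (\<lambda>x. g x * f x)"
proof (rule integrable_lborel_bound)
  have [measurable]: "f \<in> borel_measurable borel" using borel_measurable_integrable[OF f] by simp
  show "(\<lambda>x. g x * f x) \<in> borel_measurable borel" by measurable
  show "integrable lborel (\<lambda>x. M * norm (f x))" using f by simp
  show "norm (g x * f x) \<le> M * norm (f x)" for x using b by (auto simp: norm_mult intro!: mult_right_mono)
qed

text \<open>Tonelli's criterion for integrability on a product, with a majorant for the inner integrals.\<close>

lemma integrable_pairI: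
  fixes F :: "'a::euclidean_space \<times> 'b::euclidean_space \<Rightarrow> 'c::{banach, second_countable_topology}"
  assumes F: "F \<in> borel_measurable (borel \<Otimes>\<^sub>M borel)"
    and i: "\<And>x. integrable lborel (\<lambda>y. F (x, y))"
    and b: "integrable lborel b" "\<And>x. (LBINT y. norm (F (x, y))) \<le> b x"
  shows "integrable (lborel \<Otimes>\<^sub>M lborel) F"
proof (rule lborel_pair.Fubini_integrable)
  have F'[measurable]: "F \<in> borel_measurable (lborel \<Otimes>\<^sub>M lborel)" using F by simp
  then show "F \<in> borel_measurable (lborel \<Otimes>\<^sub>M lborel)" .
  show "integrable lborel (\<lambda>x. LBINT y. norm (F (x, y)))"
  proof (rule integrable_lborel_bound[OF b(1)])
    show "(\<lambda>x. LBINT y. norm (F (x, y))) \<in> borel_measurable borel" by measurable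
    show "norm (LBINT y. norm (F (x, y))) \<le> b x" for x
      using b(2)[of x] integral_nonneg_AE[of "\<lambda>y. norm (F (x, y))" lborel] by simp
  qed
  show "AE x in lborel. integrable lborel (\<lambda>y. F (x, y))" using i by simp
qed

lemma integrable_pair_bound:
  fixes F :: "'a::euclidean_space \<times> 'b::euclidean_space \<Rightarrow> 'c::{banach, second_countable_topology}"
  assumes F: "F \<in> borel_measurable (borel \<Otimes>\<^sub>M borel)"
    and a: "integrable lborel a" and b: "integrable lborel b"
    and le: "\<And>x y. norm (F (x, y)) \<le> a x * b y"
  shows "integrable (lborel \<Otimes>\<^sub>M lborel) F"
proof (rule integrable_pairI[OF F])
  have [measurable]: "F \<in> borel_measurable (borel \<Otimes>\<^sub>M borel)" by fact
  show i: "integrable lborel (\<lambda>y. F (x, y))" for x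
    using b by (intro integrable_lborel_bound[OF _ _ le]) auto
  show "integrable lborel (\<lambda>x. a x * (LBINT y. b y))" using a by simp
  show "(LBINT y. norm (F (x, y))) \<le> a x * (LBINT y. b y)" for x
    using integral_mono[of lborel "\<lambda>y. norm (F (x, y))" "\<lambda>y. a x * b y"] i b le by simp
qed

lemma lborel_Fubini:
  fixes F :: "'a::euclidean_space \<times> 'b::euclidean_space \<Rightarrow> 'c::{banach, second_countable_topology}"
  assumes "integrable (lborel \<Otimes>\<^sub>M lborel) F"
  shows "(LBINT y. (LBINT x. F (x, y))) = (LBINT x. (LBINT y. F (x, y)))"
  using lborel_pair.Fubini_integral[of "\<lambda>x y. F (x, y)"] assms by simp

section \<open>Affine changes of variables and products\<close>

lemma
  fixes f :: "'a::euclidean_space \<Rightarrow> 'b::{banach, second_countable_topology}"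
  assumes f: "f \<in> borel_measurable borel" and c: "c \<noteq> 0"
  shows integrable_lborel_affine_iff: "integrable lborel (\<lambda>x. f (t + c *\<^sub>R x)) \<longleftrightarrow> integrable lborel f" (is ?I)
    and integral_lborel_affine: "(LBINT x. f x) = \<bar>c\<bar> ^ DIM('a) *\<^sub>R (LBINT x. f (t + c *\<^sub>R x))" (is ?E)
proof -
  let ?D = "distr lborel borel (\<lambda>x::'a. t + c *\<^sub>R x)"
  have L: "(lborel :: 'a measure) = density ?D (\<lambda>_. ennreal (\<bar>c\<bar> ^ DIM('a)))"
    using lborel_affine[OF c, of t] by simp
  have "integrable lborel f \<longleftrightarrow> integrable ?D (\<lambda>x. (\<bar>c\<bar> ^ DIM('a)) *\<^sub>R f x)"
    by (subst L, subst integrable_density) (use f in auto)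
  also have "\<dots> \<longleftrightarrow> integrable ?D f"
  proof
    assume "integrable ?D (\<lambda>x. (\<bar>c\<bar> ^ DIM('a)) *\<^sub>R f x)"
    then have "integrable ?D (\<lambda>x. (1 / \<bar>c\<bar> ^ DIM('a)) *\<^sub>R (\<bar>c\<bar> ^ DIM('a)) *\<^sub>R f x)"
      by (rule integrable_scaleR_right)
    then show "integrable ?D f" using c by simp
  qed (rule integrable_scaleR_right)
  also have "\<dots> \<longleftrightarrow> integrable lborel (\<lambda>x. f (t + c *\<^sub>R x))"
    by (subst integrable_distr_eq) (use f in auto)
  finally show ?I by simp
  have "(LBINT x. f x) = (\<integral>x. (\<bar>c\<bar> ^ DIM('a)) *\<^sub>R f x \<partial>?D)"
    by (subst L, subst integral_density) (use f in auto)
  also have "\<dots> = \<bar>c\<bar> ^ DIM('a) *\<^sub>R (\<integral>x. f x \<partial>?D)" by simp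
  also have "(\<integral>x. f x \<partial>?D) = (LBINT x. f (t + c *\<^sub>R x))"
    by (subst integral_distr) (use f in auto)
  finally show ?E .
qed

lemma integral_lborel_shift:
  fixes f :: "'a::euclidean_space \<Rightarrow> 'b::{banach, second_countable_topology}"
  assumes "f \<in> borel_measurable borel"
  shows "(LBINT x. f (t + x)) = (LBINT x. f x)"
  using integral_lborel_affine[OF assms, of 1 t] by simp

lemma integrable_lborel_shift:
  fixes f :: "'a::euclidean_space \<Rightarrow> 'b::{banach, second_countable_topology}"
  assumes "integrable lborel f"
  shows "integrable lborel (\<lambda>x. f (t + x))"
  using integrable_lborel_affine_iff[of f 1 t] assms by auto

lemma integral_lborel_reflect:
  fixes f :: "'a::euclidean_space \<Rightarrow> 'b::{banach, second_countable_topology}"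
  assumes "f \<in> borel_measurable borel"
  shows "(LBINT x. f (t - x)) = (LBINT x. f x)"
  using integral_lborel_affine[OF assms, of "-1" t] by simp

text \<open>Lebesgue measure on a Euclidean space is the image of a product of one-dimensional Lebesgue
  measures under the coordinate map, so integrals of products over coordinates factorize.\<close>

lemma lborel_integral_prod_Basis:
  fixes f :: "'a::euclidean_space \<Rightarrow> real \<Rightarrow> 'b::{real_normed_field,banach,second_countable_topology}"
  assumes f: "\<And>b. b \<in> Basis \<Longrightarrow> integrable lborel (f b)"
  shows "integrable lborel (\<lambda>x::'a. \<Prod>b\<in>Basis. f b (x \<bullet> b))" (is ?I)
    and "(LBINT x. (\<Prod>b\<in>Basis. f b (x \<bullet> b))) = (\<Prod>b\<in>Basis. LBINT t. f b t)" (is ?E)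
proof -
  interpret product_sigma_finite "\<lambda>_::'a. lborel :: real measure"
    by standard
  let ?T = "\<lambda>g. \<Sum>b\<in>Basis. g b *\<^sub>R b :: 'a"
  have T: "?T \<in> (\<Pi>\<^sub>M b\<in>Basis. lborel) \<rightarrow>\<^sub>M borel" by measurable
  have fm[measurable]: "b \<in> Basis \<Longrightarrow> f b \<in> borel_measurable borel" for b
    using borel_measurable_integrable[OF f] by simp
  have m: "(\<lambda>x::'a. \<Prod>b\<in>Basis. f b (x \<bullet> b)) \<in> borel_measurable borel"
    by measurable
  have e: "(\<Prod>b\<in>Basis. f b (?T g \<bullet> b)) = (\<Prod>b\<in>Basis. f b (g b))" for g
    by (intro prod.cong) auto
  show ?I
    unfolding lborel_eq[where 'a='a]
    by (subst integrable_distr_eq[OF T m]) (use product_integrable_prod[OF finite_Basis f] in \<open>simp add: e\<close>)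
  show ?E
    unfolding lborel_eq[where 'a='a]
    by (subst integral_distr[OF T m]) (use product_integral_prod[OF finite_Basis f] in \<open>simp add: e\<close>)
qed

section \<open>Gaussians and the heat kernel\<close>

text \<open>A rescaling of the characteristic function of the standard normal distribution.\<close>

lemma gaussian_fourier_1d:
  fixes s t :: real
  assumes "0 < s"
  shows "integrable lborel (\<lambda>x. cis (t * x) * of_real (exp (- s * x\<^sup>2)))" (is ?I)
    and "(LBINT x. cis (t * x) * of_real (exp (- s * x\<^sup>2))) = complex_of_real (sqrt (pi / s) * exp (- t\<^sup>2 / (4 * s)))" (is ?E)
proof -
  define r where "r = sqrt (2 * s)"
  have r: "r > 0" "r\<^sup>2 = 2 * s" using assms by (auto simp: r_def)
  define g where "g = (\<lambda>u::real. std_normal_density u *\<^sub>R cis (t / r * u))"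
  have gm: "g \<in> borel_measurable borel" unfolding g_def cis_conv_exp by measurable
  have gi: "integrable lborel g"
    by (rule integrable_lborel_bound[OF _ gm, of std_normal_density]) (simp_all add: g_def)
  have "(LBINT u. g u) = char std_normal_distribution (t / r)"
    unfolding char_def g_def
    by (subst integral_density) (auto simp: cis_conv_exp mult_ac)
  also have "\<dots> = complex_of_real (exp (- (t / r)\<^sup>2 / 2))"
    by (simp add: char_std_normal_distribution)
  finally have G: "(LBINT u. g u) = complex_of_real (exp (- (t / r)\<^sup>2 / 2))" .
  have eq: "cis (t * x) * of_real (exp (- s * x\<^sup>2)) = sqrt (2 * pi) *\<^sub>R g (0 + r *\<^sub>R x)" for x
    using r by (simp add: g_def std_normal_density_def power_mult_distrib scaleR_conv_of_real mult_ac)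
  have i: "integrable lborel (\<lambda>x. g (0 + r *\<^sub>R x))"
    using integrable_lborel_affine_iff[OF gm, of r 0] r gi by simp
  show ?I
    unfolding eq using i by (intro integrable_scaleR_right) auto
  have "(LBINT x. g (0 + r *\<^sub>R x)) = (1 / r) *\<^sub>R complex_of_real (exp (- (t / r)\<^sup>2 / 2))"
    using integral_lborel_affine[OF gm, of r 0] r G by simp
  then have "(LBINT x. cis (t * x) * of_real (exp (- s * x\<^sup>2)))
     = sqrt (2 * pi) *\<^sub>R (1 / r) *\<^sub>R complex_of_real (exp (- (t / r)\<^sup>2 / 2))"
    unfolding eq by simp
  also have "\<dots> = complex_of_real (sqrt (2 * pi) / r * exp (- (t / r)\<^sup>2 / 2))"
    by (simp add: scaleR_conv_of_real)
  also have "sqrt (2 * pi) / r = sqrt (pi / s)"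
    unfolding r_def by (simp add: real_sqrt_divide real_sqrt_mult)
  also have "(t / r)\<^sup>2 / 2 = t\<^sup>2 / (4 * s)" using r by (simp add: power_divide)
  then have "- (t / r)\<^sup>2 / 2 = - t\<^sup>2 / (4 * s)" by simp
  finally show ?E .
qed

lemma cis_sum: "finite A \<Longrightarrow> cis (\<Sum>a\<in>A. f a) = (\<Prod>a\<in>A. cis (f a))"
  by (induction A rule: finite_induct) (auto simp flip: cis_mult)

lemma norm_sq_eq_sum: "(norm (x::'a::euclidean_space))\<^sup>2 = (\<Sum>b\<in>Basis. (x \<bullet> b)\<^sup>2)"
  unfolding power2_norm_eq_inner by (subst euclidean_inner) (simp add: power2_eq_square)

lemma gaussian_fourier:
  fixes z :: "'a::euclidean_space"
  assumes "0 < s"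
  shows "integrable lborel (\<lambda>x::'a. cis (x \<bullet> z) * of_real (exp (- s * (norm x)\<^sup>2)))" (is ?I)
    and "(LBINT x. cis (x \<bullet> z) * of_real (exp (- s * (norm x)\<^sup>2)))
       = complex_of_real (sqrt (pi / s) ^ DIM('a) * exp (- (norm z)\<^sup>2 / (4 * s)))" (is ?E)
proof -
  have eq: "cis (x \<bullet> z) * of_real (exp (- s * (norm x)\<^sup>2))
     = (\<Prod>b\<in>Basis. cis ((z \<bullet> b) * (x \<bullet> b)) * of_real (exp (- s * (x \<bullet> b)\<^sup>2)))" for x
    by (simp add: norm_sq_eq_sum euclidean_inner[of x z] cis_sum prod.distrib sum_distrib_left
        sum_negf[symmetric] exp_sum mult_ac)
  show ?I
    unfolding eq by (intro lborel_integral_prod_Basis gaussian_fourier_1d assms)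
  have "(LBINT x. cis (x \<bullet> z) * of_real (exp (- s * (norm x)\<^sup>2)))
     = (\<Prod>b\<in>Basis. complex_of_real (sqrt (pi / s) * exp (- (z \<bullet> b)\<^sup>2 / (4 * s))))"
    unfolding eq by (subst lborel_integral_prod_Basis) (use gaussian_fourier_1d assms in auto)
  also have "\<dots> = complex_of_real (sqrt (pi / s) ^ DIM('a) * exp (- (norm z)\<^sup>2 / (4 * s)))"
    by (simp add: prod.distrib norm_sq_eq_sum exp_sum[symmetric] sum_divide_distrib sum_negf
         flip: of_real_prod)
  finally show ?E .
qed

text \<open>The fundamental solution of \<open>\<partial>\<^sub>t = \<Delta>\<close>, i.e. the centred normal density with variance \<open>2t\<close> in each coordinate.\<close>

definition heat_kernel :: "real \<Rightarrow> 'a::euclidean_space \<Rightarrow> real" where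
  "heat_kernel t x = (1 / sqrt (4 * pi * t)) ^ DIM('a) * exp (- (norm x)\<^sup>2 / (4 * t))"

definition heat :: "real \<Rightarrow> ('a::euclidean_space \<Rightarrow> real) \<Rightarrow> 'a \<Rightarrow> real" where
  "heat s f x = (LBINT y. f (x + y) * heat_kernel s y)"

lemma measurable_heat_kernel [measurable]:
  "case_prod heat_kernel \<in> borel_measurable (borel \<Otimes>\<^sub>M (borel :: 'a::euclidean_space measure))"
  unfolding heat_kernel_def[abs_def] by measurable

lemma measurable_heat_kernel' [measurable (raw)]:
  assumes "f \<in> borel_measurable M" "g \<in> M \<rightarrow>\<^sub>M (borel :: 'a::euclidean_space measure)"
  shows "(\<lambda>x. heat_kernel (f x) (g x)) \<in> borel_measurable M"
  using measurable_compose[OF measurable_Pair[OF assms] measurable_heat_kernel] by simp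

lemma heat_kernel_nonneg [simp]: "0 \<le> heat_kernel t x" if "0 \<le> t"
  using that by (simp add: heat_kernel_def)

lemma heat_kernel_uminus [simp]: "heat_kernel t (- x) = heat_kernel t x"
  by (simp add: heat_kernel_def)

lemma heat_kernel_commute: "heat_kernel t (x - y) = heat_kernel t (y - x)"
  by (simp add: heat_kernel_def norm_minus_commute)

lemma heat_kernel_eq_fourier:
  fixes z :: "'a::euclidean_space"
  assumes s: "0 < s"
  shows "(LBINT x. cis (x \<bullet> z) * of_real (exp (- s * (norm x)\<^sup>2)))
       = complex_of_real ((2 * pi) ^ DIM('a) * heat_kernel s z)"
proof -
  have "sqrt (pi / s) = 2 * pi * (1 / sqrt (4 * pi * s))"
  proof -
    have "pi / s = (2 * pi)\<^sup>2 / (4 * pi * s)"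
      using s by (simp add: power2_eq_square)
    then have "sqrt (pi / s) = sqrt ((2 * pi)\<^sup>2) / sqrt (4 * pi * s)"
      by (simp only: real_sqrt_divide)
    also have "sqrt ((2 * pi)\<^sup>2) = 2 * pi" by (rule real_sqrt_unique) auto
    finally show ?thesis by simp
  qed
  then show ?thesis
    unfolding gaussian_fourier(2)[OF s] heat_kernel_def by (simp only: power_mult_distrib mult.assoc)
qed

lemma integral_heat_kernel:
  assumes s: "0 < s"
  shows "integrable lborel (heat_kernel s :: 'a::euclidean_space \<Rightarrow> real)"
    and "(LBINT x. heat_kernel s (x::'a)) = 1"
proof -
  let ?g = "\<lambda>x::'a. exp (- (1 / (4 * s)) * (norm x)\<^sup>2)"
  have p: "0 < 1 / (4 * s)" using s by simp
  have i: "integrable lborel ?g"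
    using integrable_Re[OF gaussian_fourier(1)[OF p, of "0::'a"]] by simp
  have "complex_of_real (LBINT x. ?g x) = complex_of_real (sqrt (pi / (1 / (4 * s))) ^ DIM('a))"
    using gaussian_fourier(2)[OF p, of "0::'a"] by (simp flip: of_real_exp)
  then have v: "(LBINT x. ?g x) = sqrt (4 * pi * s) ^ DIM('a)"
    unfolding of_real_eq_iff by (simp add: mult_ac)
  have e: "heat_kernel s = (\<lambda>x::'a. (1 / sqrt (4 * pi * s)) ^ DIM('a) * ?g x)"
    by (simp add: heat_kernel_def fun_eq_iff)
  show "integrable lborel (heat_kernel s :: 'a::euclidean_space \<Rightarrow> real)"
    unfolding e using i by (rule integrable_mult_right)
  show "(LBINT x. heat_kernel s (x::'a)) = 1"
    unfolding e using s by (simp only: integral_mult_right_zero v) (simp add: power_one_over)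
qed

section \<open>Test functions\<close>

lemma cont_diff_continuous: "cont_diff k f \<Longrightarrow> continuous_on UNIV f"
  by (cases k) (auto intro!: continuous_at_imp_continuous_on differentiable_imp_continuous_within)

lemma test_function_continuous: "test_function \<theta> \<Longrightarrow> continuous_on UNIV \<theta>"
  unfolding test_function_def using cont_diff_continuous by blast

lemma test_function_measurable: "test_function \<theta> \<Longrightarrow> \<theta> \<in> borel_measurable borel"
  using test_function_continuous by (rule borel_measurable_continuous_onI)

lemma test_function_differentiable: "test_function \<theta> \<Longrightarrow> \<theta> differentiable (at x)"
  unfolding test_function_def using cont_diff.simps(2) by blast

lemma test_function_has_derivative:
  "test_function \<theta> \<Longrightarrow> (\<theta> has_derivative frechet_derivative \<theta> (at x)) (at x)"
  using test_function_differentiable frechet_derivative_works by blast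

lemma test_function_bounded_support:
  assumes "test_function \<theta>"
  obtains r where "0 < r" "\<And>x. r < norm x \<Longrightarrow> \<theta> x = 0"
proof -
  have "bounded (closure {x. \<theta> x \<noteq> 0})"
    using assms by (auto simp: test_function_def compact_imp_bounded)
  then obtain r where "0 < r" "\<And>x. x \<in> closure {x. \<theta> x \<noteq> 0} \<Longrightarrow> norm x \<le> r"
    by (auto simp: bounded_pos)
  then show ?thesis using that closure_subset[of "{x. \<theta> x \<noteq> 0}"] by (metis (mono_tags, lifting) mem_Collect_eq not_le subsetD)
qed

lemma test_function_bounded:
  assumes t: "test_function \<theta>"
  obtains B where "0 < B" "\<And>x. \<bar>\<theta> x\<bar> \<le> B"
proof -
  let ?K = "closure {x. \<theta> x \<noteq> 0}"
  have "compact (\<theta> ` ?K)"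
    using t continuous_on_subset[OF test_function_continuous[OF t]]
    by (intro compact_continuous_image) (auto simp: test_function_def)
  then obtain B where "0 < B" "\<forall>y\<in>\<theta> ` ?K. norm y \<le> B"
    using compact_imp_bounded bounded_pos by blast
  moreover have "\<theta> x = 0" if "x \<notin> ?K" for x
    using that closure_subset[of "{x. \<theta> x \<noteq> 0}"] by auto
  ultimately show ?thesis using that[of B] by (metis abs_zero imageI less_le_not_le linorder_le_cases real_norm_def)
qed

lemma test_function_integrable:
  assumes t: "test_function \<theta>"
  shows "integrable lborel \<theta>"
proof -
  let ?K = "closure {x. \<theta> x \<noteq> 0}"
  have "integrable lborel (\<lambda>x. indicator ?K x *\<^sub>R \<theta> x)"
    using t continuous_on_subset[OF test_function_continuous[OF t]]
    by (intro borel_integrable_compact) (auto simp: test_function_def)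
  moreover have "(\<lambda>x. indicator ?K x *\<^sub>R \<theta> x) = \<theta>"
    using closure_subset[of "{x. \<theta> x \<noteq> 0}"] by (auto simp: indicator_def fun_eq_iff)
  ultimately show ?thesis by simp
qed

lemma test_function_derivative:
  assumes t: "test_function \<theta>"
  shows "test_function (\<lambda>x. frechet_derivative \<theta> (at x) v)"
  unfolding test_function_def
proof
  show "\<forall>k. cont_diff k (\<lambda>x. frechet_derivative \<theta> (at x) v)"
    using t unfolding test_function_def by (metis cont_diff.simps(2))
  let ?K = "closure {x. \<theta> x \<noteq> 0}"
  have "frechet_derivative \<theta> (at x) v = 0" if "x \<notin> ?K" for x
  proof -
    have "(\<theta> has_derivative (\<lambda>_. 0)) (at x)"
    proof (rule has_derivative_transform_within_open[of "\<lambda>_. 0"])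
      show "open (- ?K)" "x \<in> - ?K" using that by auto
      show "0 = \<theta> y" if "y \<in> - ?K" for y
        using that closure_subset[of "{x. \<theta> x \<noteq> 0}"] by auto
    qed auto
    from frechet_derivative_at[OF this] show ?thesis by metis
  qed
  then have "{x. frechet_derivative \<theta> (at x) v \<noteq> 0} \<subseteq> ?K" by auto
  then have "closure {x. frechet_derivative \<theta> (at x) v \<noteq> 0} \<subseteq> ?K" by (simp add: closure_minimal)
  then show "compact (closure {x. frechet_derivative \<theta> (at x) v \<noteq> 0})"
    using t unfolding test_function_def by (meson bounded_subset closed_closure compact_eq_bounded_closed)
qed

lemma cont_diff_diff: "cont_diff k f \<Longrightarrow> cont_diff k g \<Longrightarrow> cont_diff k (\<lambda>x. f x - g x)"
proof (induction k arbitrary: f g)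
  case 0
  then show ?case by (auto intro: continuous_intros)
next
  case (Suc k)
  have "frechet_derivative (\<lambda>x. f x - g x) (at x) = (\<lambda>v. frechet_derivative f (at x) v - frechet_derivative g (at x) v)" for x
    using Suc.prems
    by (intro frechet_derivative_at[symmetric] has_derivative_diff) (auto simp flip: frechet_derivative_works)
  then show ?case using Suc by (auto intro: differentiable_diff)
qed

lemma test_function_diff:
  assumes "test_function f" "test_function g"
  shows "test_function (\<lambda>x. f x - g x)"
proof -
  have "closure {x. f x - g x \<noteq> 0} \<subseteq> closure ({x. f x \<noteq> 0} \<union> {x. g x \<noteq> 0})"
    by (intro closure_mono) auto
  moreover have "compact (closure ({x. f x \<noteq> 0} \<union> {x. g x \<noteq> 0}))"
    using assms by (auto simp: test_function_def)
  ultimately have "compact (closure {x. f x - g x \<noteq> 0})"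
    by (meson bounded_subset closed_closure compact_eq_bounded_closed)
  moreover have "cont_diff k (\<lambda>x. f x - g x)" for k
    using assms by (intro cont_diff_diff) (auto simp: test_function_def)
  ultimately show ?thesis unfolding test_function_def by blast
qed

lemma test_function_along_line:
  assumes "test_function \<theta>"
  shows "((\<lambda>h. \<theta> (x + h *\<^sub>R v)) has_real_derivative frechet_derivative \<theta> (at (x + h *\<^sub>R v)) v) (at h)"
proof -
  let ?D = "frechet_derivative \<theta> (at (x + h *\<^sub>R v))"
  have "((\<lambda>h. \<theta> (x + h *\<^sub>R v)) has_derivative (\<lambda>s. ?D (s *\<^sub>R v))) (at h)"
    by (rule has_derivative_compose[where g=\<theta> and f="\<lambda>h. x + h *\<^sub>R v"])
      (auto intro!: derivative_eq_intros test_function_has_derivative[OF assms])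
  moreover have "?D (s *\<^sub>R v) = ?D v * s" for s
    using linear_cmul[OF linear_frechet_derivative[OF test_function_differentiable[OF assms]]] by simp
  ultimately show ?thesis by (simp add: has_field_derivative_def)
qed

lemma test_function_lipschitz:
  assumes t: "test_function \<theta>"
  obtains B where "0 < B" "\<And>x h. \<bar>\<theta> (x + h *\<^sub>R v) - \<theta> x\<bar> \<le> B * \<bar>h\<bar>"
proof -
  obtain B where B: "0 < B" "\<And>x. \<bar>frechet_derivative \<theta> (at x) v\<bar> \<le> B"
    using test_function_bounded[OF test_function_derivative[OF t, of v]] by metis
  have "\<bar>\<theta> (x + h *\<^sub>R v) - \<theta> x\<bar> \<le> B * \<bar>h\<bar>" for x h
    using field_differentiable_bound[of UNIV "\<lambda>h. \<theta> (x + h *\<^sub>R v)" "\<lambda>h. frechet_derivative \<theta> (at (x + h *\<^sub>R v)) v" B h 0]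
      test_function_along_line[OF t] B by auto
  with B(1) that show ?thesis by blast
qed

section \<open>The Fourier transform of a test function\<close>

lemma norm_fourier_integrand: "norm (cis a * of_real r) = \<bar>r\<bar>"
  by (simp add: norm_mult)

lemma measurable_cis [measurable]: "cis \<in> borel_measurable borel"
  by (intro borel_measurable_continuous_onI continuous_intros)

lemma integrable_fourier_integrand:
  assumes "integrable lborel \<theta>"
  shows "integrable lborel (\<lambda>x::'a::euclidean_space. cis (- (\<xi> \<bullet> x)) * of_real (\<theta> x))"
  using assms by (intro integrable_bounded_mult[where M=1]) auto

lemma measurable_fourier:
  assumes [measurable]: "\<theta> \<in> borel_measurable borel"
  shows "fourier \<theta> \<in> borel_measurable (borel :: 'a::euclidean_space measure)"
proof -
  have "(\<lambda>\<xi>. LBINT x. cis (- (\<xi> \<bullet> x)) * of_real (\<theta> x)) \<in> borel_measurable (borel :: 'a measure)"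
    by measurable
  then show ?thesis by (simp add: fourier_def[abs_def])
qed

lemma fourier_bound: "norm (fourier \<theta> \<xi>) \<le> (LBINT x. \<bar>\<theta> x\<bar>)"
  unfolding fourier_def by (rule order_trans[OF integral_norm_bound]) (simp add: norm_fourier_integrand)

lemma fourier_diff:
  assumes "integrable lborel f" "integrable lborel g"
  shows "fourier (\<lambda>x. f x - g x) \<xi> = fourier f \<xi> - fourier g \<xi>"
  unfolding fourier_def
  by (subst Bochner_Integration.integral_diff[symmetric])
     (auto intro!: integrable_fourier_integrand assms simp: right_diff_distrib)

lemma fourier_translate:
  assumes "\<theta> \<in> borel_measurable borel"
  shows "fourier (\<lambda>x. \<theta> (x + a)) \<xi> = cis (\<xi> \<bullet> a) * fourier \<theta> \<xi>"
proof -
  have [measurable]: "\<theta> \<in> borel_measurable borel" by fact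
  have "fourier \<theta> \<xi> = (LBINT x. cis (- (\<xi> \<bullet> (a + x))) * of_real (\<theta> (a + x)))"
    unfolding fourier_def by (rule integral_lborel_shift[symmetric]) measurable
  also have "\<dots> = (LBINT x. cis (- (\<xi> \<bullet> a)) * (cis (- (\<xi> \<bullet> x)) * of_real (\<theta> (x + a))))"
    by (simp add: cis_mult inner_right_distrib add.commute mult.assoc[symmetric])
  also have "\<dots> = cis (- (\<xi> \<bullet> a)) * fourier (\<lambda>x. \<theta> (x + a)) \<xi>"
    by (simp add: fourier_def)
  finally show ?thesis by (simp add: cis_mult mult.assoc[symmetric])
qed

text \<open>Translating \<open>\<theta>\<close> by \<open>h v\<close> multiplies its transform by a character; the formula is the derivative of
  this identity at \<open>h = 0\<close>.  The difference quotients are dominated because \<open>\<theta>\<close> is Lipschitz in the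
  direction \<open>v\<close> with compact support.\<close>

lemma fourier_derivative:
  fixes \<theta> :: "'a::euclidean_space \<Rightarrow> real"
  assumes t: "test_function \<theta>"
  shows "fourier (\<lambda>x. frechet_derivative \<theta> (at x) v) \<xi> = \<i> * of_real (\<xi> \<bullet> v) * fourier \<theta> \<xi>"
proof -
  define h where "h = (\<lambda>n::nat. inverse (real (Suc n)))"
  have h0: "h n \<noteq> 0" "0 < h n" "h n \<le> 1" for n by (auto simp: h_def field_simps)
  have hl: "h \<longlonglongrightarrow> 0" unfolding h_def by (rule LIMSEQ_inverse_real_of_nat)
  have hat: "filterlim h (at 0) sequentially"
    using hl h0 by (simp add: filterlim_at)
  define q where "q = (\<lambda>n x. (\<theta> (x + h n *\<^sub>R v) - \<theta> x) / h n)"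
  note [measurable] = test_function_measurable[OF t] test_function_measurable[OF test_function_derivative[OF t, of v]]
  have i: "integrable lborel \<theta>" by (rule test_function_integrable[OF t])
  have i2: "integrable lborel (\<lambda>x. \<theta> (x + h n *\<^sub>R v))" for n
    using integrable_lborel_shift[OF i, of "h n *\<^sub>R v"] by (simp add: add.commute)
  obtain B where B: "0 < B" "\<And>x h. \<bar>\<theta> (x + h *\<^sub>R v) - \<theta> x\<bar> \<le> B * \<bar>h\<bar>"
    using test_function_lipschitz[OF t] by blast
  obtain r where r: "0 < r" "\<And>x. r < norm x \<Longrightarrow> \<theta> x = 0"
    using test_function_bounded_support[OF t] by blast
  let ?R = "r + norm v"
  have bound: "norm (cis (- (\<xi> \<bullet> x)) * of_real (q n x)) \<le> B * indicator (cball 0 ?R) x" for n x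
  proof (cases "norm x \<le> ?R")
    case True
    then show ?thesis using B(2)[of x "h n"] h0[of n]
      unfolding norm_fourier_integrand by (auto simp: q_def divide_simps)
  next
    case False
    have "norm (x + h n *\<^sub>R v) \<ge> norm x - h n * norm v"
      using norm_triangle_ineq4[of "x + h n *\<^sub>R v" "h n *\<^sub>R v"] h0[of n] by simp
    moreover have "h n * norm v \<le> norm v" using h0[of n] mult_right_mono[of "h n" 1 "norm v"] by simp
    ultimately have "r < norm (x + h n *\<^sub>R v)" "r < norm x" using False norm_ge_zero[of v] by linarith+
    then show ?thesis using r(2) B(1) by (simp add: q_def norm_fourier_integrand)
  qed
  have "(\<lambda>n. fourier (q n) \<xi>) \<longlonglongrightarrow> fourier (\<lambda>x. frechet_derivative \<theta> (at x) v) \<xi>"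
    unfolding fourier_def
  proof (rule integral_dominated_convergence[where w="\<lambda>x. B * indicator (cball 0 ?R) x"])
    show "integrable lborel (\<lambda>x::'a. B * indicat_real (cball 0 ?R) x)"
      using emeasure_lborel_cball_finite[of "0::'a" ?R] by (intro integrable_mult_right) simp
    have "(\<lambda>n. q n x) \<longlonglongrightarrow> frechet_derivative \<theta> (at x) v" for x
    proof -
      have "((\<lambda>s. (\<theta> (x + s *\<^sub>R v) - \<theta> x) / s) \<longlongrightarrow> frechet_derivative \<theta> (at x) v) (at 0)"
        using test_function_along_line[OF t, of x v 0] by (simp add: has_field_derivative_iff)
      from filterlim_compose[OF this hat] show ?thesis by (simp add: q_def)
    qed
    then show "AE x in lborel. (\<lambda>n. cis (- (\<xi> \<bullet> x)) * of_real (q n x)) \<longlonglongrightarrow>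
         cis (- (\<xi> \<bullet> x)) * of_real (frechet_derivative \<theta> (at x) v)"
      by (auto intro!: tendsto_intros)
    show "\<And>n. AE x in lborel. norm (cis (- (\<xi> \<bullet> x)) * of_real (q n x)) \<le> B * indicator (cball 0 ?R) x"
      using bound by simp
  qed (auto simp: q_def)
  moreover have "(\<lambda>n. fourier (q n) \<xi>) \<longlonglongrightarrow> \<i> * of_real (\<xi> \<bullet> v) * fourier \<theta> \<xi>"
  proof -
    have e: "fourier (q n) \<xi> = ((cis (h n * (\<xi> \<bullet> v)) - 1) / complex_of_real (h n)) * fourier \<theta> \<xi>" for n
    proof -
      have "fourier (q n) \<xi> = fourier (\<lambda>x. \<theta> (x + h n *\<^sub>R v) - \<theta> x) \<xi> / complex_of_real (h n)"
        unfolding fourier_def q_def by simp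
      also have "\<dots> = (cis (h n * (\<xi> \<bullet> v)) * fourier \<theta> \<xi> - fourier \<theta> \<xi>) / complex_of_real (h n)"
        using fourier_diff[OF i2 i] fourier_translate[of \<theta> "h n *\<^sub>R v"] by simp
      finally show ?thesis by (simp add: algebra_simps diff_divide_distrib)
    qed
    have "((\<lambda>z. exp (\<i> * of_real (\<xi> \<bullet> v) * z)) has_field_derivative \<i> * of_real (\<xi> \<bullet> v)) (at 0)"
      by (auto intro!: derivative_eq_intros)
    then have lim: "((\<lambda>z. (exp (\<i> * of_real (\<xi> \<bullet> v) * z) - 1) / z) \<longlongrightarrow> \<i> * of_real (\<xi> \<bullet> v)) (at 0)"
      by (simp add: has_field_derivative_iff)
    have "filterlim (\<lambda>n. complex_of_real (h n)) (at 0) sequentially"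
      using tendsto_of_real[OF hl, where 'a=complex] h0 by (simp add: filterlim_at)
    from filterlim_compose[OF lim this]
    have "(\<lambda>n. (cis (h n * (\<xi> \<bullet> v)) - 1) / complex_of_real (h n)) \<longlonglongrightarrow> \<i> * of_real (\<xi> \<bullet> v)"
      by (simp add: cis_conv_exp mult_ac)
    then show ?thesis
      unfolding e by (intro tendsto_intros)
  qed
  ultimately show ?thesis by (rule LIMSEQ_unique)
qed

text \<open>The operator \<open>1 - \<partial>\<^sub>v\<^sup>2\<close> preserves test functions and has the multiplier \<open>1 + (\<xi> \<bullet> v)\<^sup>2\<close>.  Iterating
  it yields polynomial decay of the transform of any order.\<close>

lemma fourier_mult_one_plus_sq:
  assumes t: "test_function \<theta>"
  obtains \<psi> where "test_function \<psi>" "\<And>\<xi>. fourier \<psi> \<xi> = complex_of_real (1 + (\<xi> \<bullet> v)\<^sup>2) * fourier \<theta> \<xi>"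
proof -
  let ?D = "\<lambda>f x. frechet_derivative f (at x) v"
  have t2: "test_function (?D (?D \<theta>))" by (intro test_function_derivative t)
  show ?thesis
  proof (rule that)
    show "test_function (\<lambda>x. \<theta> x - ?D (?D \<theta>) x)" by (intro test_function_diff t t2)
    show "fourier (\<lambda>x. \<theta> x - ?D (?D \<theta>) x) \<xi> = complex_of_real (1 + (\<xi> \<bullet> v)\<^sup>2) * fourier \<theta> \<xi>" for \<xi>
      by (simp add: fourier_diff test_function_integrable t t2 test_function_derivative fourier_derivative
          algebra_simps power2_eq_square)
  qed
qed

lemma fourier_mult_prod_one_plus_sq:
  assumes "finite A" and t: "test_function \<theta>"
  shows "\<exists>\<psi>. test_function \<psi> \<and> (\<forall>\<xi>. fourier \<psi> \<xi> = complex_of_real (\<Prod>v\<in>A. 1 + (\<xi> \<bullet> v)\<^sup>2) * fourier \<theta> \<xi>)"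
  using assms(1)
proof (induction rule: finite_induct)
  case empty
  then show ?case using t by auto
next
  case (insert v A)
  then obtain \<psi> where \<psi>: "test_function \<psi>" "\<And>\<xi>. fourier \<psi> \<xi> = complex_of_real (\<Prod>v\<in>A. 1 + (\<xi> \<bullet> v)\<^sup>2) * fourier \<theta> \<xi>"
    by blast
  obtain \<eta> where "test_function \<eta>" "\<And>\<xi>. fourier \<eta> \<xi> = complex_of_real (1 + (\<xi> \<bullet> v)\<^sup>2) * fourier \<psi> \<xi>"
    using fourier_mult_one_plus_sq[OF \<psi>(1)] by blast
  with \<psi>(2) insert.hyps show ?case by (intro exI[of _ \<eta>]) (simp add: mult.assoc)
qed

lemma one_plus_sum_le_prod:
  fixes a :: "'i \<Rightarrow> real"
  assumes "finite A" "\<And>i. i \<in> A \<Longrightarrow> 0 \<le> a i"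
  shows "1 + (\<Sum>i\<in>A. a i) \<le> (\<Prod>i\<in>A. 1 + a i)"
  using assms
proof (induction rule: finite_induct)
  case (insert i A)
  have "1 + (a i + sum a A) \<le> (1 + a i) * (1 + sum a A)"
    using insert by (simp add: algebra_simps sum_nonneg)
  also have "\<dots> \<le> (1 + a i) * (\<Prod>i\<in>A. 1 + a i)" using insert by (intro mult_left_mono) auto
  finally show ?case using insert by simp
qed auto

text \<open>The product \<open>P(\<xi>)\<close> of the factors \<open>1 + \<xi>\<^sub>v\<^sup>2\<close> over all coordinates dominates \<open>1 + |\<xi>|\<^sup>2\<close>, and \<open>1 / P\<close> is
  integrable by factorization.  Thus boundedness of \<open>P\<^sup>2\<close> times the transform is enough.\<close>

lemma fourier_integrable:
  fixes \<theta> :: "'a::euclidean_space \<Rightarrow> real"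
  assumes t: "test_function \<theta>"
  shows "integrable lborel (\<lambda>\<xi>::'a. (1 + (norm \<xi>)\<^sup>2) * norm (fourier \<theta> \<xi>))"
proof -
  define P where "P = (\<lambda>\<xi>::'a. \<Prod>v\<in>Basis. 1 + (\<xi> \<bullet> v)\<^sup>2)"
  have P1: "1 + (norm \<xi>)\<^sup>2 \<le> P \<xi>" for \<xi>
    unfolding P_def norm_sq_eq_sum by (rule one_plus_sum_le_prod) auto
  then have P0: "0 < P \<xi>" for \<xi> using zero_le_power2[of "norm \<xi>"] by (smt (verit))
  obtain \<psi> where \<psi>: "test_function \<psi>" "\<And>\<xi>. fourier \<psi> \<xi> = complex_of_real (P \<xi>) * fourier \<theta> \<xi>"
    using fourier_mult_prod_one_plus_sq[OF finite_Basis t] unfolding P_def by blast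
  obtain \<eta> where \<eta>: "test_function \<eta>" "\<And>\<xi>. fourier \<eta> \<xi> = complex_of_real (P \<xi>) * fourier \<psi> \<xi>"
    using fourier_mult_prod_one_plus_sq[OF finite_Basis \<psi>(1)] unfolding P_def by blast
  define M where "M = (LBINT x. \<bar>\<eta> x\<bar>)"
  have bound: "(1 + (norm \<xi>)\<^sup>2) * norm (fourier \<theta> \<xi>) \<le> M * inverse (P \<xi>)" for \<xi>
  proof -
    have "P \<xi> * (P \<xi> * norm (fourier \<theta> \<xi>)) \<le> M"
      using fourier_bound[of \<eta> \<xi>] P0[of \<xi>] unfolding \<eta>(2) \<psi>(2) M_def by (simp add: norm_mult)
    then have "P \<xi> * norm (fourier \<theta> \<xi>) \<le> M * inverse (P \<xi>)"
      using P0[of \<xi>] by (simp add: field_simps)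
    moreover have "(1 + (norm \<xi>)\<^sup>2) * norm (fourier \<theta> \<xi>) \<le> P \<xi> * norm (fourier \<theta> \<xi>)"
      using P1 by (intro mult_right_mono) auto
    ultimately show ?thesis by simp
  qed
  have "integrable lborel (\<lambda>t::real. inverse (1 + t\<^sup>2))"
    using integrable_inverse_1_plus_square by (simp add: set_integrable_def)
  then have "integrable lborel (\<lambda>\<xi>::'a. \<Prod>v\<in>Basis. inverse (1 + (\<xi> \<bullet> v)\<^sup>2))"
    by (rule lborel_integral_prod_Basis)
  then have i: "integrable lborel (\<lambda>\<xi>::'a. M * inverse (P \<xi>))"
    by (simp add: P_def prod_inversef[symmetric] comp_def)
  show ?thesis
  proof (rule integrable_lborel_bound[OF i])
    note [measurable] = measurable_fourier[OF test_function_measurable[OF t]]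
    show "(\<lambda>\<xi>. (1 + (norm \<xi>)\<^sup>2) * norm (fourier \<theta> \<xi>)) \<in> borel_measurable borel" by measurable
  qed (use bound in \<open>simp add: abs_mult\<close>)
qed

section \<open>The Levy density of the stable subordinator\<close>

text \<open>The density of the Levy measure of the \<open>\<alpha>/2\<close>-stable subordinator, without its normalizing
  constant, which is the inverse of \<open>stable_mass \<alpha>\<close>.\<close>

definition stable_density :: "real \<Rightarrow> real \<Rightarrow> real" where
  "stable_density \<alpha> s = (if 0 < s then s powr (- 1 - \<alpha> / 2) else 0)"

definition stable_mass :: "real \<Rightarrow> real" where
  "stable_mass \<alpha> = (LBINT s. stable_density \<alpha> s * (1 - exp (- s)))"

lemma stable_density_nonneg [simp]: "0 \<le> stable_density \<alpha> s"
  by (simp add: stable_density_def)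

lemma measurable_stable_density [measurable]: "stable_density \<alpha> \<in> borel_measurable borel"
  unfolding stable_density_def[abs_def] by measurable

lemma integrable_powr_on:
  fixes a :: real
  assumes "(\<lambda>t. t powr a) integrable_on S" "S \<in> sets borel"
  shows "integrable lborel (\<lambda>s. indicator S s * s powr a)"
proof -
  have "(\<lambda>t. t powr a) absolutely_integrable_on S"
    using assms(1) by (subst absolutely_integrable_on_iff_nonneg) auto
  then show ?thesis
    using assms(2) unfolding set_integrable_def by (subst (asm) integrable_completion) (auto simp: mult_ac)
qed

lemma integrable_powr_atMost_1: "a > -1 \<Longrightarrow> integrable lborel (\<lambda>s::real. indicator {0..1} s * s powr a)"
  by (intro integrable_powr_on integrable_on_powr_from_0) auto

lemma integrable_powr_atLeast_1: "a < -1 \<Longrightarrow> integrable lborel (\<lambda>s::real. indicator {1..} s * s powr a)"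
  using has_integral_powr_to_inf[of a 1] by (intro integrable_powr_on) (auto simp: integrable_on_def)

text \<open>The density behaves like \<open>s\<^sup>-\<^sup>1\<^sup>-\<^sup>\<alpha>\<^sup>/\<^sup>2\<close>, so it integrates functions that are bounded at infinity and
  \<open>O(s)\<close> at the origin, precisely because \<open>0 < \<alpha> < 2\<close>.\<close>

lemma stable_integrable:
  fixes f :: "real \<Rightarrow> 'b::{banach, second_countable_topology}"
  assumes \<alpha>: "0 < \<alpha>" "\<alpha> < 2" and [measurable]: "f \<in> borel_measurable borel"
    and A: "\<And>s. 0 < s \<Longrightarrow> norm (f s) \<le> A" and B: "\<And>s. 0 < s \<Longrightarrow> norm (f s) \<le> B * s"
  shows "integrable lborel (\<lambda>s. stable_density \<alpha> s *\<^sub>R f s)"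
proof (rule integrable_lborel_bound)
  show "integrable lborel (\<lambda>s. B * (indicator {0..1} s * s powr (- \<alpha> / 2)) + A * (indicator {1..} s * s powr (- 1 - \<alpha> / 2)))"
    using \<alpha> by (intro Bochner_Integration.integrable_add integrable_mult_right integrable_powr_atMost_1 integrable_powr_atLeast_1) auto
  have A0: "0 \<le> A" using A[of 1] norm_ge_zero[of "f 1"] by linarith
  have B0: "0 \<le> B" using B[of 1] norm_ge_zero[of "f 1"] by linarith
  show "norm (stable_density \<alpha> s *\<^sub>R f s) \<le> B * (indicator {0..1} s * s powr (- \<alpha> / 2)) + A * (indicator {1..} s * s powr (- 1 - \<alpha> / 2))" for s
  proof (cases "0 < s")
    case True
    have e: "s powr (- \<alpha> / 2) = s powr (- 1 - \<alpha> / 2) * s"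
      using True powr_add[of s "- 1 - \<alpha> / 2" 1] by simp
    have "norm (stable_density \<alpha> s *\<^sub>R f s) = s powr (- 1 - \<alpha> / 2) * norm (f s)"
      using True by (simp add: stable_density_def)
    moreover have "s powr (- 1 - \<alpha> / 2) * norm (f s) \<le> s powr (- 1 - \<alpha> / 2) * (B * s)"
      using B True by (intro mult_left_mono) auto
    moreover have "s powr (- 1 - \<alpha> / 2) * norm (f s) \<le> s powr (- 1 - \<alpha> / 2) * A"
      using A True by (intro mult_left_mono) auto
    ultimately show ?thesis using True A0 B0 unfolding e by (auto simp: indicator_def mult_ac)
  next
    case False
    then show ?thesis using A0 B0 by (auto simp: stable_density_def)
  qed
qed measurable

lemma stable_integral_scale:
  fixes f :: "real \<Rightarrow> real"
  assumes [measurable]: "f \<in> borel_measurable borel" and a: "0 < a"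
  shows "(LBINT s. stable_density \<alpha> s * f (a * s)) = a powr (\<alpha> / 2) * (LBINT s. stable_density \<alpha> s * f s)"
proof -
  have K: "stable_density \<alpha> (a * s) = a powr (- 1 - \<alpha> / 2) * stable_density \<alpha> s" for s
    using a by (auto simp: stable_density_def powr_mult zero_less_mult_iff)
  have "(LBINT s. stable_density \<alpha> s * f s) = a * (LBINT s. stable_density \<alpha> (a * s) * f (a * s))"
    using integral_lborel_affine[of "\<lambda>s. stable_density \<alpha> s * f s" a 0] a by simp
  also have "\<dots> = (a * a powr (- 1 - \<alpha> / 2)) * (LBINT s. stable_density \<alpha> s * f (a * s))"
    by (simp add: K mult.assoc)
  also have "a * a powr (- 1 - \<alpha> / 2) = a powr (- (\<alpha> / 2))"
    using a powr_add[of a 1 "- 1 - \<alpha> / 2"] by simp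
  finally show ?thesis using a by (simp add: powr_minus field_simps)
qed

lemma stable_integral_lower_bound:
  fixes g :: "real \<Rightarrow> real"
  assumes i: "integrable lborel (\<lambda>s. stable_density \<alpha> s * g s)" and \<alpha>: "0 < \<alpha>"
    and nn: "\<And>s. 0 < s \<Longrightarrow> 0 \<le> g s" and a: "0 < a" and m: "0 \<le> m" "\<And>s. a \<le> s \<Longrightarrow> s \<le> 2 * a \<Longrightarrow> m \<le> g s"
  shows "m * 2 powr (- 1 - \<alpha> / 2) * a powr (- \<alpha> / 2) \<le> (LBINT s. stable_density \<alpha> s * g s)"
proof -
  have "m * 2 powr (- 1 - \<alpha> / 2) * a powr (- \<alpha> / 2) = m * a * (2 * a) powr (- 1 - \<alpha> / 2)"
    using a powr_add[of a 1 "- 1 - \<alpha> / 2"] by (simp add: powr_mult)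
  also have "\<dots> = (LBINT s. indicator {a..2*a} s * (m * (2 * a) powr (- 1 - \<alpha> / 2)))"
    using a by simp
  also have "\<dots> \<le> (LBINT s. stable_density \<alpha> s * g s)"
  proof (rule integral_mono[OF _ i])
    show "integrable lborel (\<lambda>s. indicator {a..2*a} s * (m * (2 * a) powr (- 1 - \<alpha> / 2)))"
      using a by (intro integrable_mult_left) auto
    show "indicator {a..2*a} s * (m * (2 * a) powr (- 1 - \<alpha> / 2)) \<le> stable_density \<alpha> s * g s" for s
    proof (cases "s \<in> {a..2*a}")
      case True
      then have "m * (2 * a) powr (- 1 - \<alpha> / 2) \<le> g s * s powr (- 1 - \<alpha> / 2)"
        using a m nn[of s] \<alpha> by (intro mult_mono powr_mono2') auto
      then show ?thesis using True a by (simp add: stable_density_def mult_ac)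
    next
      case False
      then show ?thesis using nn[of s] by (simp add: stable_density_def)
    qed
  qed
  finally show ?thesis .
qed

lemma one_minus_exp_le: "\<bar>1 - exp (- s)\<bar> \<le> 1" "\<bar>1 - exp (- s)\<bar> \<le> s" if "0 \<le> s" for s :: real
  using that exp_ge_add_one_self[of "- s"] by auto

lemma stable_mass_pos:
  assumes \<alpha>: "0 < \<alpha>" "\<alpha> < 2"
  shows "0 < stable_mass \<alpha>"
proof -
  have "integrable lborel (\<lambda>s. stable_density \<alpha> s *\<^sub>R (1 - exp (- s)))"
    using one_minus_exp_le by (intro stable_integrable[OF \<alpha>, where A=1 and B=1]) auto
  then have "(1 - exp (- 1)) * 2 powr (- 1 - \<alpha> / 2) * 1 powr (- \<alpha> / 2) \<le> stable_mass \<alpha>"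
    unfolding stable_mass_def using \<alpha> by (intro stable_integral_lower_bound) auto
  moreover have "0 < (1 - exp (- 1)) * 2 powr (- 1 - \<alpha> / 2) * (1::real) powr (- \<alpha> / 2)" by simp
  ultimately show ?thesis by linarith
qed

text \<open>Homogeneity of the density under scaling turns \<open>exp (- s r\<^sup>2)\<close> into the power \<open>r\<^sup>\<alpha>\<close>.\<close>

lemma stable_integral_exp:
  assumes \<alpha>: "0 < \<alpha>" "\<alpha> < 2" and r: "0 \<le> r"
  shows "(LBINT s. stable_density \<alpha> s * (1 - exp (- s * r\<^sup>2))) = r powr \<alpha> * stable_mass \<alpha>"
proof (cases "r = 0")
  case False
  with r have "(LBINT s. stable_density \<alpha> s * (1 - exp (- (r\<^sup>2 * s)))) = (r\<^sup>2) powr (\<alpha> / 2) * stable_mass \<alpha>"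
    unfolding stable_mass_def by (intro stable_integral_scale) auto
  moreover have "(r\<^sup>2) powr (\<alpha> / 2) = r powr \<alpha>"
    using r False by (simp add: powr_powr flip: powr_numeral)
  ultimately show ?thesis by (simp add: mult.commute)
qed simp

section \<open>The heat semigroup\<close>

lemma measurable_heat:
  assumes [measurable]: "f \<in> borel_measurable borel"
  shows "case_prod (\<lambda>s. heat s f) \<in> borel_measurable (borel \<Otimes>\<^sub>M (borel :: 'a::euclidean_space measure))"
proof -
  have "(\<lambda>p. LBINT y. f (snd p + y) * heat_kernel (fst p) y) \<in> borel_measurable (borel \<Otimes>\<^sub>M (borel :: 'a measure))"
    by measurable
  then show ?thesis by (simp add: heat_def case_prod_beta')
qed

lemma measurable_heat' [measurable (raw)]:
  assumes "f \<in> borel_measurable borel" "s \<in> borel_measurable M" "g \<in> M \<rightarrow>\<^sub>M (borel :: 'a::euclidean_space measure)"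
  shows "(\<lambda>x. heat (s x) f (g x)) \<in> borel_measurable M"
  using measurable_compose[OF measurable_Pair[OF assms(2,3)] measurable_heat[OF assms(1)]] by simp

lemma heat_eq_convolution:
  assumes "f \<in> borel_measurable borel"
  shows "heat s f x = (LBINT y. f y * heat_kernel s (y - x))"
  unfolding heat_def using assms by (subst integral_lborel_shift[symmetric, of _ x]) auto

lemma integrable_bounded_heat_kernel:
  fixes f :: "'a::euclidean_space \<Rightarrow> real"
  assumes [measurable]: "f \<in> borel_measurable borel" and b: "\<And>x. \<bar>f x\<bar> \<le> M" and s: "0 < s"
  shows "integrable lborel (\<lambda>y. f y * heat_kernel s y)"
  using b by (intro integrable_bounded_mult[where M=M] integral_heat_kernel s) auto

lemma heat_bounded:
  fixes f :: "'a::euclidean_space \<Rightarrow> real"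
  assumes f: "f \<in> borel_measurable borel" and b: "\<And>x. \<bar>f x\<bar> \<le> M" and s: "0 < s"
  shows "\<bar>heat s f x\<bar> \<le> M"
proof -
  have m[measurable]: "(\<lambda>y. f (x + y)) \<in> borel_measurable borel" using f by measurable
  have i: "integrable lborel (\<lambda>y. f (x + y) * heat_kernel s y)"
    using b s by (intro integrable_bounded_heat_kernel) auto
  have "\<bar>heat s f x\<bar> \<le> (LBINT y. M * heat_kernel s (y::'a))"
    unfolding heat_def
  proof (rule integral_abs_bound_integral[OF i])
    show "integrable lborel (\<lambda>y::'a. M * heat_kernel s y)"
      using integral_heat_kernel[OF s] by (intro integrable_mult_right)
    show "\<bar>f (x + y) * heat_kernel s y\<bar> \<le> M * heat_kernel s y" for y
      using b s by (auto simp: abs_mult intro!: mult_right_mono)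
  qed
  then show ?thesis by (simp add: integral_heat_kernel[OF s])
qed

lemma heat_kernel_scale:
  assumes l: "0 < l" and s: "0 < s"
  shows "l ^ DIM('a) * heat_kernel (l\<^sup>2 * s) (l *\<^sub>R z) = heat_kernel s (z::'a::euclidean_space)"
proof -
  have "sqrt (4 * pi * (l\<^sup>2 * s)) = l * sqrt (4 * pi * s)"
    using l by (simp add: real_sqrt_mult)
  then have a: "l * (1 / sqrt (4 * pi * (l\<^sup>2 * s))) = 1 / sqrt (4 * pi * s)"
    using l by simp
  have b: "(norm (l *\<^sub>R z))\<^sup>2 / (4 * (l\<^sup>2 * s)) = (norm z)\<^sup>2 / (4 * s)"
    using l s by (simp add: power_mult_distrib)
  have "l ^ DIM('a) * heat_kernel (l\<^sup>2 * s) (l *\<^sub>R z)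
     = (l * (1 / sqrt (4 * pi * (l\<^sup>2 * s)))) ^ DIM('a) * exp (- ((norm (l *\<^sub>R z))\<^sup>2 / (4 * (l\<^sup>2 * s))))"
    unfolding heat_kernel_def by (simp only: minus_divide_left[symmetric] mult.assoc[symmetric] power_mult_distrib)
  then show ?thesis
    unfolding a b by (simp add: heat_kernel_def)
qed

text \<open>Brownian scaling of the heat semigroup.\<close>

lemma heat_scale:
  fixes f :: "'a::euclidean_space \<Rightarrow> real"
  assumes [measurable]: "f \<in> borel_measurable borel" and l: "0 < l" and s: "0 < s"
  shows "heat (l\<^sup>2 * s) f x = (LBINT z. f (x + l *\<^sub>R z) * heat_kernel s z)"
proof -
  have "heat (l\<^sup>2 * s) f x = l ^ DIM('a) * (LBINT z. f (x + l *\<^sub>R z) * heat_kernel (l\<^sup>2 * s) (l *\<^sub>R z))"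
    unfolding heat_def using l by (subst integral_lborel_affine[of _ l 0]) auto
  also have "\<dots> = (LBINT z. f (x + l *\<^sub>R z) * (l ^ DIM('a) * heat_kernel (l\<^sup>2 * s) (l *\<^sub>R z)))"
    by (subst integral_mult_right_zero[symmetric]) (simp add: mult_ac)
  finally show ?thesis by (simp only: heat_kernel_scale[OF l s])
qed

lemma heat_tendsto:
  fixes f :: "'a::euclidean_space \<Rightarrow> real"
  assumes f: "continuous_on UNIV f" and b: "\<And>x. \<bar>f x\<bar> \<le> M" and h: "h \<longlonglongrightarrow> 0" "\<And>n. 0 < h n"
  shows "(\<lambda>n. heat ((h n)\<^sup>2) f x) \<longlonglongrightarrow> f x"
proof -
  have m[measurable]: "f \<in> borel_measurable borel" using f by (rule borel_measurable_continuous_onI)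
  have "(\<lambda>n. LBINT z. f (x + h n *\<^sub>R z) * heat_kernel 1 z) \<longlonglongrightarrow> (LBINT z. f x * heat_kernel 1 (z::'a))"
  proof (rule integral_dominated_convergence[where w="\<lambda>z. M * heat_kernel 1 z"])
    show "integrable lborel (\<lambda>z::'a. M * heat_kernel 1 z)"
      using integral_heat_kernel[of 1] by (intro integrable_mult_right) auto
    have "(\<lambda>n. f (x + h n *\<^sub>R z)) \<longlonglongrightarrow> f x" for z
    proof (rule isCont_tendsto_compose[of "x"])
      show "isCont f x" using f by (simp add: continuous_on_eq_continuous_at)
      have "(\<lambda>n. x + h n *\<^sub>R z) \<longlonglongrightarrow> x + 0 *\<^sub>R z" by (intro tendsto_intros h)
      then show "(\<lambda>n. x + h n *\<^sub>R z) \<longlonglongrightarrow> x" by simp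
    qed
    then show "AE z in lborel. (\<lambda>n. f (x + h n *\<^sub>R z) * heat_kernel 1 z) \<longlonglongrightarrow> f x * heat_kernel 1 z"
      by (auto intro!: tendsto_intros)
    show "AE z in lborel. norm (f (x + h n *\<^sub>R z) * heat_kernel 1 z) \<le> M * heat_kernel 1 z" for n
      using b by (auto simp: abs_mult intro!: mult_right_mono)
  qed simp_all
  moreover have "heat ((h n)\<^sup>2) f x = (LBINT z. f (x + h n *\<^sub>R z) * heat_kernel 1 z)" for n
    using heat_scale[OF m h(2), of 1 n] by simp
  ultimately show ?thesis by (simp add: integral_heat_kernel)
qed

text \<open>The second moment is bounded without being computed: \<open>t exp (- 2t) \<le> exp (- t)\<close> with \<open>t = |y|\<^sup>2 / 8s\<close>
  absorbs the factor \<open>|y|\<^sup>2\<close> at the cost of doubling the time.\<close>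

lemma heat_kernel_second_moment:
  assumes s: "0 < s"
  shows "integrable lborel (\<lambda>y::'a::euclidean_space. (norm y)\<^sup>2 * heat_kernel s y)"
    and "(LBINT y. (norm (y::'a))\<^sup>2 * heat_kernel s y) \<le> 8 * sqrt 2 ^ DIM('a) * s"
proof -
  let ?c = "8 * sqrt 2 ^ DIM('a) * s"
  have le: "(norm y)\<^sup>2 * heat_kernel s y \<le> ?c * heat_kernel (2 * s) y" for y :: 'a
  proof -
    define t where "t = (norm y)\<^sup>2 / (8 * s)"
    have n: "(norm y)\<^sup>2 = 8 * s * t" using s by (simp add: t_def)
    have t0: "0 \<le> t" using s by (simp add: t_def)
    have "t * exp (- t) \<le> 1"
      using exp_ge_add_one_self[of t] t0 by (simp add: exp_minus divide_simps del: exp_ge_add_one_self)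
    then have "t * exp (- t) * exp (- t) \<le> 1 * exp (- t)" by (intro mult_right_mono) auto
    then have *: "t * exp (- (2 * t)) \<le> exp (- t)" by (simp add: mult.assoc exp_add[symmetric])
    have q: "1 / sqrt (4 * pi * s) = sqrt 2 * (1 / sqrt (4 * pi * (2 * s)))"
    proof -
      have "sqrt (4 * pi * (2 * s)) = sqrt 2 * sqrt (4 * pi * s)" by (simp flip: real_sqrt_mult)
      then show ?thesis by simp
    qed
    have "(norm y)\<^sup>2 * heat_kernel s y = 8 * s * (1 / sqrt (4 * pi * s)) ^ DIM('a) * (t * exp (- (2 * t)))"
      using s by (simp add: heat_kernel_def n)
    also have "\<dots> \<le> 8 * s * (1 / sqrt (4 * pi * s)) ^ DIM('a) * exp (- t)"
      using s * by (intro mult_left_mono) auto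
    also have "\<dots> = ?c * heat_kernel (2 * s) y"
      unfolding q power_mult_distrib using s by (simp add: heat_kernel_def n)
    finally show ?thesis .
  qed
  have i: "integrable lborel (\<lambda>y::'a. ?c * heat_kernel (2 * s) y)"
    using s integral_heat_kernel(1)[of "2 * s"] by (intro integrable_mult_right) simp
  show j: "integrable lborel (\<lambda>y::'a. (norm y)\<^sup>2 * heat_kernel s y)"
    using le s by (intro integrable_lborel_bound[OF i]) (auto simp: abs_mult)
  have "(LBINT y. (norm (y::'a))\<^sup>2 * heat_kernel s y) \<le> (LBINT y. ?c * heat_kernel (2 * s) (y::'a))"
    using le by (intro integral_mono i j)
  then show "(LBINT y. (norm (y::'a))\<^sup>2 * heat_kernel s y) \<le> ?c"
    using s by (simp add: integral_heat_kernel)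
qed

section \<open>Fourier inversion and subordination\<close>

text \<open>Fubini and the explicit transform of the Gaussian: multiplication by \<open>exp (- s|\<xi>|\<^sup>2)\<close> on the Fourier
  side is convolution with the heat kernel.\<close>

lemma heat_fourier:
  fixes \<theta> :: "'a::euclidean_space \<Rightarrow> real"
  assumes t: "test_function \<theta>" and s: "0 < s"
  shows "(LBINT \<xi>. exp (- s * (norm \<xi>)\<^sup>2) *\<^sub>R (cis (\<xi> \<bullet> x) * fourier \<theta> \<xi>))
    = complex_of_real ((2 * pi) ^ DIM('a) * heat s \<theta> x)"
proof -
  note [measurable] = test_function_measurable[OF t]
  let ?F = "\<lambda>(\<xi>, y). cis (\<xi> \<bullet> (x - y)) * of_real (exp (- s * (norm \<xi>)\<^sup>2)) * of_real (\<theta> y)"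
  have F: "integrable (lborel \<Otimes>\<^sub>M lborel) ?F"
  proof (rule integrable_pair_bound)
    show "integrable lborel (\<lambda>\<xi>::'a. exp (- s * (norm \<xi>)\<^sup>2))"
      using integrable_Re[OF gaussian_fourier(1)[OF s, of "0::'a"]] by simp
    show "integrable lborel (\<lambda>y. \<bar>\<theta> y\<bar>)" using test_function_integrable[OF t] by simp
  qed (auto simp: norm_mult)
  have "(LBINT \<xi>. exp (- s * (norm \<xi>)\<^sup>2) *\<^sub>R (cis (\<xi> \<bullet> x) * fourier \<theta> \<xi>)) = (LBINT \<xi>. (LBINT y. ?F (\<xi>, y)))"
  proof (rule Bochner_Integration.integral_cong[OF refl])
    fix \<xi> :: 'a
    have "exp (- s * (norm \<xi>)\<^sup>2) *\<^sub>R (cis (\<xi> \<bullet> x) * fourier \<theta> \<xi>)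
       = (LBINT y. (complex_of_real (exp (- s * (norm \<xi>)\<^sup>2)) * cis (\<xi> \<bullet> x)) * (cis (- (\<xi> \<bullet> y)) * of_real (\<theta> y)))"
      unfolding fourier_def integral_mult_right_zero by (simp add: scaleR_conv_of_real mult.assoc)
    also have "\<dots> = (LBINT y. ?F (\<xi>, y))"
    proof -
      have "cis (\<xi> \<bullet> (x - y)) = cis (\<xi> \<bullet> x) * cis (- (\<xi> \<bullet> y))" for y
        by (simp add: cis_mult inner_diff_right)
      then show ?thesis by (simp add: mult_ac)
    qed
    finally show "exp (- s * (norm \<xi>)\<^sup>2) *\<^sub>R (cis (\<xi> \<bullet> x) * fourier \<theta> \<xi>) = (LBINT y. ?F (\<xi>, y))" .
  qed
  also have "\<dots> = (LBINT y. (LBINT \<xi>. ?F (\<xi>, y)))"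
    by (rule lborel_Fubini[OF F, symmetric])
  also have "\<dots> = (LBINT y. complex_of_real ((2 * pi) ^ DIM('a) * (\<theta> y * heat_kernel s (y - x))))"
    by (simp only: prod.case integral_mult_left_zero heat_kernel_eq_fourier[OF s])
       (simp add: heat_kernel_commute[of s x] mult_ac)
  also have "\<dots> = complex_of_real ((2 * pi) ^ DIM('a) * (LBINT y. \<theta> y * heat_kernel s (y - x)))"
    by (simp only: integral_complex_of_real integral_mult_right_zero)
  also have "(LBINT y. \<theta> y * heat_kernel s (y - x)) = heat s \<theta> x"
    by (rule heat_eq_convolution[symmetric]) measurable
  finally show ?thesis .
qed

lemma fourier_integrable_le:
  fixes \<theta> :: "'a::euclidean_space \<Rightarrow> real"
  assumes t: "test_function \<theta>" and [measurable]: "g \<in> borel_measurable borel" and g: "\<And>\<xi>. \<bar>g \<xi>\<bar> \<le> c * (1 + (norm \<xi>)\<^sup>2)"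
  shows "integrable lborel (\<lambda>\<xi>::'a. g \<xi> *\<^sub>R (cis (\<xi> \<bullet> x) * fourier \<theta> \<xi>))"
proof (rule integrable_lborel_bound)
  note [measurable] = measurable_fourier[OF test_function_measurable[OF t]]
  show "integrable lborel (\<lambda>\<xi>::'a. c * ((1 + (norm \<xi>)\<^sup>2) * norm (fourier \<theta> \<xi>)))"
    by (intro integrable_mult_right fourier_integrable t)
  show "(\<lambda>\<xi>. g \<xi> *\<^sub>R (cis (\<xi> \<bullet> x) * fourier \<theta> \<xi>)) \<in> borel_measurable borel" by measurable
  have "\<bar>g \<xi>\<bar> * norm (fourier \<theta> \<xi>) \<le> c * ((1 + (norm \<xi>)\<^sup>2) * norm (fourier \<theta> \<xi>))" for \<xi>
    using mult_right_mono[OF g norm_ge_zero] by (simp add: mult.assoc)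
  then show "norm (g \<xi> *\<^sub>R (cis (\<xi> \<bullet> x) * fourier \<theta> \<xi>)) \<le> c * ((1 + (norm \<xi>)\<^sup>2) * norm (fourier \<theta> \<xi>))" for \<xi>
    by (simp add: norm_mult)
qed

text \<open>The limit \<open>s \<rightarrow> 0\<close> of \<open>heat_fourier\<close>: the left-hand side converges because the transform of a test
  function is integrable, and the right-hand side because the heat kernels are an approximate identity.\<close>

lemma fourier_inversion:
  fixes \<theta> :: "'a::euclidean_space \<Rightarrow> real"
  assumes t: "test_function \<theta>"
  shows "(LBINT \<xi>. cis (\<xi> \<bullet> x) * fourier \<theta> \<xi>) = complex_of_real ((2 * pi) ^ DIM('a) * \<theta> x)"
proof -
  define h where "h = (\<lambda>n::nat. inverse (real (Suc n)))"
  have h: "h \<longlonglongrightarrow> 0" "\<And>n. 0 < h n" unfolding h_def by (rule LIMSEQ_inverse_real_of_nat) simp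
  note [measurable] = measurable_fourier[OF test_function_measurable[OF t]]
  obtain B where B: "\<And>x. \<bar>\<theta> x\<bar> \<le> B" using test_function_bounded[OF t] by metis
  let ?G = "\<lambda>\<xi>. cis (\<xi> \<bullet> x) * fourier \<theta> \<xi>"
  have i: "integrable lborel ?G"
    using fourier_integrable_le[OF t, of "\<lambda>_. 1" 1 x] by simp
  have "(\<lambda>n. LBINT \<xi>. exp (- (h n)\<^sup>2 * (norm \<xi>)\<^sup>2) *\<^sub>R ?G \<xi>) \<longlonglongrightarrow> (LBINT \<xi>. ?G \<xi>)"
  proof (rule integral_dominated_convergence[where w="\<lambda>\<xi>. norm (?G \<xi>)"])
    show "integrable lborel (\<lambda>\<xi>. norm (?G \<xi>))" using i by simp
    have "(\<lambda>n. exp (- (h n)\<^sup>2 * (norm \<xi>)\<^sup>2) *\<^sub>R ?G \<xi>) \<longlonglongrightarrow> exp (- 0\<^sup>2 * (norm \<xi>)\<^sup>2) *\<^sub>R ?G \<xi>" for \<xi>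
      by (intro tendsto_intros h)
    then show "AE \<xi> in lborel. (\<lambda>n. exp (- (h n)\<^sup>2 * (norm \<xi>)\<^sup>2) *\<^sub>R ?G \<xi>) \<longlonglongrightarrow> ?G \<xi>" by simp
    show "AE \<xi> in lborel. norm (exp (- (h n)\<^sup>2 * (norm \<xi>)\<^sup>2) *\<^sub>R ?G \<xi>) \<le> norm (?G \<xi>)" for n
      by (auto simp: norm_mult intro!: mult_left_le_one_le)
  qed simp_all
  moreover have "(LBINT \<xi>. exp (- (h n)\<^sup>2 * (norm \<xi>)\<^sup>2) *\<^sub>R ?G \<xi>) = complex_of_real ((2 * pi) ^ DIM('a) * heat ((h n)\<^sup>2) \<theta> x)" for n
    using h(2)[of n] by (intro heat_fourier t) auto
  ultimately have "(\<lambda>n. complex_of_real ((2 * pi) ^ DIM('a) * heat ((h n)\<^sup>2) \<theta> x)) \<longlonglongrightarrow> (LBINT \<xi>. ?G \<xi>)"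
    by simp
  moreover have "(\<lambda>n. complex_of_real ((2 * pi) ^ DIM('a) * heat ((h n)\<^sup>2) \<theta> x)) \<longlonglongrightarrow> complex_of_real ((2 * pi) ^ DIM('a) * \<theta> x)"
    by (intro tendsto_of_real tendsto_mult_left heat_tendsto[OF test_function_continuous[OF t] B h])
  ultimately show ?thesis by (rule LIMSEQ_unique)
qed

lemma powr_le_one_plus_sq:
  fixes r :: real
  assumes "0 < \<alpha>" "\<alpha> < 2" "0 \<le> r" shows "r powr \<alpha> \<le> 1 + r\<^sup>2"
proof (cases "r \<le> 1")
  case True
  then have "r powr \<alpha> \<le> 1" using assms by (intro powr_le1) auto
  then show ?thesis by (simp add: add_increasing2)
next
  case False
  then have "r powr \<alpha> \<le> r powr 2" using assms by (intro powr_mono) auto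
  then show ?thesis using False by simp
qed

text \<open>Bochner's subordination formula.  On the Fourier side it is \<open>stable_integral_exp\<close> with \<open>r = |\<xi>|\<close>;
  the integrals over \<open>s\<close> and \<open>\<xi>\<close> may be exchanged since \<open>|\<xi>|\<^sup>\<alpha>\<close> times the transform of \<open>\<theta>\<close> is integrable.\<close>

theorem frac_laplacian_eq_heat:
  fixes \<theta> :: "'a::euclidean_space \<Rightarrow> real"
  assumes \<alpha>: "0 < \<alpha>" "\<alpha> < 2" and t: "test_function \<theta>"
  shows "frac_laplacian \<alpha> \<theta> x = (LBINT s. stable_density \<alpha> s * (heat s \<theta> x - \<theta> x)) / stable_mass \<alpha>"
proof -
  note [measurable] = measurable_fourier[OF test_function_measurable[OF t]]
  let ?C = "(2 * pi) ^ DIM('a)"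
  let ?G = "\<lambda>\<xi>. cis (\<xi> \<bullet> x) * fourier \<theta> \<xi>"
  let ?e = "\<lambda>s \<xi>::'a. exp (- s * (norm \<xi>)\<^sup>2) - 1"
  let ?F = "\<lambda>(\<xi>, s). stable_density \<alpha> s *\<^sub>R ?e s \<xi> *\<^sub>R ?G \<xi>"
  have ni: "integrable lborel (\<lambda>s. stable_density \<alpha> s *\<^sub>R ?e s \<xi>)" for \<xi> :: 'a
    by (rule stable_integrable[OF \<alpha>, where A=1 and B="(norm \<xi>)\<^sup>2"])
       (use one_minus_exp_le[of "_ * (norm \<xi>)\<^sup>2"] in \<open>auto simp: abs_minus_commute mult_ac\<close>)
  have Fs: "(LBINT s. ?F (\<xi>, s)) = (- (norm \<xi> powr \<alpha>) * stable_mass \<alpha>) *\<^sub>R ?G \<xi>" for \<xi> :: 'a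
  proof -
    have "(LBINT s. ?F (\<xi>, s)) = (LBINT s. (stable_density \<alpha> s *\<^sub>R ?e s \<xi>) *\<^sub>R ?G \<xi>)" by simp
    also have "\<dots> = (LBINT s. stable_density \<alpha> s *\<^sub>R ?e s \<xi>) *\<^sub>R ?G \<xi>"
      by (rule integral_scaleR_left) (use ni in auto)
    also have "(LBINT s. stable_density \<alpha> s *\<^sub>R ?e s \<xi>) = - (LBINT s. stable_density \<alpha> s * (1 - exp (- s * (norm \<xi>)\<^sup>2)))"
      by (subst Bochner_Integration.integral_minus[symmetric]) (simp add: algebra_simps)
    finally show ?thesis using stable_integral_exp[OF \<alpha>, of "norm \<xi>"] by simp
  qed
  have F: "integrable (lborel \<Otimes>\<^sub>M lborel) ?F"
  proof (rule integrable_pairI)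
    show "integrable lborel (\<lambda>s. ?F (\<xi>, s))" for \<xi>
    proof -
      have "integrable lborel (\<lambda>s. (stable_density \<alpha> s *\<^sub>R ?e s \<xi>) *\<^sub>R ?G \<xi>)"
        by (intro integrable_scaleR_left ni)
      then show ?thesis by simp
    qed
    show "integrable lborel (\<lambda>\<xi>::'a. stable_mass \<alpha> * ((1 + (norm \<xi>)\<^sup>2) * norm (fourier \<theta> \<xi>)))"
      by (intro integrable_mult_right fourier_integrable t)
    show "(LBINT s. norm (?F (\<xi>, s))) \<le> stable_mass \<alpha> * ((1 + (norm \<xi>)\<^sup>2) * norm (fourier \<theta> \<xi>))" for \<xi>
    proof -
      have "(LBINT s. norm (?F (\<xi>, s))) = (LBINT s. stable_density \<alpha> s * (1 - exp (- s * (norm \<xi>)\<^sup>2)) * norm (fourier \<theta> \<xi>))"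
      proof (rule Bochner_Integration.integral_cong[OF refl])
        fix s :: real
        show "norm (?F (\<xi>, s)) = stable_density \<alpha> s * (1 - exp (- s * (norm \<xi>)\<^sup>2)) * norm (fourier \<theta> \<xi>)"
        proof (cases "0 < s")
          case True
          then have "\<bar>?e s \<xi>\<bar> = 1 - exp (- s * (norm \<xi>)\<^sup>2)" by simp
          then show ?thesis by (simp add: norm_mult abs_mult)
        qed (simp add: stable_density_def)
      qed
      also have "\<dots> = norm \<xi> powr \<alpha> * stable_mass \<alpha> * norm (fourier \<theta> \<xi>)"
        using stable_integral_exp[OF \<alpha>, of "norm \<xi>"] by simp
      also have "\<dots> = stable_mass \<alpha> * (norm \<xi> powr \<alpha> * norm (fourier \<theta> \<xi>))" by simp
      also have "\<dots> \<le> stable_mass \<alpha> * ((1 + (norm \<xi>)\<^sup>2) * norm (fourier \<theta> \<xi>))"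
        using powr_le_one_plus_sq[OF \<alpha>, of "norm \<xi>"] stable_mass_pos[OF \<alpha>]
        by (intro mult_left_mono mult_right_mono) auto
      finally show ?thesis .
    qed
    show "?F \<in> borel_measurable (borel \<Otimes>\<^sub>M borel)" by measurable
  qed
  have heat: "complex_of_real (heat s \<theta> x - \<theta> x) = (LBINT \<xi>. ?e s \<xi> *\<^sub>R ?G \<xi>) / complex_of_real ?C" if s: "0 < s" for s
  proof -
    have "(LBINT \<xi>. ?e s \<xi> *\<^sub>R ?G \<xi>) = (LBINT \<xi>. exp (- s * (norm \<xi>)\<^sup>2) *\<^sub>R ?G \<xi> - ?G \<xi>)"
      by (simp add: scaleR_diff_left)
    also have "\<dots> = (LBINT \<xi>. exp (- s * (norm \<xi>)\<^sup>2) *\<^sub>R ?G \<xi>) - (LBINT \<xi>. ?G \<xi>)"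
    proof (rule Bochner_Integration.integral_diff)
      show "integrable lborel ?G" using fourier_integrable_le[OF t, of "\<lambda>_. 1" 1 x] by simp
      show "integrable lborel (\<lambda>\<xi>. exp (- s * (norm \<xi>)\<^sup>2) *\<^sub>R ?G \<xi>)"
        using s by (intro fourier_integrable_le[OF t, where c=1]) (auto simp: add_increasing2)
    qed
    finally show ?thesis
      unfolding heat_fourier[OF t s] fourier_inversion[OF t] by (simp add: field_simps)
  qed
  have "complex_of_real (LBINT s. stable_density \<alpha> s * (heat s \<theta> x - \<theta> x))
      = (LBINT s. stable_density \<alpha> s *\<^sub>R complex_of_real (heat s \<theta> x - \<theta> x))"
    by (simp only: scaleR_conv_of_real of_real_mult[symmetric] integral_complex_of_real)
  also have "\<dots> = (LBINT s. (LBINT \<xi>. ?F (\<xi>, s)) / complex_of_real ?C)"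
  proof (rule Bochner_Integration.integral_cong[OF refl])
    fix s
    show "stable_density \<alpha> s *\<^sub>R complex_of_real (heat s \<theta> x - \<theta> x) = (LBINT \<xi>. ?F (\<xi>, s)) / complex_of_real ?C"
    proof (cases "0 < s")
      case True
      have "(LBINT \<xi>. ?F (\<xi>, s)) = stable_density \<alpha> s *\<^sub>R (LBINT \<xi>. ?e s \<xi> *\<^sub>R ?G \<xi>)"
        by (simp only: prod.case integral_scaleR_right)
      then show ?thesis unfolding heat[OF True] by (simp only: scaleR_conv_of_real times_divide_eq_right)
    qed (simp add: stable_density_def)
  qed
  also have "\<dots> = (LBINT s. (LBINT \<xi>. ?F (\<xi>, s))) / complex_of_real ?C"
    by (rule integral_divide_zero)
  also have "(LBINT s. (LBINT \<xi>. ?F (\<xi>, s))) = (LBINT \<xi>. (LBINT s. ?F (\<xi>, s)))"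
    by (rule lborel_Fubini[OF F])
  also have "\<dots> = (LBINT \<xi>. complex_of_real (stable_mass \<alpha>) * (cis (\<xi> \<bullet> x) * of_real (- (norm \<xi> powr \<alpha>)) * fourier \<theta> \<xi>))"
    unfolding Fs by (simp add: scaleR_conv_of_real mult_ac)
  also have "\<dots> = complex_of_real (stable_mass \<alpha>) * (LBINT \<xi>. cis (\<xi> \<bullet> x) * of_real (- (norm \<xi> powr \<alpha>)) * fourier \<theta> \<xi>)"
    by (rule integral_mult_right_zero)
  finally have eq: "complex_of_real (LBINT s. stable_density \<alpha> s * (heat s \<theta> x - \<theta> x))
     = complex_of_real (stable_mass \<alpha>) * (LBINT \<xi>. cis (\<xi> \<bullet> x) * of_real (- (norm \<xi> powr \<alpha>)) * fourier \<theta> \<xi>) / complex_of_real ?C" .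
  have *: "I / complex_of_real c = complex_of_real (A / m)"
    if "complex_of_real A = complex_of_real m * I / complex_of_real c" "0 < m" for A m c I
  proof -
    have "complex_of_real (A / m) = complex_of_real m * I / complex_of_real c / complex_of_real m"
      by (simp only: of_real_divide that(1))
    then show ?thesis using that(2) by simp
  qed
  show ?thesis
    unfolding frac_laplacian_def *[OF eq stable_mass_pos[OF \<alpha>]] by (rule Re_complex_of_real)
qed

section \<open>The weak form of the fractional Laplacian\<close>

lemma one_minus_cos_le: "2 - 2 * cos t \<le> t\<^sup>2" for t :: real
proof -
  have "cos t = 1 - 2 * (sin (t / 2))\<^sup>2" using cos_double_sin[of "t / 2"] by simp
  moreover have "(sin (t / 2))\<^sup>2 \<le> (t / 2)\<^sup>2"
    using abs_sin_x_le_abs_x[of "t / 2"] by (rule abs_le_square_iff[THEN iffD1])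
  ultimately show ?thesis by (simp add: power_divide)
qed

text \<open>By Fourier inversion the second difference has the multiplier \<open>2 cos (\<xi> \<bullet> y) - 2\<close>, which is at most
  \<open>|\<xi>|\<^sup>2 |y|\<^sup>2\<close> in absolute value.\<close>

lemma test_function_second_difference:
  fixes \<theta> :: "'a::euclidean_space \<Rightarrow> real"
  assumes t: "test_function \<theta>"
  obtains M where "0 \<le> M" "\<And>x y. \<bar>\<theta> (x + y) + \<theta> (x - y) - 2 * \<theta> x\<bar> \<le> M * (norm y)\<^sup>2"
proof -
  let ?C = "(2 * pi) ^ DIM('a)"
  define J where "J = (LBINT \<xi>. (1 + (norm (\<xi>::'a))\<^sup>2) * norm (fourier \<theta> \<xi>))"
  have iJ: "integrable lborel (\<lambda>\<xi>::'a. (1 + (norm \<xi>)\<^sup>2) * norm (fourier \<theta> \<xi>))"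
    by (rule fourier_integrable[OF t])
  have "0 \<le> J" unfolding J_def by (rule integral_nonneg_AE) simp
  have "\<bar>\<theta> (x + y) + \<theta> (x - y) - 2 * \<theta> x\<bar> \<le> J / ?C * (norm y)\<^sup>2" for x y
  proof -
    let ?G = "\<lambda>x \<xi>. cis (\<xi> \<bullet> x) * fourier \<theta> \<xi>"
    have i: "integrable lborel (?G x)" for x
      using fourier_integrable_le[OF t, of "\<lambda>_. 1" 1 x] by simp
    have e: "?G (x + y) \<xi> + ?G (x - y) \<xi> - 2 * ?G x \<xi> = (2 * cos (\<xi> \<bullet> y) - 2) *\<^sub>R ?G x \<xi>" for \<xi>
    proof -
      have "cis (\<xi> \<bullet> (x + y)) = cis (\<xi> \<bullet> x) * cis (\<xi> \<bullet> y)" "cis (\<xi> \<bullet> (x - y)) = cis (\<xi> \<bullet> x) * cis (- (\<xi> \<bullet> y))"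
        by (simp_all add: cis_mult inner_add_right inner_diff_right)
      moreover have "cis (- (\<xi> \<bullet> y)) = 2 * of_real (cos (\<xi> \<bullet> y)) - cis (\<xi> \<bullet> y)"
        by (simp add: complex_eq_iff)
      ultimately show ?thesis
        by (simp only: scaleR_conv_of_real) (simp add: algebra_simps)
    qed
    have "complex_of_real (?C * (\<theta> (x + y) + \<theta> (x - y) - 2 * \<theta> x))
      = (LBINT \<xi>. ?G (x + y) \<xi>) + (LBINT \<xi>. ?G (x - y) \<xi>) - 2 * (LBINT \<xi>. ?G x \<xi>)"
      unfolding fourier_inversion[OF t] by (simp add: algebra_simps)
    also have "\<dots> = (LBINT \<xi>. ?G (x + y) \<xi> + ?G (x - y) \<xi> - 2 * ?G x \<xi>)"
      using i by (subst Bochner_Integration.integral_diff, simp, simp, subst Bochner_Integration.integral_add, simp_all)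
    also have "\<dots> = (LBINT \<xi>. (2 * cos (\<xi> \<bullet> y) - 2) *\<^sub>R ?G x \<xi>)" unfolding e ..
    finally have "norm (complex_of_real (?C * (\<theta> (x + y) + \<theta> (x - y) - 2 * \<theta> x)))
      = norm (LBINT \<xi>. (2 * cos (\<xi> \<bullet> y) - 2) *\<^sub>R ?G x \<xi>)" by (rule arg_cong)
    also have "\<dots> \<le> (LBINT \<xi>. (norm y)\<^sup>2 * ((1 + (norm \<xi>)\<^sup>2) * norm (fourier \<theta> \<xi>)))"
    proof (rule Bochner_Integration.integral_norm_bound_integral)
      have b: "\<bar>2 * cos (\<xi> \<bullet> y) - 2\<bar> \<le> (norm y)\<^sup>2 * (1 + (norm \<xi>)\<^sup>2)" for \<xi>
      proof -
        have "\<bar>2 * cos (\<xi> \<bullet> y) - 2\<bar> \<le> (\<xi> \<bullet> y)\<^sup>2"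
          using one_minus_cos_le[of "\<xi> \<bullet> y"] cos_le_one[of "\<xi> \<bullet> y"] by linarith
        also have "\<dots> \<le> (norm \<xi> * norm y)\<^sup>2"
          using Cauchy_Schwarz_ineq2[of \<xi> y] by (simp add: abs_le_square_iff[symmetric])
        also have "\<dots> \<le> (norm y)\<^sup>2 * (1 + (norm \<xi>)\<^sup>2)" by (simp add: power_mult_distrib algebra_simps)
        finally show ?thesis .
      qed
      show "integrable lborel (\<lambda>\<xi>. (2 * cos (\<xi> \<bullet> y) - 2) *\<^sub>R ?G x \<xi>)"
        using b by (intro fourier_integrable_le[OF t]) auto
      show "integrable lborel (\<lambda>\<xi>::'a. (norm y)\<^sup>2 * ((1 + (norm \<xi>)\<^sup>2) * norm (fourier \<theta> \<xi>)))"
        by (intro integrable_mult_right iJ)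
      show "norm ((2 * cos (\<xi> \<bullet> y) - 2) *\<^sub>R ?G x \<xi>) \<le> (norm y)\<^sup>2 * ((1 + (norm \<xi>)\<^sup>2) * norm (fourier \<theta> \<xi>))" for \<xi>
        using mult_right_mono[OF b, of "norm (fourier \<theta> \<xi>)" \<xi>] by (simp add: norm_mult mult.assoc)
    qed
    also have "\<dots> = (norm y)\<^sup>2 * J" unfolding J_def by simp
    finally have "?C * \<bar>\<theta> (x + y) + \<theta> (x - y) - 2 * \<theta> x\<bar> \<le> (norm y)\<^sup>2 * J"
      unfolding norm_of_real by (simp add: abs_mult)
    then show ?thesis by (simp add: field_simps)
  qed
  moreover have "0 \<le> J / ?C" using \<open>0 \<le> J\<close> by simp
  ultimately show ?thesis using that by blast
qed

text \<open>In the \<open>L\<^sup>1\<close> norm the second difference is \<open>O(|y|\<^sup>2)\<close>: for \<open>|y| \<le> 1\<close> the uniform bound is integrated over a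
  fixed ball that contains the support, and for \<open>|y| > 1\<close> already the trivial bound by four times
  the norm of \<open>\<theta>\<close> suffices.\<close>

lemma test_function_second_difference_integral:
  fixes \<theta> :: "'a::euclidean_space \<Rightarrow> real"
  assumes t: "test_function \<theta>"
  defines "\<delta> \<equiv> \<lambda>x y. \<theta> (x + y) + \<theta> (x - y) - 2 * \<theta> x"
  obtains M A where "0 \<le> M" "0 \<le> A" "\<And>y. integrable lborel (\<lambda>x. \<delta> x y)"
    "\<And>y. (LBINT x. \<bar>\<delta> x y\<bar>) \<le> A" "\<And>y. (LBINT x. \<bar>\<delta> x y\<bar>) \<le> M * (norm y)\<^sup>2"
proof -
  obtain M where M: "0 \<le> M" "\<And>x y. \<bar>\<delta> x y\<bar> \<le> M * (norm y)\<^sup>2"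
    unfolding \<delta>_def using test_function_second_difference[OF t] by metis
  obtain r where r: "0 < r" "\<And>x. r < norm x \<Longrightarrow> \<theta> x = 0"
    using test_function_bounded_support[OF t] by blast
  define A where "A = 4 * (LBINT x. \<bar>\<theta> x\<bar>)"
  have A0: "0 \<le> A" unfolding A_def by simp
  have it: "integrable lborel \<theta>" by (rule test_function_integrable[OF t])
  note [measurable] = test_function_measurable[OF t]
  have i1: "integrable lborel (\<lambda>x. \<theta> (x + y))" for y
    using integrable_lborel_shift[OF it, of y] by (simp add: add.commute)
  have i2: "integrable lborel (\<lambda>x. \<theta> (x - y))" for y
    using i1[of "- y"] by simp
  have id: "integrable lborel (\<lambda>x. \<delta> x y)" for y
    unfolding \<delta>_def using i1 i2 it by simp
  have dA: "(LBINT x. \<bar>\<delta> x y\<bar>) \<le> A" for y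
  proof -
    have e1: "(LBINT x. \<bar>\<theta> (x + y)\<bar>) = (LBINT x. \<bar>\<theta> x\<bar>)" for y
      using integral_lborel_shift[of "\<lambda>x. \<bar>\<theta> x\<bar>" y] by (simp add: add.commute)
    have "(LBINT x. \<bar>\<delta> x y\<bar>) \<le> (LBINT x. \<bar>\<theta> (x + y)\<bar> + \<bar>\<theta> (x - y)\<bar> + 2 * \<bar>\<theta> x\<bar>)"
      using id i1 i2 it by (intro integral_mono) (auto simp: \<delta>_def)
    also have "\<dots> = A"
      using i1 i2 it e1[of y] e1[of "- y"] by (simp add: A_def)
    finally show ?thesis .
  qed
  define m where "m = measure lborel (cball (0::'a) (r + 1))"
  have m0: "0 \<le> m" by (simp add: m_def)
  have dM: "(LBINT x. \<bar>\<delta> x y\<bar>) \<le> (M * m + A) * (norm y)\<^sup>2" for y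
  proof (cases "norm y \<le> 1")
    case True
    have "(LBINT x. \<bar>\<delta> x y\<bar>) \<le> (LBINT x. (M * (norm y)\<^sup>2) * indicator (cball 0 (r + 1)) (x::'a))"
    proof (rule integral_mono)
      show "integrable lborel (\<lambda>x. \<bar>\<delta> x y\<bar>)" using id by simp
      show "integrable lborel (\<lambda>x::'a. (M * (norm y)\<^sup>2) * indicator (cball 0 (r + 1)) x)"
        using emeasure_lborel_cball_finite[of "0::'a" "r + 1"] by (intro integrable_mult_right) simp
      show "\<bar>\<delta> x y\<bar> \<le> (M * (norm y)\<^sup>2) * indicator (cball 0 (r + 1)) x" for x
      proof (cases "norm x \<le> r + 1")
        case False
        have "r < norm (x + y)" "r < norm (x - y)" "r < norm x"
          using True False norm_triangle_ineq4[of "x + y" y] norm_triangle_ineq[of "x - y" y] by auto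
        then show ?thesis using r(2) M(1) by (simp add: \<delta>_def)
      qed (use M in auto)
    qed
    also have "\<dots> = M * m * (norm y)\<^sup>2" by (simp add: m_def)
    also have "\<dots> \<le> (M * m + A) * (norm y)\<^sup>2" using A0 by (intro mult_right_mono) auto
    finally show ?thesis .
  next
    case False
    have "A \<le> A * (norm y)\<^sup>2" using False A0 by (simp add: mult_le_cancel_left1 one_le_power)
    also have "\<dots> \<le> (M * m + A) * (norm y)\<^sup>2" using M(1) m0 by (intro mult_right_mono) auto
    finally show ?thesis using dA[of y] by simp
  qed
  have "0 \<le> M * m + A" using M(1) m0 A0 by simp
  then show ?thesis using that[OF _ A0 id dA dM] by blast
qed

text \<open>Averaging over \<open>y\<close> and \<open>- y\<close> removes the first-order term.\<close>

lemma heat_minus_self: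
  fixes \<theta> :: "'a::euclidean_space \<Rightarrow> real"
  assumes [measurable]: "\<theta> \<in> borel_measurable borel" and b: "\<And>x. \<bar>\<theta> x\<bar> \<le> B" and s: "0 < s"
  shows "heat s \<theta> x - \<theta> x = (LBINT y. (\<theta> (x + y) + \<theta> (x - y) - 2 * \<theta> x) * heat_kernel s y) / 2"
proof -
  have i: "integrable lborel (\<lambda>y. \<theta> (x + y) * heat_kernel s y)" "integrable lborel (\<lambda>y. \<theta> (x - y) * heat_kernel s y)"
    "integrable lborel (\<lambda>y::'a. 2 * \<theta> x * heat_kernel s y)"
    using b s by (auto intro!: integrable_bounded_heat_kernel integral_heat_kernel)
  have r: "(LBINT y. \<theta> (x - y) * heat_kernel s y) = heat s \<theta> x"
    unfolding heat_def using integral_lborel_reflect[of "\<lambda>y. \<theta> (x + y) * heat_kernel s y" 0] by simp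
  have "(LBINT y. (\<theta> (x + y) + \<theta> (x - y) - 2 * \<theta> x) * heat_kernel s y)
    = (LBINT y. (\<theta> (x + y) * heat_kernel s y + \<theta> (x - y) * heat_kernel s y) - 2 * \<theta> x * heat_kernel s y)"
    by (simp add: algebra_simps)
  also have "\<dots> = 2 * heat s \<theta> x - 2 * \<theta> x"
    using i r integral_heat_kernel[OF s, where 'a='a]
    by (subst Bochner_Integration.integral_diff, simp, simp, subst Bochner_Integration.integral_add, simp_all add: heat_def)
  finally show ?thesis by simp
qed

text \<open>This estimate makes \<open>\<Delta>\<^sup>\<alpha>\<^sup>/\<^sup>2 \<theta>\<close> integrable over the whole space, so that it can be tested against bounded
  functions that do not decay.\<close>

lemma heat_L1_modulus:
  fixes \<theta> :: "'a::euclidean_space \<Rightarrow> real"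
  assumes t: "test_function \<theta>"
  obtains A C where "\<And>s. 0 < s \<Longrightarrow> integrable lborel (\<lambda>x. heat s \<theta> x - \<theta> x)"
    "\<And>s. 0 < s \<Longrightarrow> (LBINT x. \<bar>heat s \<theta> x - \<theta> x\<bar>) \<le> A"
    "\<And>s. 0 < s \<Longrightarrow> (LBINT x. \<bar>heat s \<theta> x - \<theta> x\<bar>) \<le> C * s"
proof -
  define \<delta> where "\<delta> = (\<lambda>x y. \<theta> (x + y) + \<theta> (x - y) - 2 * \<theta> x)"
  note [measurable] = test_function_measurable[OF t]
  obtain B where B: "\<And>x. \<bar>\<theta> x\<bar> \<le> B" using test_function_bounded[OF t] by metis
  obtain M A where M: "0 \<le> M" "0 \<le> A" "\<And>y. integrable lborel (\<lambda>x. \<delta> x y)"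
    "\<And>y. (LBINT x. \<bar>\<delta> x y\<bar>) \<le> A" "\<And>y. (LBINT x. \<bar>\<delta> x y\<bar>) \<le> M * (norm y)\<^sup>2"
    unfolding \<delta>_def using test_function_second_difference_integral[OF t] by blast
  have *: "integrable lborel (\<lambda>x. heat s \<theta> x - \<theta> x) \<and>
      (LBINT x. \<bar>heat s \<theta> x - \<theta> x\<bar>) \<le> (LBINT y. d y * heat_kernel s y)"
    if s: "0 < s" and d: "\<And>y. (LBINT x. \<bar>\<delta> x y\<bar>) \<le> d y" and id: "integrable lborel (\<lambda>y. d y * heat_kernel s y)" for s d
  proof -
    let ?F = "\<lambda>(y, x). \<delta> x y * heat_kernel s y"
    have [measurable]: "?F \<in> borel_measurable (borel \<Otimes>\<^sub>M borel)" unfolding \<delta>_def by measurable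
    have Fb: "(LBINT x. norm (?F (y, x))) \<le> d y * heat_kernel s y" for y
      using s d[of y] by (simp add: abs_mult mult_right_mono)
    have F: "integrable (lborel \<Otimes>\<^sub>M lborel) ?F"
      using M(3) id Fb by (intro integrable_pairI[where b="\<lambda>y. d y * heat_kernel s y"]) auto
    then have Fn: "integrable (lborel \<Otimes>\<^sub>M lborel) (\<lambda>p. norm (?F p))" by (rule integrable_norm)
    have e: "heat s \<theta> x - \<theta> x = (LBINT y. ?F (y, x)) / 2" for x
      using heat_minus_self[OF test_function_measurable[OF t] B s, where x=x] by (simp add: \<delta>_def)
    have i: "integrable lborel (\<lambda>x. LBINT y. ?F (y, x))"
      using lborel_pair.integrable_snd[of "\<lambda>y x. ?F (y, x)"] F by simp
    have j: "integrable lborel (\<lambda>x. LBINT y. norm (?F (y, x)))"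
      using lborel_pair.integrable_snd[of "\<lambda>y x. norm (?F (y, x))"] Fn by (simp add: case_prod_beta')
    have k: "integrable lborel (\<lambda>y. LBINT x. norm (?F (y, x)))"
      using lborel_pair.integrable_fst[of "\<lambda>y x. norm (?F (y, x))"] Fn by (simp add: case_prod_beta')
    have "(LBINT x. \<bar>heat s \<theta> x - \<theta> x\<bar>) \<le> (LBINT x. (LBINT y. norm (?F (y, x))))"
    proof (rule integral_mono[OF _ j])
      show "integrable lborel (\<lambda>x. \<bar>heat s \<theta> x - \<theta> x\<bar>)" unfolding e using i by simp
      show "\<bar>heat s \<theta> x - \<theta> x\<bar> \<le> (LBINT y. norm (?F (y, x)))" for x
      proof -
        have "\<bar>LBINT y. ?F (y, x)\<bar> \<le> (LBINT y. norm (?F (y, x)))"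
          using integral_norm_bound[of lborel "\<lambda>y. ?F (y, x)"] by simp
        moreover have "0 \<le> (LBINT y. norm (?F (y, x)))" by (rule integral_nonneg_AE) simp
        ultimately show ?thesis unfolding e by linarith
      qed
    qed
    also have "\<dots> = (LBINT y. (LBINT x. norm (?F (y, x))))"
      by (rule lborel_Fubini[OF Fn])
    also have "\<dots> \<le> (LBINT y. d y * heat_kernel s y)"
      by (intro integral_mono k id Fb)
    finally show ?thesis unfolding e using i by simp
  qed
  show ?thesis
  proof (rule that)
    fix s :: real assume s: "0 < s"
    have ia: "integrable lborel (\<lambda>y::'a. A * heat_kernel s y)"
      using integral_heat_kernel[OF s] by (intro integrable_mult_right) auto
    show "integrable lborel (\<lambda>x. heat s \<theta> x - \<theta> x)" "(LBINT x. \<bar>heat s \<theta> x - \<theta> x\<bar>) \<le> A"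
      using *[OF s M(4) ia] by (simp_all add: integral_heat_kernel[OF s])
    have im: "integrable lborel (\<lambda>y::'a. M * (norm y)\<^sup>2 * heat_kernel s y)"
      unfolding mult.assoc using heat_kernel_second_moment[OF s] by (intro integrable_mult_right) auto
    have "(LBINT x. \<bar>heat s \<theta> x - \<theta> x\<bar>) \<le> M * (LBINT y. (norm y)\<^sup>2 * heat_kernel s (y::'a))"
      using *[OF s M(5) im] by (simp add: mult.assoc)
    also have "\<dots> \<le> M * (8 * sqrt 2 ^ DIM('a) * s)"
      by (intro mult_left_mono heat_kernel_second_moment s M)
    finally show "(LBINT x. \<bar>heat s \<theta> x - \<theta> x\<bar>) \<le> (M * (8 * sqrt 2 ^ DIM('a))) * s" by (simp add: mult.assoc)
  qed
qed

lemma heat_symmetric: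
  fixes u \<theta> :: "'a::euclidean_space \<Rightarrow> real"
  assumes [measurable]: "u \<in> borel_measurable borel" and u: "\<And>x. \<bar>u x\<bar> \<le> M"
    and it: "integrable lborel \<theta>" and s: "0 < s"
  shows "(LBINT x. u x * heat s \<theta> x) = (LBINT x. \<theta> x * heat s u x)"
proof -
  have tm[measurable]: "\<theta> \<in> borel_measurable borel" using it borel_measurable_integrable by simp
  let ?F = "\<lambda>(z, x). \<theta> z * (u x * heat_kernel s (x - z))"
  have F: "integrable (lborel \<Otimes>\<^sub>M lborel) ?F"
  proof (rule integrable_pairI)
    show "integrable lborel (\<lambda>x. ?F (z, x))" for z
    proof -
      have "integrable lborel (\<lambda>x. heat_kernel s (x - z))"
        using integrable_lborel_shift[OF integral_heat_kernel(1)[OF s], of "- z"] by simp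
      then have "integrable lborel (\<lambda>x. u x * heat_kernel s (x - z))"
        using u by (intro integrable_bounded_mult[where M=M]) auto
      then show ?thesis by simp
    qed
    show "integrable lborel (\<lambda>z. \<bar>\<theta> z\<bar> * M)" using it by simp
    show "(LBINT x. norm (?F (z, x))) \<le> \<bar>\<theta> z\<bar> * M" for z
    proof -
      have "heat s (\<lambda>x. \<bar>u x\<bar>) z \<le> M"
        using heat_bounded[of "\<lambda>x. \<bar>u x\<bar>" M s z] u s by simp
      then show ?thesis using s by (simp add: heat_eq_convolution abs_mult mult_left_mono)
    qed
  qed measurable
  have "(LBINT x. u x * heat s \<theta> x) = (LBINT x. (LBINT z. ?F (z, x)))"
    unfolding heat_eq_convolution[OF tm] by (subst heat_kernel_commute) (simp add: mult.left_commute[of "\<theta> _"])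
  also have "\<dots> = (LBINT z. (LBINT x. ?F (z, x)))"
    by (rule lborel_Fubini[OF F])
  also have "\<dots> = (LBINT z. \<theta> z * heat s u z)"
    by (simp add: heat_eq_convolution)
  finally show ?thesis .
qed

text \<open>\<open>\<Delta>\<^sup>\<alpha>\<^sup>/\<^sup>2\<close> in subordinated form.  It makes sense pointwise for bounded functions without a Fourier
  transform.\<close>

definition stable_generator :: "real \<Rightarrow> ('a::euclidean_space \<Rightarrow> real) \<Rightarrow> 'a \<Rightarrow> real" where
  "stable_generator \<alpha> u x = (LBINT s. stable_density \<alpha> s * (heat s u x - u x)) / stable_mass \<alpha>"

lemma measurable_stable_generator:
  assumes [measurable]: "u \<in> borel_measurable borel"
  shows "stable_generator \<alpha> u \<in> borel_measurable (borel :: 'a::euclidean_space measure)"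
proof -
  have "(\<lambda>x. (LBINT s. stable_density \<alpha> s * (heat s u x - u x)) / stable_mass \<alpha>) \<in> borel_measurable (borel :: 'a measure)"
    by measurable
  then show ?thesis by (simp add: stable_generator_def[abs_def])
qed

lemma stable_generator_integrable:
  fixes u :: "'a::euclidean_space \<Rightarrow> real"
  assumes \<alpha>: "0 < \<alpha>" "\<alpha> < 2" and um[measurable]: "u \<in> borel_measurable borel" and u: "\<And>x. \<bar>u x\<bar> \<le> M"
    and C: "\<And>s x. 0 < s \<Longrightarrow> \<bar>heat s u x - u x\<bar> \<le> C * s"
  shows "integrable lborel (\<lambda>s. stable_density \<alpha> s * (heat s u x - u x))"
    and "(LBINT s. stable_density \<alpha> s * \<bar>heat s u x - u x\<bar>) \<le> (LBINT s. stable_density \<alpha> s * min (2 * M) (C * s))"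
proof -
  have b: "\<bar>heat s u x - u x\<bar> \<le> 2 * M" if "0 < s" for s
    using heat_bounded[OF um u that, of x] u[of x] by linarith
  have "integrable lborel (\<lambda>s. stable_density \<alpha> s *\<^sub>R (heat s u x - u x))"
    using b C by (intro stable_integrable[OF \<alpha>, where A="2 * M" and B=C]) auto
  then show i: "integrable lborel (\<lambda>s. stable_density \<alpha> s * (heat s u x - u x))" by simp
  have "0 \<le> M" "0 \<le> C" using u[of 0] C[of 1 0] by auto
  then have "integrable lborel (\<lambda>s. stable_density \<alpha> s *\<^sub>R min (2 * M) (C * s))"
    by (intro stable_integrable[OF \<alpha>, where A="2 * M" and B=C]) auto
  moreover have "integrable lborel (\<lambda>s. stable_density \<alpha> s * \<bar>heat s u x - u x\<bar>)"
    using integrable_abs[OF i] by (simp add: abs_mult)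
  moreover have "stable_density \<alpha> s * \<bar>heat s u x - u x\<bar> \<le> stable_density \<alpha> s * min (2 * M) (C * s)" for s
    using b[of s] C[of s x] by (cases "0 < s") (auto simp: stable_density_def intro!: mult_left_mono)
  ultimately show "(LBINT s. stable_density \<alpha> s * \<bar>heat s u x - u x\<bar>) \<le> (LBINT s. stable_density \<alpha> s * min (2 * M) (C * s))"
    by (intro integral_mono) auto
qed

lemma stable_generator_bounded:
  fixes u :: "'a::euclidean_space \<Rightarrow> real"
  assumes \<alpha>: "0 < \<alpha>" "\<alpha> < 2" and um: "u \<in> borel_measurable borel" and u: "\<And>x. \<bar>u x\<bar> \<le> M"
    and C: "\<And>s x. 0 < s \<Longrightarrow> \<bar>heat s u x - u x\<bar> \<le> C * s"
  shows "\<exists>B. \<forall>x. \<bar>stable_generator \<alpha> u x\<bar> \<le> B"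
proof (intro exI allI)
  fix x
  let ?J = "LBINT s. stable_density \<alpha> s * min (2 * M) (C * s)"
  have "\<bar>LBINT s. stable_density \<alpha> s * (heat s u x - u x)\<bar> \<le> (LBINT s. stable_density \<alpha> s * \<bar>heat s u x - u x\<bar>)"
    by (rule order_trans[OF integral_abs_bound]) (simp add: abs_mult)
  also have "\<dots> \<le> ?J" by (rule stable_generator_integrable(2)[OF \<alpha> um u C])
  finally show "\<bar>stable_generator \<alpha> u x\<bar> \<le> ?J / stable_mass \<alpha>"
    using stable_mass_pos[OF \<alpha>] by (simp add: stable_generator_def divide_right_mono)
qed

lemma stable_generator_nonneg:
  assumes "0 < \<alpha>" "\<alpha> < 2" "\<And>s. 0 < s \<Longrightarrow> 0 \<le> heat s u x - u x"
  shows "0 \<le> stable_generator \<alpha> u x"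
  unfolding stable_generator_def using stable_mass_pos[OF assms(1,2)] assms(3)
  by (intro divide_nonneg_pos integral_nonneg_AE) (auto simp: stable_density_def)

text \<open>Both sides are integrals over \<open>x\<close> and \<open>s\<close>, and for each \<open>s\<close> the inner integrals over \<open>x\<close> agree because
  \<open>H\<^sub>s\<close> is symmetric.  The exchange of integrals rests on \<open>heat_L1_modulus\<close> on the left, and on the
  bound \<open>min (2M) (C s)\<close> for \<open>|H\<^sub>s u - u|\<close> on the right.\<close>

theorem weak_frac_laplacian:
  fixes u \<theta> :: "'a::euclidean_space \<Rightarrow> real"
  assumes \<alpha>: "0 < \<alpha>" "\<alpha> < 2" and t: "test_function \<theta>"
    and um[measurable]: "u \<in> borel_measurable borel" and u: "\<And>x. \<bar>u x\<bar> \<le> M"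
    and C: "\<And>s x. 0 < s \<Longrightarrow> \<bar>heat s u x - u x\<bar> \<le> C * s"
  shows "integrable lborel (\<lambda>x. u x * frac_laplacian \<alpha> \<theta> x)"
    and "(LBINT x. u x * frac_laplacian \<alpha> \<theta> x) = (LBINT x. stable_generator \<alpha> u x * \<theta> x)"
proof -
  note [measurable] = test_function_measurable[OF t]
  have it: "integrable lborel \<theta>" by (rule test_function_integrable[OF t])
  have M0: "0 \<le> M" using u[of 0] by linarith
  obtain A' C' where h: "\<And>s. 0 < s \<Longrightarrow> integrable lborel (\<lambda>x. heat s \<theta> x - \<theta> x)"
    "\<And>s. 0 < s \<Longrightarrow> (LBINT x. \<bar>heat s \<theta> x - \<theta> x\<bar>) \<le> A'"
    "\<And>s. 0 < s \<Longrightarrow> (LBINT x. \<bar>heat s \<theta> x - \<theta> x\<bar>) \<le> C' * s"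
    using heat_L1_modulus[OF t] by blast
  have uint: "integrable lborel (\<lambda>x. u x * f x)" if "integrable lborel f" for f
    using u that by (intro integrable_bounded_mult[where M=M]) auto
  have ud: "integrable lborel (\<lambda>x. u x * (heat s \<theta> x - \<theta> x))" if "0 < s" for s
    using uint h(1) that by blast
  let ?F = "\<lambda>(s, x). stable_density \<alpha> s * (u x * (heat s \<theta> x - \<theta> x))"
  let ?N = "\<lambda>s. (LBINT x. \<bar>u x * (heat s \<theta> x - \<theta> x)\<bar>)"
  have Nb: "?N s \<le> M * (LBINT x. \<bar>heat s \<theta> x - \<theta> x\<bar>)" if s: "0 < s" for s
  proof -
    have "?N s \<le> (LBINT x. M * \<bar>heat s \<theta> x - \<theta> x\<bar>)"
      using integrable_abs[OF ud[OF s]] h(1)[OF s] u by (intro integral_mono) (auto simp: abs_mult intro!: mult_right_mono)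
    then show ?thesis by simp
  qed
  have F: "integrable (lborel \<Otimes>\<^sub>M lborel) ?F"
  proof (rule integrable_pairI)
    show "?F \<in> borel_measurable (borel \<Otimes>\<^sub>M borel)" by measurable
    show "integrable lborel (\<lambda>x. ?F (s, x))" for s
      using ud[of s] by (cases "0 < s") (auto simp: stable_density_def)
    show "integrable lborel (\<lambda>s. stable_density \<alpha> s *\<^sub>R ?N s)"
    proof (rule stable_integrable[OF \<alpha>])
      show "norm (?N s) \<le> M * A'" if "0 < s" for s
        using Nb[OF that] mult_left_mono[OF h(2)[OF that] M0] by simp
      show "norm (?N s) \<le> M * C' * s" if "0 < s" for s
        using Nb[OF that] mult_left_mono[OF h(3)[OF that] M0] by (simp add: mult.assoc)
    qed measurable
    show "(LBINT x. norm (?F (s, x))) \<le> stable_density \<alpha> s *\<^sub>R ?N s" for s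
      by (simp add: abs_mult)
  qed
  have Lu: "u x * frac_laplacian \<alpha> \<theta> x = (LBINT s. ?F (s, x)) / stable_mass \<alpha>" for x
    unfolding frac_laplacian_eq_heat[OF \<alpha> t] by (simp add: mult.left_commute)
  show "integrable lborel (\<lambda>x. u x * frac_laplacian \<alpha> \<theta> x)"
    unfolding Lu using lborel_pair.integrable_snd[of "\<lambda>s x. ?F (s, x)"] F by simp
  let ?H = "\<lambda>(x, s). stable_density \<alpha> s * (\<theta> x * (heat s u x - u x))"
  note hu = stable_generator_integrable[OF \<alpha> um u C]
  have H: "integrable (lborel \<Otimes>\<^sub>M lborel) ?H"
  proof (rule integrable_pairI)
    show "?H \<in> borel_measurable (borel \<Otimes>\<^sub>M borel)" by measurable
    show "integrable lborel (\<lambda>s. ?H (x, s))" for x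
      using integrable_mult_right[OF hu(1), of "\<theta> x"] by (simp add: mult_ac)
    show "integrable lborel (\<lambda>x. \<bar>\<theta> x\<bar> * (LBINT s. stable_density \<alpha> s * min (2 * M) (C * s)))"
      using it by simp
    show "(LBINT s. norm (?H (x, s))) \<le> \<bar>\<theta> x\<bar> * (LBINT s. stable_density \<alpha> s * min (2 * M) (C * s))" for x
    proof -
      have "(LBINT s. norm (?H (x, s))) = \<bar>\<theta> x\<bar> * (LBINT s. stable_density \<alpha> s * \<bar>heat s u x - u x\<bar>)"
        by (simp add: abs_mult mult.left_commute)
      then show ?thesis using hu(2)[of x] by (simp add: mult_left_mono)
    qed
  qed
  have "(LBINT x. (LBINT s. ?F (s, x))) = (LBINT s. (LBINT x. ?F (s, x)))"
    by (rule lborel_Fubini[OF F])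
  also have "\<dots> = (LBINT s. (LBINT x. ?H (x, s)))"
  proof (rule Bochner_Integration.integral_cong[OF refl])
    fix s
    show "(LBINT x. ?F (s, x)) = (LBINT x. ?H (x, s))"
    proof (cases "0 < s")
      case True
      have i1: "integrable lborel (\<lambda>x. u x * \<theta> x)" using uint it by blast
      have ih: "integrable lborel (heat s \<theta>)"
        using Bochner_Integration.integrable_add[OF h(1)[OF True] it] by simp
      have i2: "integrable lborel (\<lambda>x. u x * heat s \<theta> x)" by (rule uint[OF ih])
      have "integrable lborel (\<lambda>x. heat s u x * \<theta> x)"
        using heat_bounded[OF um u True] it by (intro integrable_bounded_mult[where M=M]) auto
      then have i3: "integrable lborel (\<lambda>x. \<theta> x * heat s u x)" by (simp add: mult.commute)
      have "(LBINT x. u x * (heat s \<theta> x - \<theta> x)) = (LBINT x. \<theta> x * (heat s u x - u x))"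
        using i1 i2 i3 heat_symmetric[OF um u it True] by (simp add: right_diff_distrib mult.commute)
      then show ?thesis by simp
    qed (simp add: stable_density_def)
  qed
  also have "\<dots> = (LBINT x. (LBINT s. ?H (x, s)))"
    by (rule lborel_Fubini[OF H])
  also have "\<dots> = (LBINT x. \<theta> x * (LBINT s. stable_density \<alpha> s * (heat s u x - u x)))"
    by (simp add: mult.left_commute)
  finally show "(LBINT x. u x * frac_laplacian \<alpha> \<theta> x) = (LBINT x. stable_generator \<alpha> u x * \<theta> x)"
    unfolding Lu stable_generator_def by (simp add: mult.commute)
qed

section \<open>A superharmonic bump with a flat top\<close>

lemma heat_kernel_complete_square:
  fixes x y :: "'a::euclidean_space"
  assumes t: "0 < t" and s: "0 < s"
  shows "heat_kernel t (x + y) * heat_kernel s y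
    = heat_kernel (t + s) x * heat_kernel (t * s / (t + s)) ((s / (t + s)) *\<^sub>R x + y)"
proof -
  let ?X = "x \<bullet> x" and ?Y = "y \<bullet> y" and ?Z = "x \<bullet> y"
  have n1: "(norm (x + y))\<^sup>2 = ?X + 2 * ?Z + ?Y"
    by (simp add: power2_norm_eq_inner inner_add_left inner_add_right inner_commute)
  have n2: "(norm ((s / (t + s)) *\<^sub>R x + y))\<^sup>2 = (s / (t + s))\<^sup>2 * ?X + 2 * (s / (t + s)) * ?Z + ?Y"
    unfolding power2_norm_eq_inner inner_add_left inner_add_right
    by (simp add: inner_commute power2_eq_square)
  have pos: "t + s > 0" using t s by simp
  have e: "(norm (x + y))\<^sup>2 / (4 * t) + (norm y)\<^sup>2 / (4 * s)
     = (norm x)\<^sup>2 / (4 * (t + s)) + (norm ((s / (t + s)) *\<^sub>R x + y))\<^sup>2 / (4 * (t * s / (t + s)))"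
    unfolding n1 n2 power2_norm_eq_inner[of x] power2_norm_eq_inner[of y]
    using t s pos by (simp add: divide_simps) (simp add: algebra_simps power2_eq_square)
  have "sqrt (4 * pi * t) * sqrt (4 * pi * s) = sqrt (4 * pi * (t + s)) * sqrt (4 * pi * (t * s / (t + s)))"
    using pos by (simp add: real_sqrt_mult[symmetric])
  then have c: "1 / sqrt (4 * pi * t) * (1 / sqrt (4 * pi * s)) = 1 / sqrt (4 * pi * (t + s)) * (1 / sqrt (4 * pi * (t * s / (t + s))))"
    by simp
  have "heat_kernel t (x + y) * heat_kernel s y = (1 / sqrt (4 * pi * t) * (1 / sqrt (4 * pi * s))) ^ DIM('a)
     * exp (- ((norm (x + y))\<^sup>2 / (4 * t) + (norm y)\<^sup>2 / (4 * s)))"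
    unfolding heat_kernel_def power_mult_distrib minus_add_distrib exp_add by simp
  also have "\<dots> = heat_kernel (t + s) x * heat_kernel (t * s / (t + s)) ((s / (t + s)) *\<^sub>R x + y)"
    unfolding heat_kernel_def e c power_mult_distrib minus_add_distrib exp_add by simp
  finally show ?thesis .
qed

text \<open>The semigroup property, obtained by completing the square in the exponent.\<close>

lemma heat_heat_kernel:
  assumes t: "0 < t" and s: "0 < s"
  shows "heat s (heat_kernel t) (x::'a::euclidean_space) = heat_kernel (t + s) x"
proof -
  have p: "0 < t * s / (t + s)" using t s by simp
  have "heat s (heat_kernel t) x = heat_kernel (t + s) x * (LBINT y. heat_kernel (t * s / (t + s)) ((s / (t + s)) *\<^sub>R x + y))"
    unfolding heat_def heat_kernel_complete_square[OF t s] by simp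
  also have "(LBINT y. heat_kernel (t * s / (t + s)) ((s / (t + s)) *\<^sub>R x + y)) = (LBINT y. heat_kernel (t * s / (t + s)) (y::'a))"
    by (rule integral_lborel_shift) measurable
  finally show ?thesis using integral_heat_kernel(2)[OF p, where 'a='a] by simp
qed

text \<open>The Newtonian potential of the heat kernel at time \<open>1\<close>.  Moving the starting time from \<open>0\<close> to \<open>1\<close>
  removes the singularity of the fundamental solution.\<close>

definition tail_potential :: "'a::euclidean_space \<Rightarrow> real" where
  "tail_potential x = (LBINT t. indicator {1..} t * heat_kernel t x)"

definition tail_const :: real where
  "tail_const = (LBINT t. indicator {1..} t * t powr (- 5 / 4))"

lemma tail_const_integrable: "integrable lborel (\<lambda>t::real. indicator {1..} t * t powr (- 5 / 4))"
  by (rule integrable_powr_atLeast_1) simp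

lemma tail_const_nonneg: "0 \<le> tail_const"
  unfolding tail_const_def by (rule integral_nonneg_AE) simp

lemma inverse_sqrt_power_le:
  assumes t: "1 \<le> t" and N: "3 \<le> N"
  shows "(1 / sqrt (4 * pi * t)) ^ N \<le> t powr (- 3 / 2)"
proof -
  have 1: "1 \<le> sqrt t" using t by simp
  have pi: "1 \<le> 4 * pi" using pi_gt3 by simp
  have "sqrt t \<le> sqrt (4 * pi * t)" using mult_right_mono[OF pi, of t] t by simp
  then have "1 / sqrt (4 * pi * t) \<le> 1 / sqrt t" using t 1 by (intro divide_left_mono) auto
  then have "(1 / sqrt (4 * pi * t)) ^ N \<le> (1 / sqrt t) ^ N" using t by (intro power_mono) auto
  also have "\<dots> \<le> (1 / sqrt t) ^ 3" using 1 N by (intro power_decreasing) auto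
  also have "\<dots> = t powr (- 3 / 2)"
  proof -
    have "1 / sqrt t = t powr (- 1 / 2)" using t by (simp add: powr_half_sqrt[symmetric] powr_minus_divide)
    then have "(1 / sqrt t) ^ 3 = (t powr (- 1 / 2)) powr 3" using t by simp
    then show ?thesis by (simp add: powr_powr)
  qed
  finally show ?thesis .
qed

lemma heat_kernel_le_powr:
  assumes "3 \<le> DIM('a::euclidean_space)" "1 \<le> t"
  shows "heat_kernel t (x::'a) \<le> t powr (- 3 / 2) * exp (- (norm x)\<^sup>2 / (4 * t))"
  unfolding heat_kernel_def using inverse_sqrt_power_le[OF assms(2,1)] by (intro mult_right_mono) auto

lemma heat_kernel_le_powr':
  assumes "3 \<le> DIM('a::euclidean_space)" "1 \<le> t"
  shows "heat_kernel t (x::'a) \<le> t powr (- 3 / 2)"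
proof -
  have "heat_kernel t x \<le> t powr (- 3 / 2) * exp (- (norm x)\<^sup>2 / (4 * t))"
    by (rule heat_kernel_le_powr[OF assms])
  also have "\<dots> \<le> t powr (- 3 / 2) * 1" using assms by (intro mult_left_mono) auto
  finally show ?thesis by simp
qed

lemma powr_tail_le: "t powr (- 3 / 2) \<le> t powr (- 5 / 4)" if "1 \<le> t" for t :: real
  using that by (intro powr_mono) auto

lemma heat_kernel_le_tail:
  assumes "3 \<le> DIM('a::euclidean_space)" "1 \<le> t"
  shows "heat_kernel t (x::'a) \<le> t powr (- 5 / 4)"
  using heat_kernel_le_powr'[OF assms, of x] powr_tail_le[OF assms(2)] by simp

text \<open>For \<open>N \<ge> 3\<close> and \<open>t \<ge> 1\<close> the heat kernel is at most \<open>t\<^sup>-\<^sup>3\<^sup>/\<^sup>2\<close>.  The weaker exponent \<open>5/4\<close> leaves a factor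
  \<open>t\<^sup>-\<^sup>1\<^sup>/\<^sup>4\<close> that can be traded for decay in \<open>x\<close> or in \<open>s\<close>.\<close>

lemma tail_integrable:
  assumes "f \<in> borel_measurable borel" "\<And>t. 1 \<le> t \<Longrightarrow> \<bar>f t\<bar> \<le> c * t powr (- 5 / 4)"
  shows "integrable lborel (\<lambda>t. indicator {1..} t * f t)"
    and "(LBINT t. indicator {1..} t * f t) \<le> c * tail_const"
proof -
  have [measurable]: "f \<in> borel_measurable borel" by fact
  have j: "integrable lborel (\<lambda>t. c * (indicator {1..} t * t powr (- 5 / 4)))"
    by (intro integrable_mult_right tail_const_integrable)
  show i: "integrable lborel (\<lambda>t. indicator {1..} t * f t)"
    by (rule integrable_lborel_bound[OF j]) (use assms(2) in \<open>auto simp: indicator_def\<close>)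
  have "(LBINT t. indicator {1..} t * f t) \<le> (LBINT t. c * (indicator {1..} t * t powr (- 5 / 4)))"
    using assms(2) by (intro integral_mono i j) (auto simp: indicator_def abs_le_iff)
  then show "(LBINT t. indicator {1..} t * f t) \<le> c * tail_const" by (simp add: tail_const_def)
qed

lemma tail_heat_kernel_integrable:
  assumes "3 \<le> DIM('a::euclidean_space)"
  shows "integrable lborel (\<lambda>t. indicator {1..} t * heat_kernel t (x::'a))"
  using heat_kernel_le_tail[OF assms] by (intro tail_integrable(1)[where c=1]) auto

lemma measurable_tail_potential [measurable]: "tail_potential \<in> borel_measurable (borel :: 'a::euclidean_space measure)"
proof -
  have "(\<lambda>x. LBINT t. indicator {1..} t * heat_kernel t x) \<in> borel_measurable (borel :: 'a measure)"
    by measurable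
  then show ?thesis by (simp add: tail_potential_def[abs_def])
qed

lemma tail_potential_nonneg: "0 \<le> tail_potential x"
  unfolding tail_potential_def by (rule integral_nonneg_AE) (auto simp: indicator_def)

lemma tail_potential_bounded:
  assumes "3 \<le> DIM('a::euclidean_space)"
  shows "\<bar>tail_potential (x::'a)\<bar> \<le> tail_const"
  using heat_kernel_le_tail[OF assms, of _ x] tail_integrable(2)[of "\<lambda>t. heat_kernel t x" 1] tail_potential_nonneg[of x]
  unfolding tail_potential_def by simp

lemma heat_tail_potential:
  assumes N: "3 \<le> DIM('a::euclidean_space)" and s: "0 < s"
  shows "heat s tail_potential (x::'a) = (LBINT t. indicator {1..} t * heat_kernel (t + s) x)"
proof -
  let ?F = "\<lambda>(t, y). indicator {1..} t * (heat_kernel t (x + y) * heat_kernel s y)"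
  have F: "integrable (lborel \<Otimes>\<^sub>M lborel) ?F"
  proof (rule integrable_pair_bound[OF _ tail_const_integrable])
    show "integrable lborel (heat_kernel s :: 'a \<Rightarrow> real)" using integral_heat_kernel[OF s] by simp
    show "norm (?F (t, y)) \<le> indicator {1..} t * t powr (- 5 / 4) * heat_kernel s y" for t y
      using heat_kernel_le_tail[OF N, of t "x + y"] s by (auto simp: indicator_def abs_mult intro!: mult_right_mono)
  qed measurable
  have "heat s tail_potential x = (LBINT y. (LBINT t. ?F (t, y)))"
    unfolding heat_def tail_potential_def by (simp add: mult.assoc flip: integral_mult_left_zero)
  also have "\<dots> = (LBINT t. (LBINT y. ?F (t, y)))"
    by (rule lborel_Fubini[OF F])
  also have "\<dots> = (LBINT t. indicator {1..} t * heat_kernel (t + s) x)"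
  proof (rule Bochner_Integration.integral_cong[OF refl])
    fix t :: real
    show "(LBINT y. ?F (t, y)) = indicator {1..} t * heat_kernel (t + s) x"
    proof (cases "1 \<le> t")
      case True
      then show ?thesis using heat_heat_kernel[of t s x] s by (simp add: heat_def)
    qed simp
  qed
  finally show ?thesis .
qed

text \<open>The semigroup moves the starting time of the potential from \<open>1\<close> to \<open>1 + s\<close>, so the difference is
  the integral of a kernel bounded by \<open>1\<close> over an interval of length \<open>s\<close>.\<close>

lemma heat_tail_potential_modulus:
  assumes N: "3 \<le> DIM('a::euclidean_space)" and s: "0 < s"
  shows "0 \<le> tail_potential x - heat s tail_potential (x::'a)" "tail_potential x - heat s tail_potential (x::'a) \<le> s"
proof -
  have "heat s tail_potential x = (LBINT t. indicator {1..} (t - s) * heat_kernel t x)"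
    unfolding heat_tail_potential[OF N s]
    using integral_lborel_shift[of "\<lambda>t. indicator {1..} (t - s) * heat_kernel t x" s] by (simp add: add.commute)
  also have "(\<lambda>t. indicator {1..} (t - s) * heat_kernel t x) = (\<lambda>t. indicator {1..} t * heat_kernel t x - indicator {1..<1 + s} t * heat_kernel t x)"
    using s by (auto simp: indicator_def fun_eq_iff)
  finally have h: "heat s tail_potential x = (LBINT t. indicator {1..} t * heat_kernel t x - indicator {1..<1 + s} t * heat_kernel t x)" .
  have b: "0 \<le> indicator {1..<1 + s} t * heat_kernel t x" "indicator {1..<1 + s} t * heat_kernel t x \<le> indicator {1..<1 + s} t" for t
  proof -
    have "heat_kernel t x \<le> 1" if "1 \<le> t"
      using heat_kernel_le_tail[OF N that, of x] powr_mono[of "- 5 / 4" 0 t] that by simp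
    then show "0 \<le> indicator {1..<1 + s} t * heat_kernel t x" "indicator {1..<1 + s} t * heat_kernel t x \<le> indicator {1..<1 + s} t"
      by (auto simp: indicator_def)
  qed
  have i1: "integrable lborel (\<lambda>t. indicator {1..<1 + s} t :: real)" using s by simp
  have i2: "integrable lborel (\<lambda>t. indicator {1..<1 + s} t * heat_kernel t x)"
    by (rule integrable_lborel_bound[OF i1]) (use b in auto)
  have d: "tail_potential x - heat s tail_potential x = (LBINT t. indicator {1..<1 + s} t * heat_kernel t x)"
    unfolding h using i2 tail_heat_kernel_integrable[OF N, of x] by (simp add: tail_potential_def)
  show "0 \<le> tail_potential x - heat s tail_potential x"
    unfolding d using b by (intro integral_nonneg_AE) auto
  have "(LBINT t. indicator {1..<1 + s} t * heat_kernel t x) \<le> (LBINT t. indicator {1..<1 + s} t)"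
    using b by (intro integral_mono i1 i2)
  then show "tail_potential x - heat s tail_potential x \<le> s" unfolding d using s by simp
qed

lemma heat_tail_potential_decay:
  assumes N: "3 \<le> DIM('a::euclidean_space)" and s: "0 < s"
  shows "heat s tail_potential (x::'a) \<le> s powr (- 1 / 4) * tail_const"
  unfolding heat_tail_potential[OF N s]
proof (rule tail_integrable(2))
  fix t :: real assume t: "1 \<le> t"
  have "heat_kernel (t + s) x \<le> (t + s) powr (- 3 / 2)"
    using t s by (intro heat_kernel_le_powr'[OF N]) simp
  also have "\<dots> = (t + s) powr (- 1 / 4) * (t + s) powr (- 5 / 4)" using t s by (simp flip: powr_add)
  also have "\<dots> \<le> s powr (- 1 / 4) * t powr (- 5 / 4)"
    using t s by (intro mult_mono powr_mono2') auto
  finally show "\<bar>heat_kernel (t + s) x\<bar> \<le> s powr (- 1 / 4) * t powr (- 5 / 4)" using t s by simp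
qed measurable

lemma exp_minus_le_powr: "exp (- z) \<le> z powr (- 1 / 4)" if "0 < z" for z :: real
proof -
  have "z powr (1 / 4) \<le> exp z"
  proof (cases "z \<le> 1")
    case True
    then have "z powr (1 / 4) \<le> 1" using that by (intro powr_le1) auto
    then show ?thesis using that exp_ge_add_one_self[of z] by linarith
  next
    case False
    then have "z powr (1 / 4) \<le> z powr 1" using that by (intro powr_mono) auto
    then show ?thesis using that exp_ge_add_one_self[of z] by (simp del: exp_ge_add_one_self)
  qed
  then show ?thesis using that by (simp add: exp_minus powr_minus field_simps)
qed

text \<open>The true rate is \<open>|x|\<^sup>2\<^sup>-\<^sup>N\<close>, but any power of \<open>|x|\<close> suffices to separate the bumps.\<close>

lemma tail_potential_decay:
  assumes N: "3 \<le> DIM('a::euclidean_space)" and x: "(x::'a) \<noteq> 0"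
  shows "tail_potential x \<le> 2 * tail_const / sqrt (norm x)"
proof -
  have "tail_potential x \<le> (2 / sqrt (norm x)) * tail_const"
    unfolding tail_potential_def
  proof (rule tail_integrable(2))
    fix t :: real assume t: "1 \<le> t"
    let ?n = "norm x"
    have n: "0 < ?n" using x by simp
    have "exp (- ?n\<^sup>2 / (4 * t)) \<le> (?n\<^sup>2 / (4 * t)) powr (- 1 / 4)"
      using exp_minus_le_powr[of "?n\<^sup>2 / (4 * t)"] n t by simp
    also have "(?n\<^sup>2 / (4 * t)) powr (- 1 / 4) = (?n\<^sup>2) powr (- 1 / 4) * (4 * t) powr (1 / 4)"
      using n t by (simp add: powr_divide powr_minus_divide)
    also have "(?n\<^sup>2) powr (- 1 / 4) = 1 / sqrt ?n"
      using n by (simp add: powr_powr powr_half_sqrt[symmetric] powr_minus_divide flip: powr_numeral)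
    also have "(4 * t) powr (1 / 4) \<le> 2 * t powr (1 / 4)"
    proof -
      have "(4::real) powr (1 / 4) \<le> 4 powr (1 / 2)" by (intro powr_mono) auto
      then have "(4::real) powr (1 / 4) \<le> 2" by (simp add: powr_half_sqrt)
      then show ?thesis using t by (simp add: powr_mult)
    qed
    finally have e: "exp (- ?n\<^sup>2 / (4 * t)) \<le> 1 / sqrt ?n * (2 * t powr (1 / 4))" using n by (simp add: divide_right_mono mult_left_mono)
    have "heat_kernel t x \<le> t powr (- 3 / 2) * exp (- ?n\<^sup>2 / (4 * t))" by (rule heat_kernel_le_powr[OF N t])
    also have "\<dots> \<le> t powr (- 3 / 2) * (1 / sqrt ?n * (2 * t powr (1 / 4)))"
      using e by (intro mult_left_mono) auto
    also have "\<dots> = 2 / sqrt ?n * (t powr (- 3 / 2) * t powr (1 / 4))" by simp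
    also have "t powr (- 3 / 2) * t powr (1 / 4) = t powr (- 5 / 4)" using t by (simp flip: powr_add)
    finally show "\<bar>heat_kernel t x\<bar> \<le> 2 / sqrt ?n * t powr (- 5 / 4)" using t by simp
  qed measurable
  then show ?thesis by simp
qed

lemma exp_minus_sq_lipschitz: "\<bar>exp (- a\<^sup>2) - exp (- b\<^sup>2)\<bar> \<le> \<bar>a - b\<bar>" for a b :: real
proof -
  have "norm (exp (- a\<^sup>2) - exp (- b\<^sup>2)) \<le> 1 * norm (a - b)"
  proof (rule field_differentiable_bound[of UNIV "\<lambda>z. exp (- z\<^sup>2)" "\<lambda>z. - 2 * z * exp (- z\<^sup>2)"])
    show "((\<lambda>z. exp (- z\<^sup>2)) has_field_derivative - 2 * z * exp (- z\<^sup>2)) (at z within UNIV)" for z :: real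
      by (auto intro!: derivative_eq_intros)
    show "norm (- 2 * z * exp (- z\<^sup>2)) \<le> 1" for z :: real
    proof -
      have "2 * \<bar>z\<bar> \<le> 1 + z\<^sup>2" using zero_le_power2[of "\<bar>z\<bar> - 1"] by (simp add: power2_diff)
      also have "\<dots> \<le> exp (z\<^sup>2)" using exp_ge_add_one_self[of "z\<^sup>2"] by simp
      finally show ?thesis by (simp add: abs_mult exp_minus field_simps)
    qed
  qed auto
  then show ?thesis by simp
qed

lemma tail_potential_lipschitz:
  assumes N: "3 \<le> DIM('a::euclidean_space)"
  shows "\<bar>tail_potential (x::'a) - tail_potential y\<bar> \<le> tail_const * norm (x - y)"
proof -
  have *: "tail_potential (x::'a) - tail_potential y \<le> tail_const * norm (x - y)" for x y
  proof -
    have "tail_potential x - tail_potential y = (LBINT t. indicator {1..} t * heat_kernel t x - indicator {1..} t * heat_kernel t y)"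
      unfolding tail_potential_def using tail_heat_kernel_integrable[OF N] by simp
    also have "\<dots> = (LBINT t. indicator {1..} t * (heat_kernel t x - heat_kernel t y))" by (simp add: algebra_simps)
    also have "\<dots> \<le> norm (x - y) * tail_const"
    proof (rule tail_integrable(2))
      fix t :: real assume t: "1 \<le> t"
      let ?a = "norm x / (2 * sqrt t)" and ?b = "norm y / (2 * sqrt t)"
      have sq: "- (norm z)\<^sup>2 / (4 * t) = - (norm z / (2 * sqrt t))\<^sup>2" for z :: 'a
        using t by (simp add: power_divide power_mult_distrib)
      have "1 \<le> 2 * sqrt t" using t real_sqrt_ge_one[of t] by linarith
      then have "\<bar>norm x - norm y\<bar> / (2 * sqrt t) \<le> \<bar>norm x - norm y\<bar>"
        using mult_left_mono[of 1 "2 * sqrt t" "\<bar>norm x - norm y\<bar>"] t by (simp add: divide_le_eq)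
      then have "\<bar>?a - ?b\<bar> \<le> norm (x - y)"
        using t norm_triangle_ineq3[of x y] by (simp flip: diff_divide_distrib)
      then have e: "\<bar>exp (- (norm x)\<^sup>2 / (4 * t)) - exp (- (norm y)\<^sup>2 / (4 * t))\<bar> \<le> norm (x - y)"
        unfolding sq using exp_minus_sq_lipschitz[of ?a ?b] by linarith
      have "\<bar>heat_kernel t x - heat_kernel t y\<bar> = (1 / sqrt (4 * pi * t)) ^ DIM('a) * \<bar>exp (- (norm x)\<^sup>2 / (4 * t)) - exp (- (norm y)\<^sup>2 / (4 * t))\<bar>"
        using t unfolding heat_kernel_def right_diff_distrib[symmetric] abs_mult by simp
      also have "\<dots> \<le> t powr (- 5 / 4) * norm (x - y)"
        using inverse_sqrt_power_le[OF t N] powr_tail_le[OF t] e t by (intro mult_mono) auto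
      finally show "\<bar>heat_kernel t x - heat_kernel t y\<bar> \<le> norm (x - y) * t powr (- 5 / 4)" by (simp add: mult.commute)
    qed measurable
    finally show ?thesis by (simp add: mult.commute)
  qed
  show ?thesis using *[of x y] *[of y x] by (simp add: norm_minus_commute abs_le_iff)
qed

lemma tail_potential_lower_bound:
  assumes N: "3 \<le> DIM('a::euclidean_space)" and x: "norm (x::'a) \<le> 1"
  shows "(1 / sqrt (8 * pi)) ^ DIM('a) * exp (- 1 / 4) \<le> tail_potential x"
proof -
  let ?m = "(1 / sqrt (8 * pi)) ^ DIM('a) * exp (- 1 / 4)"
  have "?m = (LBINT t. indicator {1..2::real} t * ?m)" by simp
  also have "\<dots> \<le> tail_potential x"
    unfolding tail_potential_def
  proof (rule integral_mono[OF _ tail_heat_kernel_integrable[OF N]])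
    show "indicator {1..2} t * ?m \<le> indicator {1..} t * heat_kernel t x" for t
    proof (cases "t \<in> {1..2}")
      case True
      have "(norm x)\<^sup>2 / (4 * t) \<le> 1 / 4"
        using True x power_mono[of "norm x" 1 2] by (simp add: divide_le_eq)
      then have "exp (- 1 / 4) \<le> exp (- (norm x)\<^sup>2 / (4 * t))" by simp
      moreover have "(1 / sqrt (8 * pi)) ^ DIM('a) \<le> (1 / sqrt (4 * pi * t)) ^ DIM('a)"
        using True by (intro power_mono divide_left_mono) auto
      ultimately have "?m \<le> heat_kernel t x" unfolding heat_kernel_def using True by (intro mult_mono) auto
      then show ?thesis using True by simp
    qed (auto simp: indicator_def)
  qed simp
  finally show ?thesis .
qed

text \<open>A concave nondecreasing truncation at height \<open>1\<close>, used in place of \<open>min 1 t\<close>: it is flat beyond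
  \<open>1\<close> but has a Lipschitz derivative, without which \<open>w - H\<^sub>s w = O(s)\<close> would fail.\<close>

definition cap :: "real \<Rightarrow> real" where
  "cap t = 1 - (max 0 (1 - t))\<^sup>2"

lemma cap_le_tangent: "cap b \<le> cap a + 2 * max 0 (1 - a) * (b - a)"
proof (cases "a \<le> 1")
  case True
  show ?thesis
  proof (cases "b \<le> 1")
    case b: True
    have "0 \<le> (b - a)\<^sup>2" by simp
    with True b show ?thesis by (simp add: cap_def power2_eq_square algebra_simps)
  next
    case b: False
    have "0 \<le> (1 - a) * (1 - a + 2 * (b - 1))" using True b by (intro mult_nonneg_nonneg) auto
    with True b show ?thesis by (simp add: cap_def power2_eq_square algebra_simps)
  qed
qed (simp add: cap_def)

lemma cap_ge_tangent: "cap a + 2 * max 0 (1 - a) * (b - a) - (b - a)\<^sup>2 \<le> cap b"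
proof (cases "a \<le> 1")
  case True
  show ?thesis
  proof (cases "b \<le> 1")
    case b: True
    with True show ?thesis by (simp add: cap_def power2_eq_square algebra_simps)
  next
    case b: False
    have "0 \<le> (1 - b)\<^sup>2" by simp
    with True b show ?thesis by (simp add: cap_def power2_eq_square algebra_simps)
  qed
next
  case False
  have "(max 0 (1 - b))\<^sup>2 \<le> (b - a)\<^sup>2" using False by (simp add: abs_le_square_iff[symmetric])
  with False show ?thesis by (simp add: cap_def)
qed

lemma cap_bounds: "0 \<le> t \<Longrightarrow> 0 \<le> cap t" "cap t \<le> 1" "0 \<le> t \<Longrightarrow> cap t \<le> 2 * t" "1 \<le> t \<Longrightarrow> cap t = 1"
  using cap_le_tangent[of t 0] power_mono[of "max 0 (1 - t)" 1 2] by (auto simp: cap_def)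

text \<open>The modulus \<open>w - H\<^sub>s w \<le> C s\<close> is what remains of a bounded Laplacian, and \<open>s0\<close> is a time after which the
  semigroup has flattened the bump to half of its height.\<close>

locale flat_bump =
  fixes w :: "'a::euclidean_space \<Rightarrow> real" and C s0 :: real
  assumes w_cont: "continuous_on UNIV w" and w_nonneg: "\<And>x. 0 \<le> w x" and w_le_1: "\<And>x. w x \<le> 1"
    and w_flat: "\<And>x. norm x \<le> 1 \<Longrightarrow> w x = 1"
    and C: "1 \<le> C" and w_decay: "\<And>x. x \<noteq> 0 \<Longrightarrow> w x \<le> C / sqrt (norm x)"
    and w_super: "\<And>s x. 0 < s \<Longrightarrow> 0 \<le> w x - heat s w x"
    and w_modulus: "\<And>s x. 0 < s \<Longrightarrow> w x - heat s w x \<le> C * s"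
    and s0: "0 < s0" and w_half: "\<And>s x. s0 \<le> s \<Longrightarrow> heat s w x \<le> 1 / 2"

text \<open>The bump is \<open>cap V\<close> with \<open>V\<close> a multiple of the tail potential that is at least \<open>1\<close> on the unit ball.
  Concavity of \<open>cap\<close> gives \<open>H\<^sub>s w \<le> w\<close> from \<open>H\<^sub>s V \<le> V\<close> (Jensen's inequality), and the quadratic lower
  bound for \<open>cap\<close> gives \<open>w - H\<^sub>s w = O(s)\<close> from \<open>V - H\<^sub>s V = O(s)\<close> and the Lipschitz continuity of \<open>V\<close>.\<close>

theorem superharmonic_bump:
  assumes N: "3 \<le> DIM('a::euclidean_space)"
  shows "\<exists>(w :: 'a \<Rightarrow> real) C s0. flat_bump w C s0"
proof -
  define m where "m = (1 / sqrt (8 * pi)) ^ DIM('a) * exp (- 1 / 4)"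
  have m: "0 < m" by (simp add: m_def)
  define V where "V = (\<lambda>x::'a. tail_potential x / m)"
  have [measurable]: "V \<in> borel_measurable borel" unfolding V_def by measurable
  define K where "K = tail_const / m"
  have K: "0 \<le> K" using tail_const_nonneg m by (simp add: K_def)
  have V0: "0 \<le> V x" for x using tail_potential_nonneg[of x] m by (simp add: V_def)
  have Vb: "\<bar>V x\<bar> \<le> K" for x using tail_potential_bounded[OF N, of x] m by (simp add: V_def K_def abs_divide divide_right_mono)
  have V1: "1 \<le> V x" if "norm x \<le> 1" for x
    using tail_potential_lower_bound[OF N that] m by (simp add: V_def m_def)
  have VL: "\<bar>V x - V y\<bar> \<le> K * norm (x - y)" for x y
    using tail_potential_lipschitz[OF N, of x y] m by (simp add: V_def K_def abs_divide divide_right_mono flip: diff_divide_distrib)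
  have heatV: "heat s V x = heat s tail_potential x / m" for s x by (simp add: heat_def V_def)
  have VH: "0 \<le> V x - heat s V x" "V x - heat s V x \<le> s / m" if "0 < s" for s x
  proof -
    have "V x - heat s V x = (tail_potential x - heat s tail_potential x) / m"
      unfolding heatV by (simp add: V_def diff_divide_distrib)
    then show "0 \<le> V x - heat s V x" "V x - heat s V x \<le> s / m"
      using heat_tail_potential_modulus[OF N that, of x] m by (simp_all add: divide_right_mono)
  qed
  have VD: "heat s V x \<le> s powr (- 1 / 4) * K" if "0 < s" for s x
    using heat_tail_potential_decay[OF N that, of x] m unfolding heatV K_def by (simp add: divide_right_mono)
  have Vd: "V x \<le> 2 * K / sqrt (norm x)" if "x \<noteq> 0" for x
    using divide_right_mono[OF tail_potential_decay[OF N that], of m] m by (simp add: V_def K_def mult_ac)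
  define w where "w = (\<lambda>x. cap (V x))"
  have Vc: "continuous_on UNIV V"
  proof -
    have "K-lipschitz_on UNIV V" by (rule lipschitz_onI) (use VL K in \<open>auto simp: dist_norm\<close>)
    then show ?thesis by (rule lipschitz_on_continuous_on)
  qed
  then have wc: "continuous_on UNIV w"
    unfolding w_def cap_def by (intro continuous_intros)
  then have [measurable]: "w \<in> borel_measurable borel" by (rule borel_measurable_continuous_onI)
  have wb: "\<bar>w x\<bar> \<le> 1" for x using cap_bounds[of "V x"] V0[of x] by (simp add: w_def)
  let ?Q = "8 * sqrt 2 ^ DIM('a)"
  have iw: "integrable lborel (\<lambda>y. w (x + y) * heat_kernel s y)" if "0 < s" for s x
    using wb that by (intro integrable_bounded_heat_kernel) auto
  have iV: "integrable lborel (\<lambda>y. V (x + y) * heat_kernel s y)" if "0 < s" for s x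
    using Vb that by (intro integrable_bounded_heat_kernel) auto
  have lin: "integrable lborel (\<lambda>y. (a + b * (V (x + y) - c)) * heat_kernel s y)"
    "(LBINT y. (a + b * (V (x + y) - c)) * heat_kernel s y) = a + b * (heat s V x - c)" if s: "0 < s" for s x a b c
  proof -
    have e: "(a + b * (V (x + y) - c)) * heat_kernel s y = (a - b * c) * heat_kernel s y + b * (V (x + y) * heat_kernel s y)" for y
      by (simp add: algebra_simps)
    show "integrable lborel (\<lambda>y. (a + b * (V (x + y) - c)) * heat_kernel s y)"
      unfolding e using iV[OF s, of x] integral_heat_kernel[OF s, where 'a='a] by simp
    show "(LBINT y. (a + b * (V (x + y) - c)) * heat_kernel s y) = a + b * (heat s V x - c)"
      unfolding e using iV[OF s, of x] integral_heat_kernel[OF s, where 'a='a] by (simp add: heat_def algebra_simps)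
  qed
  \<comment> \<open>The tangent may be taken at any point \<open>c\<close>: \<open>c = V x\<close> gives superharmonicity, \<open>c = 0\<close> the bound \<open>2 H\<^sub>s V\<close>.\<close>
  have upper: "heat s w x \<le> cap c + 2 * max 0 (1 - c) * (heat s V x - c)" if s: "0 < s" for s x c
  proof -
    have "heat s w x \<le> (LBINT y. (cap c + 2 * max 0 (1 - c) * (V (x + y) - c)) * heat_kernel s y)"
      unfolding heat_def using s by (intro integral_mono iw lin mult_right_mono) (auto simp: w_def cap_le_tangent)
    then show ?thesis using lin(2)[OF s] by simp
  qed
  have lower: "w x - heat s w x \<le> (2 / m + K\<^sup>2 * ?Q) * s" if s: "0 < s" for s x
  proof -
    let ?b = "2 * max 0 (1 - V x)"
    let ?q = "\<lambda>y. K\<^sup>2 * ((norm y)\<^sup>2 * heat_kernel s (y::'a))"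
    have iq: "integrable lborel ?q" using heat_kernel_second_moment(1)[OF s] by (intro integrable_mult_right)
    have "(LBINT y. (cap (V x) + ?b * (V (x + y) - V x)) * heat_kernel s y - ?q y) \<le> heat s w x"
      unfolding heat_def
    proof (rule integral_mono)
      show "integrable lborel (\<lambda>y. w (x + y) * heat_kernel s y)" using iw[OF s] .
      show "integrable lborel (\<lambda>y. (cap (V x) + ?b * (V (x + y) - V x)) * heat_kernel s y - ?q y)"
        using lin(1)[OF s] iq by (intro Bochner_Integration.integrable_diff)
      fix y :: 'a
      have "(V (x + y) - V x)\<^sup>2 \<le> (K * norm y)\<^sup>2"
        using VL[of "x + y" x] K by (simp add: abs_le_square_iff[symmetric])
      then have "cap (V x) + ?b * (V (x + y) - V x) - K\<^sup>2 * (norm y)\<^sup>2 \<le> w (x + y)"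
        using cap_ge_tangent[of "V x" "V (x + y)"] by (simp add: w_def power_mult_distrib)
      then have "(cap (V x) + ?b * (V (x + y) - V x) - K\<^sup>2 * (norm y)\<^sup>2) * heat_kernel s y \<le> w (x + y) * heat_kernel s y"
        using s by (intro mult_right_mono) auto
      then show "(cap (V x) + ?b * (V (x + y) - V x)) * heat_kernel s y - ?q y \<le> w (x + y) * heat_kernel s y"
        by (simp add: left_diff_distrib mult.assoc)
    qed
    moreover have "(LBINT y. (cap (V x) + ?b * (V (x + y) - V x)) * heat_kernel s y - ?q y)
       = cap (V x) + ?b * (heat s V x - V x) - (LBINT y. ?q y)"
      by (subst Bochner_Integration.integral_diff[OF lin(1)[OF s] iq]) (simp only: lin(2)[OF s])
    moreover have "(LBINT y. ?q y) \<le> K\<^sup>2 * (?Q * s)"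
      using mult_left_mono[OF heat_kernel_second_moment(2)[OF s, where 'a='a], of "K\<^sup>2"] by simp
    moreover have "?b * (V x - heat s V x) \<le> 2 * (s / m)"
      using VH[OF s, of x] V0[of x] by (intro mult_mono) auto
    then have "- (2 * (s / m)) \<le> ?b * (heat s V x - V x)" by (simp add: right_diff_distrib)
    ultimately have "cap (V x) - 2 * (s / m) - K\<^sup>2 * (?Q * s) \<le> heat s w x" by linarith
    then show ?thesis by (simp add: w_def algebra_simps)
  qed
  \<comment> \<open>With \<open>cap t \<le> 2 t\<close> the decay \<open>H\<^sub>s V \<le> K s\<^sup>-\<^sup>1\<^sup>/\<^sup>4\<close> brings \<open>H\<^sub>s w\<close> below \<open>1/2\<close> once \<open>s\<^sup>1\<^sup>/\<^sup>4 \<ge> 4K\<close>.\<close>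
  define s0 where "s0 = (4 * K + 1) powr 4"
  have s0: "0 < s0" using K by (simp add: s0_def)
  have half: "heat s w x \<le> 1 / 2" if "s0 \<le> s" for s x
  proof -
    have s: "0 < s" using that s0 by simp
    have "heat s w x \<le> 2 * heat s V x" using upper[OF s, of x 0] by (simp add: cap_def)
    also have "\<dots> \<le> 2 * (s powr (- 1 / 4) * K)" using VD[OF s, of x] by simp
    also have "\<dots> \<le> 2 * (s0 powr (- 1 / 4) * K)"
      using K that s0 by (intro mult_left_mono mult_right_mono powr_mono2') auto
    also have "s0 powr (- 1 / 4) = 1 / (4 * K + 1)"
      unfolding s0_def powr_powr using K by (simp add: powr_minus_divide)
    also have "2 * (1 / (4 * K + 1) * K) \<le> 1 / 2" using K by (simp add: divide_simps)
    finally show ?thesis .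
  qed
  define C where "C = 1 + (2 / m + K\<^sup>2 * ?Q) + 4 * K"
  have "0 \<le> 2 / m + K\<^sup>2 * ?Q" using m by simp
  then have C: "1 \<le> C" "2 / m + K\<^sup>2 * ?Q \<le> C" "4 * K \<le> C" using K by (auto simp: C_def)
  have "flat_bump w C s0"
  proof
    show "w x \<le> 1" for x using cap_bounds by (simp add: w_def)
    show "0 \<le> w x" for x using cap_bounds V0 by (simp add: w_def)
    show "w x = 1" if "norm x \<le> 1" for x using cap_bounds(4) V1[OF that] by (simp add: w_def)
    show "w x \<le> C / sqrt (norm x)" if "x \<noteq> 0" for x
    proof -
      have "w x \<le> 2 * V x" using cap_bounds(3) V0 by (simp add: w_def)
      also have "\<dots> \<le> 4 * K / sqrt (norm x)" using Vd[OF that] by simp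
      also have "\<dots> \<le> C / sqrt (norm x)" using C by (intro divide_right_mono) auto
      finally show ?thesis .
    qed
    show "0 \<le> w x - heat s w x" if "0 < s" for s x
    proof -
      have "2 * max 0 (1 - V x) * (heat s V x - V x) \<le> 0"
        using VH(1)[OF that, of x] by (intro mult_nonneg_nonpos) auto
      then show ?thesis using upper[OF that, of x "V x"] by (simp add: w_def)
    qed
    show "w x - heat s w x \<le> C * s" if "0 < s" for s x
      using lower[OF that, of x] C(2) that mult_right_mono[of "2 / m + K\<^sup>2 * ?Q" C s] by linarith
  qed (use wc C s0 half in auto)
  then show ?thesis by blast
qed

section \<open>Superposition of bumps at separated scales\<close>

lemma heat_rescale:
  fixes w :: "'a::euclidean_space \<Rightarrow> real"
  assumes [measurable]: "w \<in> borel_measurable borel" and l: "0 < l" and s: "0 < s"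
  shows "heat s (\<lambda>x. w ((1 / l) *\<^sub>R (x - a))) x = heat (s / l\<^sup>2) w ((1 / l) *\<^sub>R (x - a))"
proof -
  have "heat (l\<^sup>2 * (s / l\<^sup>2)) (\<lambda>x. w ((1 / l) *\<^sub>R (x - a))) x
      = (LBINT z. w ((1 / l) *\<^sub>R (x + l *\<^sub>R z - a)) * heat_kernel (s / l\<^sup>2) z)"
    using l s by (intro heat_scale) auto
  moreover have "(1 / l) *\<^sub>R (x + l *\<^sub>R z - a) = (1 / l) *\<^sub>R (x - a) + z" for z
  proof -
    have "x + l *\<^sub>R z - a = (x - a) + l *\<^sub>R z" by simp
    then show ?thesis using l by (simp only: scaleR_add_right) simp
  qed
  ultimately show ?thesis using l by (simp add: heat_def)
qed

lemma norm_le_norm_minus_add: "norm a \<le> norm (x - a) + norm x" for a x :: "'a::real_normed_vector"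
  using norm_triangle_ineq4[of x "x - a"] by simp

lemma sum_half_powers: "(\<Sum>k<n. c / 2 ^ k) \<le> 2 * c" if "0 \<le> c" for c :: real
proof -
  have "(\<Sum>k<n. c / 2 ^ k) = 2 * c - 2 * c / 2 ^ n" by (induction n) (auto simp: field_simps)
  then show ?thesis using that by simp
qed

text \<open>Here \<open>\<epsilon> (Suc n)\<close> is the depth \<open>1 - a\<^sub>n\<close> of the \<open>n\<close>-th bump, \<open>R n\<close> the distance of its centre from the origin,
  and \<open>r n\<close> the quotient of its radius by this distance.\<close>

locale separated_scales =
  fixes \<kappa> :: real and \<epsilon> r R :: "nat \<Rightarrow> real"
  assumes \<epsilon>_pos: "\<And>n. 0 < \<epsilon> n" and \<epsilon>_half: "\<And>n. \<epsilon> n \<le> 1 / 2" and \<epsilon>_dec: "\<And>n. \<epsilon> (Suc n) \<le> \<epsilon> n"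
    and r_def: "\<And>n. r n = (\<kappa> * \<epsilon> n / 2 ^ n)\<^sup>2" and r_le_1: "\<And>n. r n \<le> 1"
    and radius_large: "\<And>n. 2 ^ n \<le> r n * R n"
    and gap: "\<And>j k. j < k \<Longrightarrow> 8 * R j \<le> (\<epsilon> (Suc k))\<^sup>2 * R k"

text \<open>The ratio \<open>r n\<close> depends on the previous depth \<open>\<epsilon> n\<close> only; the depth \<open>\<epsilon> (Suc n)\<close> is chosen next so that
  \<open>\<phi>\<close> is tiny there compared with \<open>r n\<close>, and the distance \<open>R n\<close> last, so large that all previous distances
  are negligible and the radii grow geometrically.\<close>

lemma scale_sequences:
  fixes \<phi> :: "real \<Rightarrow> real"
  assumes c: "continuous_on {0..} \<phi>" and p0: "\<phi> 0 = 0" and \<kappa>: "0 < \<kappa>" "\<kappa> \<le> 1"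
  shows "\<exists>\<epsilon> r R. separated_scales \<kappa> \<epsilon> r R \<and> (\<forall>n. \<phi> (\<epsilon> (Suc n)) \<le> r n ^ N / (real n + 1))"
proof -
  have small: "\<exists>y. 0 < y \<and> y \<le> b \<and> \<phi> y \<le> d" if b: "0 < b" and d: "0 < d" for b d
  proof -
    from c have "\<forall>e>0. \<exists>\<delta>>0. \<forall>x\<in>{0..}. dist x 0 < \<delta> \<longrightarrow> dist (\<phi> x) (\<phi> 0) < e"
      unfolding continuous_on_iff by (metis atLeast_iff order_refl)
    then obtain \<delta> where \<delta>: "0 < \<delta>" "\<And>x. 0 \<le> x \<Longrightarrow> x < \<delta> \<Longrightarrow> \<bar>\<phi> x\<bar> < d"
      using d p0 by (auto simp: dist_real_def)
    define y where "y = min b (\<delta> / 2)"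
    have y: "0 < y" "y \<le> b" "y < \<delta>" using \<delta>(1) b by (auto simp: y_def)
    then show ?thesis using \<delta>(2)[of y] by (intro exI[of _ y]) auto
  qed
  have "\<exists>\<epsilon>. \<forall>n. (0 < \<epsilon> n \<and> \<epsilon> n \<le> (1 / 2 :: real)) \<and> (\<epsilon> (Suc n) \<le> \<epsilon> n \<and> \<phi> (\<epsilon> (Suc n)) \<le> ((\<kappa> * \<epsilon> n / 2 ^ n)\<^sup>2) ^ N / (real n + 1))"
  proof (rule dependent_nat_choice)
    show "\<exists>x::real. 0 < x \<and> x \<le> 1 / 2" by (rule exI[of _ "1 / 2"]) simp
    fix x :: real and n :: nat
    assume x: "0 < x \<and> x \<le> 1 / 2"
    have "0 < ((\<kappa> * x / 2 ^ n)\<^sup>2) ^ N / (real n + 1)" using x \<kappa> by simp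
    from small[OF _ this, of x] x
    show "\<exists>y. (0 < y \<and> y \<le> 1 / 2) \<and> y \<le> x \<and> \<phi> y \<le> ((\<kappa> * x / 2 ^ n)\<^sup>2) ^ N / (real n + 1)" by force
  qed
  then obtain \<epsilon> where \<epsilon>: "\<And>n. 0 < \<epsilon> n" "\<And>n. \<epsilon> n \<le> (1 / 2 :: real)" "\<And>n. \<epsilon> (Suc n) \<le> \<epsilon> n"
    "\<And>n. \<phi> (\<epsilon> (Suc n)) \<le> ((\<kappa> * \<epsilon> n / 2 ^ n)\<^sup>2) ^ N / (real n + 1)" by blast
  define r where "r = (\<lambda>n. (\<kappa> * \<epsilon> n / 2 ^ n)\<^sup>2)"
  have r0: "0 < r n" for n using \<epsilon>(1)[of n] \<kappa> by (simp add: r_def)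
  have r1: "r n \<le> 1" for n
  proof -
    have "\<kappa> * \<epsilon> n \<le> 1 * 1" using \<kappa> \<epsilon>(1)[of n] \<epsilon>(2)[of n] by (intro mult_mono) auto
    also have "\<dots> \<le> 2 ^ n" by simp
    finally have "\<kappa> * \<epsilon> n / 2 ^ n \<le> 1" by simp
    then show ?thesis using \<kappa> \<epsilon>(1)[of n] by (simp add: r_def power_le_one)
  qed
  define R where "R = rec_nat (1 / r 0) (\<lambda>k Rk. 8 * Rk / (\<epsilon> (Suc (Suc k)))\<^sup>2 + 2 ^ Suc k / r (Suc k))"
  have R0: "R 0 = 1 / r 0" and RS: "R (Suc k) = 8 * R k / (\<epsilon> (Suc (Suc k)))\<^sup>2 + 2 ^ Suc k / r (Suc k)" for k
    by (simp_all add: R_def)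
  have Rpos: "0 < R k" for k
  proof (induction k)
    case (Suc k)
    then show ?case unfolding RS using r0[of "Suc k"] \<epsilon>(1)[of "Suc (Suc k)"] by (intro add_pos_pos divide_pos_pos) auto
  qed (use r0 in \<open>simp add: R0\<close>)
  have big: "2 ^ n \<le> r n * R n" for n
  proof (cases n)
    case 0
    then show ?thesis using r0[of 0] by (simp add: R0)
  next
    case (Suc k)
    have "2 ^ Suc k = r (Suc k) * (2 ^ Suc k / r (Suc k))" using r0[of "Suc k"] by simp
    also have "\<dots> \<le> r (Suc k) * R (Suc k)" using r0[of "Suc k"] Rpos[of k] \<epsilon>(1)[of "Suc (Suc k)"] unfolding RS
      by (intro mult_left_mono) auto
    finally show ?thesis using Suc by simp
  qed
  have step: "8 * R k \<le> (\<epsilon> (Suc (Suc k)))\<^sup>2 * R (Suc k)" for k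
    unfolding RS using r0[of "Suc k"] \<epsilon>(1)[of "Suc (Suc k)"] by (simp add: distrib_left)
  have mono: "R k \<le> R (Suc k)" for k
  proof -
    have "(\<epsilon> (Suc (Suc k)))\<^sup>2 \<le> 1" using \<epsilon>(1,2)[of "Suc (Suc k)"] by (simp add: power_le_one)
    then have "(\<epsilon> (Suc (Suc k)))\<^sup>2 * R (Suc k) \<le> R (Suc k)" using Rpos[of "Suc k"] by (simp add: mult_le_cancel_right1)
    then show ?thesis using step[of k] Rpos[of k] by linarith
  qed
  have gap: "8 * R j \<le> (\<epsilon> (Suc k))\<^sup>2 * R k" if jk: "j < k" for j k
  proof -
    obtain k' where k': "k = Suc k'" using jk by (cases k) auto
    have "R j \<le> R k'" using lift_Suc_mono_le[of R j k'] mono jk k' by simp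
    then show ?thesis using step[of k'] k' by simp
  qed
  have "separated_scales \<kappa> \<epsilon> r R" by standard (use \<epsilon> r1 big gap in \<open>auto simp: r_def\<close>)
  with \<epsilon>(4) show ?thesis unfolding r_def[symmetric] by (intro exI[of _ \<epsilon>] exI[of _ r] exI[of _ R]) (simp add: r_def)
qed

text \<open>The copies of \<open>w\<close> are placed along the direction \<open>e\<close>.  The constant \<open>\<kappa> = 1 / (8 C)\<close> cancels the decay constant
  \<open>C\<close>: a copy is at most \<open>2 \<kappa> C = 1/4\<close> times \<open>\<epsilon> k / 2 ^ k\<close> at distance \<open>R k / 4\<close> or more from its centre.\<close>

locale bump_array = flat_bump w C s0 + separated_scales "1 / (8 * C)" \<epsilon> r R
  for w :: "'a::euclidean_space \<Rightarrow> real" and C s0 \<epsilon> r R +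
  fixes e :: 'a
  assumes e: "norm e = 1"
begin

definition radius where "radius k = r k * R k"

definition bump where "bump k x = w ((1 / radius k) *\<^sub>R (x - R k *\<^sub>R e))"

definition weight where "weight k = 1 - \<epsilon> (Suc k)"

definition bump_sum where "bump_sum x = (\<Sum>k. weight k * bump k x)"

lemma r_pos: "0 < r k" using \<epsilon>_pos[of k] C by (simp add: r_def)

lemma radius_pos: "0 < radius k"
  using radius_large[of k] unfolding radius_def by (smt (verit) zero_less_power)

lemma R_pos: "0 < R k"
  using radius_pos[of k] r_pos[of k] by (simp add: radius_def zero_less_mult_iff)

lemma radius_le_R: "radius k \<le> R k"
  using mult_right_mono[OF r_le_1[of k], of "R k"] R_pos[of k] by (simp add: radius_def)

lemma R_large: "2 ^ k \<le> R k"
  using radius_le_R[of k] radius_large[of k] by (simp add: radius_def)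

lemma gap': "j < k \<Longrightarrow> 8 * R j \<le> R k"
proof -
  assume jk: "j < k"
  have "(\<epsilon> (Suc k))\<^sup>2 \<le> 1" using \<epsilon>_pos[of "Suc k"] \<epsilon>_half[of "Suc k"] by (simp add: power_le_one)
  then have "(\<epsilon> (Suc k))\<^sup>2 * R k \<le> R k" using R_pos[of k] by (simp add: mult_le_cancel_right1)
  then show ?thesis using gap[OF jk] by linarith
qed

lemma \<epsilon>_mono: "j \<le> k \<Longrightarrow> \<epsilon> k \<le> \<epsilon> j"
  by (rule lift_Suc_antimono_le[of \<epsilon>]) (use \<epsilon>_dec in auto)

lemma weight_bounds: "1 / 2 \<le> weight k" "weight k \<le> 1"
  using \<epsilon>_pos[of "Suc k"] \<epsilon>_half[of "Suc k"] by (auto simp: weight_def)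

lemma weighted_le: "0 \<le> t \<Longrightarrow> weight k * t \<le> t"
  using weight_bounds[of k] by (simp add: mult_left_le_one_le)

lemma w_measurable [measurable]: "w \<in> borel_measurable borel"
  using w_cont by (rule borel_measurable_continuous_onI)

lemma bump_continuous: "continuous_on UNIV (bump k)"
  unfolding bump_def[abs_def]
  by (rule continuous_on_compose2[OF w_cont]) (auto intro!: continuous_intros)

lemma bump_measurable [measurable]: "bump k \<in> borel_measurable borel"
  using bump_continuous by (rule borel_measurable_continuous_onI)

lemma bump_bounds: "0 \<le> bump k x" "bump k x \<le> 1"
  using w_nonneg w_le_1 by (auto simp: bump_def)

lemma bump_flat: "x \<in> cball (R k *\<^sub>R e) (radius k) \<Longrightarrow> bump k x = 1"
  unfolding bump_def using radius_pos[of k] by (intro w_flat) (simp add: dist_norm norm_minus_commute)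

lemma heat_bump: "0 < s \<Longrightarrow> heat s (bump k) x = heat (s / (radius k)\<^sup>2) w ((1 / radius k) *\<^sub>R (x - R k *\<^sub>R e))"
  unfolding bump_def[abs_def] using radius_pos by (intro heat_rescale) auto

lemma bump_super: "0 < s \<Longrightarrow> 0 \<le> bump k x - heat s (bump k) x"
  using w_super radius_pos[of k] by (simp add: heat_bump bump_def)

lemma bump_modulus:
  assumes s: "0 < s"
  shows "bump k x - heat s (bump k) x \<le> C * s * (1 / 2) ^ k"
proof -
  have "bump k x - heat s (bump k) x \<le> C * (s / (radius k)\<^sup>2)"
    unfolding heat_bump[OF s] bump_def using s radius_pos[of k] by (intro w_modulus) simp
  also have "\<dots> \<le> C * (s * (1 / 2) ^ k)"
  proof (rule mult_left_mono)
    have "(2::real) ^ k \<le> (2 ^ k)\<^sup>2" by (simp add: power2_eq_square)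
    also have "\<dots> \<le> (radius k)\<^sup>2" using radius_large[of k] by (intro power_mono) (auto simp: radius_def)
    finally have "1 / (radius k)\<^sup>2 \<le> 1 / 2 ^ k" using radius_pos[of k] by (intro divide_left_mono) auto
    then show "s / (radius k)\<^sup>2 \<le> s * (1 / 2) ^ k"
      using mult_left_mono[of "1 / (radius k)\<^sup>2" "1 / 2 ^ k" s] s by (simp add: power_one_over)
  qed (use C in simp)
  finally show ?thesis by (simp add: mult.assoc)
qed

text \<open>The form in which the decay of \<open>w\<close> is used: distance \<open>D\<close> from the centre costs the square root of
  the quotient of radius and \<open>D\<close>.\<close>

lemma bump_decay:
  assumes D: "D \<le> norm (x - R k *\<^sub>R e)" and q: "0 < q" "radius k \<le> q\<^sup>2 * D"
  shows "bump k x \<le> C * q"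
proof -
  have rp: "0 < radius k" by (rule radius_pos)
  have "radius k \<le> q\<^sup>2 * norm (x - R k *\<^sub>R e)"
    using q(2) mult_left_mono[OF D zero_le_power2, of q] by linarith
  moreover have "norm ((1 / radius k) *\<^sub>R (x - R k *\<^sub>R e)) = norm (x - R k *\<^sub>R e) / radius k" (is "norm ?z = _")
    using rp by (simp only: norm_scaleR) simp
  ultimately have "1 / q\<^sup>2 \<le> norm ?z"
    using rp q by (simp only:) (simp add: field_simps)
  then have z: "(1 / q)\<^sup>2 \<le> norm ?z" by (simp add: power_divide)
  have nz: "0 < norm ?z" using z q by (smt (verit) zero_less_divide_1_iff zero_less_power)
  have "1 / q \<le> sqrt (norm ?z)" using z q by (intro real_le_rsqrt) auto
  then have "C / sqrt (norm ?z) \<le> C / (1 / q)" using q C nz by (intro divide_left_mono) auto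
  moreover have "w ?z \<le> C / sqrt (norm ?z)" using nz by (intro w_decay) auto
  ultimately show ?thesis using q unfolding bump_def by simp
qed

lemma norm_center [simp]: "norm (R k *\<^sub>R e) = R k"
  using R_pos[of k] e by simp

lemma bump_far:
  assumes "R k / 4 \<le> norm (x - R k *\<^sub>R e)"
  shows "bump k x \<le> \<epsilon> k / 4 / 2 ^ k"
proof -
  let ?q = "2 * (1 / (8 * C) * \<epsilon> k / 2 ^ k)"
  have "bump k x \<le> C * ?q"
  proof (rule bump_decay[OF assms])
    show "0 < ?q" using C \<epsilon>_pos[of k] by simp
    have "?q\<^sup>2 = 4 * r k" unfolding r_def by (simp only: power_mult_distrib) simp
    then show "radius k \<le> ?q\<^sup>2 * (R k / 4)" by (simp add: radius_def)
  qed
  then show ?thesis using C by simp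
qed

text \<open>Near the \<open>k\<close>-th centre all other bumps together contribute at most half of the depth \<open>\<epsilon> (Suc k)\<close>.  An earlier
  bump is small there because \<open>R k\<close> is huge compared with its own scale, a later one because its
  ratio \<open>r j\<close> was chosen after \<open>\<epsilon> (Suc k)\<close>.\<close>

lemma bump_interaction:
  assumes x: "norm (x - R k *\<^sub>R e) < R k / 2" and jk: "j \<noteq> k"
  shows "bump j x \<le> \<epsilon> (Suc k) / 4 / 2 ^ j"
proof (cases "j < k")
  case True
  let ?q = "2 * (1 / (8 * C) * \<epsilon> j / 2 ^ j) * \<epsilon> (Suc k)"
  have "bump j x \<le> C * ?q"
  proof (rule bump_decay[of "R k / 4"])
    have "norm (R k *\<^sub>R e) \<le> norm (x - R k *\<^sub>R e) + norm x"
      by (rule norm_le_norm_minus_add)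
    moreover have "norm x \<le> norm (x - R j *\<^sub>R e) + norm (R j *\<^sub>R e)"
      using norm_triangle_ineq[of "x - R j *\<^sub>R e" "R j *\<^sub>R e"] by simp
    ultimately show "R k / 4 \<le> norm (x - R j *\<^sub>R e)"
      using x gap'[OF True] R_pos[of k] R_pos[of j] norm_center[of j] norm_center[of k] by linarith
    show "0 < ?q" using C \<epsilon>_pos[of j] \<epsilon>_pos[of "Suc k"] by simp
    have q: "?q\<^sup>2 * (R k / 4) = r j * ((\<epsilon> (Suc k))\<^sup>2 * R k)"
      unfolding r_def power_mult_distrib by simp
    have "R j \<le> (\<epsilon> (Suc k))\<^sup>2 * R k" using gap[OF True] R_pos[of j] by linarith
    then show "radius j \<le> ?q\<^sup>2 * (R k / 4)"
      unfolding q radius_def using r_pos[of j] by (intro mult_left_mono) auto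
  qed
  also have "\<dots> = \<epsilon> j * (\<epsilon> (Suc k) / 4 / 2 ^ j)" using C by simp
  also have "\<dots> \<le> 1 * (\<epsilon> (Suc k) / 4 / 2 ^ j)"
    using \<epsilon>_half[of j] \<epsilon>_pos[of "Suc k"] by (intro mult_right_mono) auto
  finally show ?thesis by simp
next
  case False
  then have kj: "k < j" using jk by simp
  have "norm (R j *\<^sub>R e) \<le> norm (x - R j *\<^sub>R e) + norm x"
    by (rule norm_le_norm_minus_add)
  moreover have "norm x \<le> norm (x - R k *\<^sub>R e) + norm (R k *\<^sub>R e)"
    using norm_triangle_ineq[of "x - R k *\<^sub>R e" "R k *\<^sub>R e"] by simp
  ultimately have "R j / 4 \<le> norm (x - R j *\<^sub>R e)"
    using x gap'[OF kj] R_pos[of k] R_pos[of j] norm_center[of j] norm_center[of k] by linarith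
  then have "bump j x \<le> \<epsilon> j / 4 / 2 ^ j" by (rule bump_far)
  also have "\<dots> \<le> \<epsilon> (Suc k) / 4 / 2 ^ j"
    using \<epsilon>_mono[of "Suc k" j] kj by (intro divide_right_mono) auto
  finally show ?thesis .
qed

text \<open>A point lies close to at most one centre.  If it is close to the \<open>k\<close>-th one, the own bump
  contributes at most \<open>1 - \<epsilon> (Suc k)\<close> and the others at most half of \<open>\<epsilon> (Suc k)\<close>; if it is close to none,
  the bumps sum up to at most \<open>1/2\<close>.\<close>

lemma partial_sum_bound: "\<exists>\<eta>>0. \<forall>n. (\<Sum>k<n. weight k * bump k x) \<le> 1 - \<eta>"
proof (cases "\<exists>k. norm (x - R k *\<^sub>R e) < R k / 2")
  case True
  then obtain k where k: "norm (x - R k *\<^sub>R e) < R k / 2" by blast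
  let ?\<eta> = "\<epsilon> (Suc k) / 2"
  have "(\<Sum>j<n. weight j * bump j x) \<le> 1 - ?\<eta>" for n
  proof -
    have "(\<Sum>j<n. weight j * bump j x) \<le> (\<Sum>j<n. (if j = k then weight k else 0) + (\<epsilon> (Suc k) / 4) / 2 ^ j)"
    proof (rule sum_mono)
      fix j
      show "weight j * bump j x \<le> (if j = k then weight k else 0) + (\<epsilon> (Suc k) / 4) / 2 ^ j"
      proof (cases "j = k")
        case True
        have "weight k * bump k x \<le> weight k" using weight_bounds[of k] bump_bounds[of k x] by (simp add: mult_left_le)
        then show ?thesis using True \<epsilon>_pos[of "Suc k"] by (simp add: add_increasing2)
      next
        case False
        have "weight j * bump j x \<le> bump j x" by (intro weighted_le bump_bounds)
        then show ?thesis using bump_interaction[OF k False] False by simp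
      qed
    qed
    also have "\<dots> = (\<Sum>j<n. if j = k then weight k else 0) + (\<Sum>j<n. (\<epsilon> (Suc k) / 4) / 2 ^ j)" by (rule sum.distrib)
    also have "\<dots> \<le> weight k + 2 * (\<epsilon> (Suc k) / 4)"
      using weight_bounds[of k] \<epsilon>_pos[of "Suc k"] by (intro add_mono sum_half_powers) (auto simp: sum.delta)
    finally show ?thesis by (simp add: weight_def)
  qed
  then show ?thesis using \<epsilon>_pos[of "Suc k"] by (intro exI[of _ ?\<eta>]) auto
next
  case False
  have "(\<Sum>k<n. weight k * bump k x) \<le> 1 - 1 / 2" for n
  proof -
    have "(\<Sum>k<n. weight k * bump k x) \<le> (\<Sum>k<n. (1 / 4) / 2 ^ k)"
    proof (rule sum_mono)
      fix k
      have "R k / 2 \<le> norm (x - R k *\<^sub>R e)" using False by (simp add: not_less)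
      then have "bump k x \<le> \<epsilon> k / 4 / 2 ^ k" using R_pos[of k] by (intro bump_far) linarith
      also have "\<dots> \<le> (1 / 4) / 2 ^ k" using \<epsilon>_half[of k] by (intro divide_right_mono) auto
      finally have "bump k x \<le> (1 / 4) / 2 ^ k" .
      moreover have "weight k * bump k x \<le> bump k x" by (intro weighted_le bump_bounds)
      ultimately show "weight k * bump k x \<le> (1 / 4) / 2 ^ k" by linarith
    qed
    also have "\<dots> \<le> 2 * (1 / 4)" by (rule sum_half_powers) simp
    finally show ?thesis by simp
  qed
  then show ?thesis by (intro exI[of _ "1 / 2"]) auto
qed

lemma term_nonneg: "0 \<le> weight k * bump k x"
  using weight_bounds[of k] bump_bounds[of k x] by simp

lemma bump_sum_summable: "summable (\<lambda>k. weight k * bump k x)"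
proof -
  obtain \<eta> where "\<forall>n. (\<Sum>k<n. weight k * bump k x) \<le> 1 - \<eta>" using partial_sum_bound by blast
  then show ?thesis by (intro summableI_nonneg_bounded[where x="1 - \<eta>"] term_nonneg) auto
qed

lemma bump_sum_less_1: "bump_sum x < 1"
proof -
  obtain \<eta> where \<eta>: "\<eta> > 0" "\<forall>n. (\<Sum>k<n. weight k * bump k x) \<le> 1 - \<eta>" using partial_sum_bound by blast
  have "bump_sum x \<le> 1 - \<eta>" unfolding bump_sum_def using \<eta> by (intro suminf_le_const bump_sum_summable) auto
  then show ?thesis using \<eta>(1) by linarith
qed

lemma bump_sum_nonneg: "0 \<le> bump_sum x"
  unfolding bump_sum_def by (intro suminf_nonneg bump_sum_summable term_nonneg)

lemma partial_le_bump_sum: "(\<Sum>k<n. weight k * bump k x) \<le> bump_sum x"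
  unfolding bump_sum_def by (intro sum_le_suminf bump_sum_summable term_nonneg) auto

lemma term_le_bump_sum: "weight k * bump k x \<le> bump_sum x"
proof -
  have "weight k * bump k x \<le> (\<Sum>j<Suc k. weight j * bump j x)"
    by (rule member_le_sum) (auto intro: term_nonneg)
  then show ?thesis using partial_le_bump_sum[of x "Suc k"] by linarith
qed

text \<open>On a ball around the origin all but finitely many bumps are bounded by \<open>2\<^sup>-\<^sup>k\<close>, so the series
  converges uniformly there.\<close>

lemma bump_sum_continuous: "continuous_on UNIV bump_sum"
proof -
  have "continuous_on (ball 0 \<rho>) bump_sum" for \<rho> :: real
  proof -
    obtain m :: nat where m: "2 * \<rho> < 2 ^ m" using real_arch_pow[of 2 "2 * \<rho>"] by auto
    have bd: "norm (weight k * bump k x) \<le> (1 / 2) ^ k" if "m \<le> k" "x \<in> ball 0 \<rho>" for k x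
    proof -
      have "(2::real) ^ m \<le> 2 ^ k" using that by (intro power_increasing) auto
      then have "2 * \<rho> < R k" using m R_large[of k] by linarith
      moreover have "norm (R k *\<^sub>R e) \<le> norm (x - R k *\<^sub>R e) + norm x"
        by (rule norm_le_norm_minus_add)
      ultimately have "R k / 4 \<le> norm (x - R k *\<^sub>R e)" using that(2) R_pos[of k] norm_center[of k] by simp
      then have "bump k x \<le> \<epsilon> k / 4 / 2 ^ k" by (rule bump_far)
      also have "\<dots> \<le> 1 / 2 ^ k" using \<epsilon>_half[of k] by (intro divide_right_mono) auto
      finally have "bump k x \<le> (1 / 2) ^ k" by (simp add: power_one_over)
      moreover have "weight k * bump k x \<le> bump k x" by (intro weighted_le bump_bounds)
      ultimately show ?thesis using term_nonneg[of k x] by simp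
    qed
    have ul: "uniform_limit (ball 0 \<rho>) (\<lambda>n x. \<Sum>k<n. weight k * bump k x) (\<lambda>x. \<Sum>k. weight k * bump k x) sequentially"
      using bd by (intro Weierstrass_m_test_ev[where M="\<lambda>k. (1 / 2) ^ k"])
        (auto simp: eventually_sequentially summable_geometric intro!: exI[of _ m])
    have "continuous_on (ball 0 \<rho>) (\<lambda>x. \<Sum>k. weight k * bump k x)"
      by (rule uniform_limit_theorem[OF _ ul])
        (auto intro!: always_eventually continuous_intros continuous_on_subset[OF bump_continuous])
    then show ?thesis by (simp add: bump_sum_def[abs_def])
  qed
  then have "continuous_on (\<Union>n::nat. ball 0 (real n)) bump_sum"
    by (intro continuous_on_open_UN) auto
  moreover have "(\<Union>n::nat. ball (0::'a) (real n)) = UNIV"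
    using reals_Archimedean2 by auto
  ultimately show ?thesis by simp
qed

lemma bump_sum_measurable [measurable]: "bump_sum \<in> borel_measurable borel"
  using bump_sum_continuous by (rule borel_measurable_continuous_onI)

lemma heat_partial_sum:
  assumes s: "0 < s"
  shows "heat s (\<lambda>x. \<Sum>k<n. weight k * bump k x) x = (\<Sum>k<n. weight k * heat s (bump k) x)"
proof -
  have i: "integrable lborel (\<lambda>y. bump k (x + y) * heat_kernel s y)" for k
    using bump_bounds s by (intro integrable_bounded_heat_kernel[where M=1]) auto
  have "heat s (\<lambda>x. \<Sum>k<n. weight k * bump k x) x = (LBINT y. (\<Sum>k<n. weight k * (bump k (x + y) * heat_kernel s y)))"
    by (simp add: heat_def sum_distrib_right mult.assoc)
  also have "\<dots> = (\<Sum>k<n. LBINT y. weight k * (bump k (x + y) * heat_kernel s y))"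
    using i by (intro Bochner_Integration.integral_sum integrable_mult_right)
  finally show ?thesis by (simp add: heat_def)
qed

lemma heat_bump_sum_tendsto:
  assumes s: "0 < s"
  shows "(\<lambda>n. \<Sum>k<n. weight k * (bump k x - heat s (bump k) x)) \<longlonglongrightarrow> bump_sum x - heat s bump_sum x"
proof -
  have lim: "(\<lambda>n. \<Sum>k<n. weight k * bump k x) \<longlonglongrightarrow> bump_sum x" for x
    unfolding bump_sum_def using bump_sum_summable by (rule summable_LIMSEQ)
  have "(\<lambda>n. LBINT y. (\<Sum>k<n. weight k * bump k (x + y)) * heat_kernel s y) \<longlonglongrightarrow> (LBINT y. bump_sum (x + y) * heat_kernel s y)"
  proof (rule integral_dominated_convergence[where w="heat_kernel s"])
    show "integrable lborel (heat_kernel s :: 'a \<Rightarrow> real)" by (rule integral_heat_kernel[OF s])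
    show "AE y in lborel. (\<lambda>n. (\<Sum>k<n. weight k * bump k (x + y)) * heat_kernel s y) \<longlonglongrightarrow> bump_sum (x + y) * heat_kernel s y"
      by (intro always_eventually allI tendsto_intros lim)
    show "AE y in lborel. norm ((\<Sum>k<n. weight k * bump k (x + y)) * heat_kernel s y) \<le> heat_kernel s y" for n
    proof (intro always_eventually allI)
      fix y
      have "0 \<le> (\<Sum>k<n. weight k * bump k (x + y))" by (intro sum_nonneg term_nonneg)
      moreover have "(\<Sum>k<n. weight k * bump k (x + y)) \<le> 1"
        using partial_le_bump_sum[of "x + y" n] bump_sum_less_1[of "x + y"] by linarith
      ultimately show "norm ((\<Sum>k<n. weight k * bump k (x + y)) * heat_kernel s y) \<le> heat_kernel s y"
        using s by (simp add: abs_mult mult_left_le_one_le)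
    qed
  qed measurable
  then have "(\<lambda>n. \<Sum>k<n. weight k * heat s (bump k) x) \<longlonglongrightarrow> heat s bump_sum x"
    using heat_partial_sum[OF s] by (simp add: heat_def)
  from tendsto_diff[OF lim[of x] this] show ?thesis
    by (simp add: sum_subtractf[symmetric] right_diff_distrib)
qed

text \<open>Every bump is superharmonic, so the defect of the sum dominates the defect of each term.\<close>

lemma heat_bump_sum_term:
  assumes s: "0 < s"
  shows "weight k * (bump k x - heat s (bump k) x) \<le> bump_sum x - heat s bump_sum x"
proof (rule Lim_bounded2[OF heat_bump_sum_tendsto[OF s]])
  show "\<forall>n\<ge>Suc k. weight k * (bump k x - heat s (bump k) x) \<le> (\<Sum>j<n. weight j * (bump j x - heat s (bump j) x))"
    using weight_bounds bump_super[OF s]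
    by (intro allI impI member_le_sum[of k _ "\<lambda>j. weight j * (bump j x - heat s (bump j) x)"] mult_nonneg_nonneg)
      (auto intro: order_trans[OF _ weight_bounds(1)])
qed

lemma bump_sum_super: "0 < s \<Longrightarrow> 0 \<le> bump_sum x - heat s bump_sum x"
  using heat_bump_sum_term[of s 0 x] bump_super[of s 0 x] weight_bounds[of 0]
  by (smt (verit) mult_nonneg_nonneg divide_nonneg_nonneg)

text \<open>The \<open>k\<close>-th bump lives on the scale of its radius, which is at least \<open>2\<^sup>k\<close>, and so its modulus of
  superharmonicity is at most \<open>C s / 2\<^sup>k\<close>; these bounds are summable.\<close>

lemma bump_sum_modulus:
  assumes s: "0 < s"
  shows "bump_sum x - heat s bump_sum x \<le> 2 * C * s"
proof (rule Lim_bounded[OF heat_bump_sum_tendsto[OF s]])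
  have "(\<Sum>k<n. weight k * (bump k x - heat s (bump k) x)) \<le> 2 * (C * s)" for n
  proof -
    have "(\<Sum>k<n. weight k * (bump k x - heat s (bump k) x)) \<le> (\<Sum>k<n. (C * s) / 2 ^ k)"
    proof (rule sum_mono)
      fix k
      have "weight k * (bump k x - heat s (bump k) x) \<le> bump k x - heat s (bump k) x"
        by (intro weighted_le bump_super s)
      also have "\<dots> \<le> C * s / 2 ^ k" using bump_modulus[OF s, of k x] by (simp add: power_one_over)
      finally show "weight k * (bump k x - heat s (bump k) x) \<le> C * s / 2 ^ k" .
    qed
    also have "\<dots> \<le> 2 * (C * s)" using C s by (intro sum_half_powers) simp
    finally show ?thesis .
  qed
  then show "\<forall>n\<ge>0. (\<Sum>k<n. weight k * (bump k x - heat s (bump k) x)) \<le> 2 * C * s" by (simp add: mult.assoc)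
qed

definition solution where "solution x = 1 - bump_sum x"

lemma solution_bounds: "0 < solution x" "solution x \<le> 1"
  using bump_sum_less_1[of x] bump_sum_nonneg[of x] by (auto simp: solution_def)

lemma solution_continuous: "continuous_on UNIV solution"
  unfolding solution_def[abs_def] by (intro continuous_intros bump_sum_continuous)

lemma heat_solution:
  assumes s: "0 < s"
  shows "heat s solution x - solution x = bump_sum x - heat s bump_sum x"
proof -
  have b: "\<bar>bump_sum y\<bar> \<le> 1" for y using bump_sum_less_1[of y] bump_sum_nonneg[of y] by simp
  have i: "integrable lborel (\<lambda>y. bump_sum (x + y) * heat_kernel s y)"
    using b s by (intro integrable_bounded_heat_kernel) auto
  have "heat s solution x = (LBINT y. heat_kernel s y - bump_sum (x + y) * heat_kernel s y)"
    by (simp add: heat_def solution_def left_diff_distrib)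
  also have "\<dots> = 1 - heat s bump_sum x"
    using i integral_heat_kernel[OF s, where 'a='a] by (simp add: heat_def)
  finally show ?thesis by (simp add: solution_def)
qed

lemma solution_super: "0 < s \<Longrightarrow> 0 \<le> heat s solution x - solution x"
  using bump_sum_super[of s x] heat_solution[of s x] by simp

lemma solution_modulus: "0 < s \<Longrightarrow> \<bar>heat s solution x - solution x\<bar> \<le> 2 * C * s"
  using solution_super[of s x] bump_sum_modulus[of s x] heat_solution[of s x] by simp

lemma solution_measurable [measurable]: "solution \<in> borel_measurable borel"
  using solution_continuous by (rule borel_measurable_continuous_onI)

lemma solution_abs_le: "\<bar>solution x\<bar> \<le> 1"
  using solution_bounds[of x] by simp

lemma solution_small: "x \<in> cball (R k *\<^sub>R e) (radius k) \<Longrightarrow> solution x \<le> \<epsilon> (Suc k)"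
  using term_le_bump_sum[of k x] bump_flat[of x k] by (simp add: solution_def weight_def)

text \<open>For times \<open>s\<close> comparable with the square of the radius, the heat semigroup has spread the bump out to
  at most \<open>1/2\<close>, while the bump itself equals \<open>1\<close> at \<open>x\<close>.  Integrating this gap over such times against
  the stable density gives the scale-invariant order \<open>radius\<^sup>-\<^sup>\<alpha>\<close>, uniformly in the depth of the bump.\<close>

lemma solution_generator_lower_bound:
  assumes \<alpha>: "0 < \<alpha>" "\<alpha> < 2" and x: "x \<in> cball (R k *\<^sub>R e) (radius k)"
  shows "1 / 4 * 2 powr (- 1 - \<alpha> / 2) * s0 powr (- \<alpha> / 2) / stable_mass \<alpha> * radius k powr - \<alpha> \<le> stable_generator \<alpha> solution x"
proof -
  let ?l = "radius k" and ?a = "s0 * (radius k)\<^sup>2"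
  have l: "0 < ?l" by (rule radius_pos)
  note i = stable_generator_integrable(1)[OF \<alpha> solution_measurable solution_abs_le solution_modulus]
  have "1 / 4 * 2 powr (- 1 - \<alpha> / 2) * ?a powr (- \<alpha> / 2) \<le> (LBINT s. stable_density \<alpha> s * (heat s solution x - solution x))"
  proof (rule stable_integral_lower_bound[OF i \<alpha>(1) solution_super])
    show "0 < ?a" using s0 l by simp
    show "1 / 4 \<le> heat s solution x - solution x" if "?a \<le> s" "s \<le> 2 * ?a" for s
    proof -
      have s: "0 < s" using that s0 l by (smt (verit) mult_pos_pos zero_less_power)
      have "s0 \<le> s / ?l\<^sup>2" using that l by (simp add: pos_le_divide_eq)
      then have "heat s (bump k) x \<le> 1 / 2" unfolding heat_bump[OF s] by (rule w_half)
      then have "1 / 2 \<le> bump k x - heat s (bump k) x" using bump_flat[OF x] by simp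
      then have "1 / 2 * (1 / 2) \<le> weight k * (bump k x - heat s (bump k) x)"
        using weight_bounds[of k] by (intro mult_mono) auto
      then show ?thesis using heat_bump_sum_term[OF s, of k x] heat_solution[OF s, of x] by simp
    qed
  qed auto
  moreover have "?a powr (- \<alpha> / 2) = s0 powr (- \<alpha> / 2) * ?l powr - \<alpha>"
    using s0 l powr_powr[of ?l 2 "- \<alpha> / 2"] by (simp add: powr_mult)
  ultimately show ?thesis
    using stable_mass_pos[OF \<alpha>] by (simp add: stable_generator_def field_simps)
qed

end

section \<open>The coefficient and its Riesz potential\<close>

lemma solves_frac_eqI:
  fixes u :: "'a::euclidean_space \<Rightarrow> real"
  assumes \<alpha>: "0 < \<alpha>" "\<alpha> < 2" and uc: "continuous_on UNIV u" and u: "\<And>x. \<bar>u x\<bar> \<le> M"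
    and C: "\<And>s x. 0 < s \<Longrightarrow> \<bar>heat s u x - u x\<bar> \<le> C * s"
    and eq: "\<And>x. \<rho> x * \<phi> (u x) = stable_generator \<alpha> u x"
  shows "solves_frac_eq \<alpha> \<rho> \<phi> u"
proof -
  have um[measurable]: "u \<in> borel_measurable borel" using uc by (rule borel_measurable_continuous_onI)
  note [measurable] = measurable_stable_generator[OF um, of \<alpha>]
  obtain B where b: "\<And>x. \<bar>stable_generator \<alpha> u x\<bar> \<le> B" using stable_generator_bounded[OF \<alpha> um u C] by blast
  have "set_integrable lborel K (stable_generator \<alpha> u)" if "compact K" for K
    unfolding set_integrable_def
  proof -
    have [measurable]: "K \<in> sets borel" using that by (rule borel_compact)
    have "integrable lborel (\<lambda>x. stable_generator \<alpha> u x * indicator K x)"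
      using b emeasure_compact_finite[OF that] by (intro integrable_bounded_mult[where M=B]) auto
    then show "integrable lborel (\<lambda>x. indicator K x *\<^sub>R stable_generator \<alpha> u x)" by (simp add: mult.commute)
  qed
  then show ?thesis
    unfolding solves_frac_eq_def eq using uc weak_frac_laplacian[OF \<alpha> _ um u C] by auto
qed

lemma solves_frac_eq_const:
  assumes \<alpha>: "0 < \<alpha>" "\<alpha> < 2" and c: "\<phi> c = 0"
  shows "solves_frac_eq \<alpha> \<rho> \<phi> (\<lambda>_::'a::euclidean_space. c)"
proof -
  have h: "heat s (\<lambda>_::'a. c) x = c" if "0 < s" for s x
    using integral_heat_kernel[OF that, where 'a='a] by (simp add: heat_def)
  have g: "stable_generator \<alpha> (\<lambda>_::'a. c) x = 0" for x
  proof -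
    have "(\<lambda>s. stable_density \<alpha> s * (heat s (\<lambda>_::'a. c) x - c)) = (\<lambda>_. 0)"
      using h by (auto simp: stable_density_def fun_eq_iff)
    then show ?thesis by (simp add: stable_generator_def)
  qed
  show ?thesis
    by (rule solves_frac_eqI[OF \<alpha>, where M="\<bar>c\<bar>" and C=0]) (use h g c in auto)
qed

text \<open>The ball must avoid \<open>x\<close>, because \<open>0 powr \<beta> = 0\<close> for every \<open>\<beta>\<close>.\<close>

lemma riesz_potential_lower_bound:
  fixes \<rho> :: "'a::euclidean_space \<Rightarrow> real"
  assumes A: "\<And>y. y \<in> cball z l \<Longrightarrow> A \<le> \<rho> y" "0 \<le> A" and l: "0 \<le> l" and \<beta>: "\<beta> \<le> 0"
    and D: "\<And>y. y \<in> cball z l \<Longrightarrow> y \<noteq> x \<and> norm (x - y) \<le> D"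
  shows "ennreal (A * D powr \<beta> * (unit_ball_vol (real DIM('a)) * l ^ DIM('a)))
     \<le> (\<integral>\<^sup>+ y. ennreal (\<rho> y * norm (x - y) powr \<beta>) \<partial>lborel)"
proof -
  have "ennreal (A * D powr \<beta> * (unit_ball_vol (real DIM('a)) * l ^ DIM('a)))
     = (\<integral>\<^sup>+ y. ennreal (A * D powr \<beta>) * indicator (cball z l) y \<partial>lborel)"
    using A(2) l by (subst nn_integral_cmult_indicator) (auto simp: emeasure_cball ennreal_mult[symmetric])
  also have "\<dots> \<le> (\<integral>\<^sup>+ y. ennreal (\<rho> y * norm (x - y) powr \<beta>) \<partial>lborel)"
  proof (rule nn_integral_mono)
    fix y
    show "ennreal (A * D powr \<beta>) * indicator (cball z l) y \<le> ennreal (\<rho> y * norm (x - y) powr \<beta>)"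
    proof (cases "y \<in> cball z l")
      case True
      then have "D powr \<beta> \<le> norm (x - y) powr \<beta>" using D[OF True] \<beta> by (intro powr_mono2') auto
      then have "A * D powr \<beta> \<le> \<rho> y * norm (x - y) powr \<beta>" using A(1)[OF True] A(2) by (intro mult_mono) auto
      then show ?thesis using True by (simp add: ennreal_leI)
    qed simp
  qed
  finally show ?thesis .
qed

lemma ennreal_eq_top_if_unbounded:
  assumes "\<And>M::real. \<exists>c\<ge>M. ennreal c \<le> I"
  shows "I = \<infinity>"
proof (rule ccontr)
  assume "I \<noteq> \<infinity>"
  then obtain i where i: "I = ennreal i" "0 \<le> i" by (cases I) auto
  obtain c where "i + 1 \<le> c" "ennreal c \<le> I" using assms by blast
  then show False using i by (simp add: ennreal_le_iff)
qed

text \<open>A ball of radius \<open>l\<close> at distance \<open>l\<close> from \<open>x\<close> contributes a multiple of \<open>l\<^sup>\<alpha>\<close>.\<close>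

lemma riesz_potential_one:
  assumes "0 < \<alpha>" "\<alpha> < 2" "3 \<le> DIM('a::euclidean_space)"
  shows "(\<integral>\<^sup>+ y. ennreal (1 * norm (x - y) powr (\<alpha> - real DIM('a))) \<partial>(lborel :: 'a measure)) = \<infinity>"
proof (rule ennreal_eq_top_if_unbounded)
  fix M :: real
  let ?\<beta> = "\<alpha> - real DIM('a)"
  define k where "k = 3 powr ?\<beta> * unit_ball_vol (real DIM('a))"
  have k: "0 < k" by (simp add: k_def)
  define l where "l = (max 1 (M / k)) powr (1 / \<alpha>)"
  have l: "0 < l" by (simp add: l_def)
  have la: "l powr \<alpha> = max 1 (M / k)" using assms(1) by (simp add: l_def powr_powr)
  obtain e :: 'a where e: "norm e = 1" using vector_choose_size[of 1] by auto
  let ?z = "x + (2 * l) *\<^sub>R e"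
  have D: "y \<noteq> x \<and> norm (x - y) \<le> 3 * l" if "y \<in> cball ?z l" for y
  proof -
    have zy: "norm (?z - y) \<le> l" using that by (simp add: dist_norm)
    have zx: "norm (?z - x) = 2 * l" using e l by simp
    have "norm (x - y) \<le> norm (?z - y) + norm (?z - x)"
      using norm_triangle_ineq4[of "?z - y" "?z - x"] by simp
    moreover have "y \<noteq> x" using zy zx l by auto
    ultimately show ?thesis using zy zx by simp
  qed
  have "ennreal (1 * (3 * l) powr ?\<beta> * (unit_ball_vol (real DIM('a)) * l ^ DIM('a)))
     \<le> (\<integral>\<^sup>+ y. ennreal (1 * norm (x - y) powr ?\<beta>) \<partial>lborel)"
    using assms l by (intro riesz_potential_lower_bound D) auto
  moreover have "1 * (3 * l) powr ?\<beta> * (unit_ball_vol (real DIM('a)) * l ^ DIM('a)) = k * max 1 (M / k)"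
  proof -
    have "l powr ?\<beta> * l ^ DIM('a) = l powr \<alpha>"
      using l by (simp add: powr_diff powr_realpow)
    then show ?thesis using l unfolding la[symmetric] by (simp add: powr_mult k_def mult_ac)
  qed
  moreover have "M \<le> k * max 1 (M / k)"
  proof -
    have "k * (M / k) \<le> k * max 1 (M / k)" using k by (intro mult_left_mono) auto
    then show ?thesis using k by simp
  qed
  ultimately show "\<exists>c\<ge>M. ennreal c \<le> (\<integral>\<^sup>+ y. ennreal (1 * norm (x - y) powr ?\<beta>) \<partial>lborel)" by auto
qed

text \<open>On the \<open>k\<close>-th ball \<open>\<rho>\<close> is at least a constant times \<open>\<lambda>\<^sup>-\<^sup>\<alpha> (k + 1) / r\<^sup>N\<close>, where \<open>\<lambda> = r R\<close> is its radius and
  \<open>R\<close> the distance of its centre.  The volume is of order \<open>\<lambda>\<^sup>N\<close> and \<open>|x - y| \<le> 3 R\<close> there, so the ball contributes at least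
  a constant times \<open>(k + 1) r\<^sup>-\<^sup>\<alpha> \<ge> k + 1\<close> to the potential.  As \<open>k\<close> is arbitrary, the potential is infinite.\<close>

theorem existence_with_divergent_potential:
  fixes \<alpha> :: real and \<phi> :: "real \<Rightarrow> real"
  assumes N: "DIM('a::euclidean_space) \<ge> 3" and \<alpha>: "0 < \<alpha>" "\<alpha> < 2"
    and \<phi>: "continuous_on {0..} \<phi>" "mono_on {0..} \<phi>" "\<phi> 0 = 0"
    and \<phi>pos: "\<And>t. 0 < t \<Longrightarrow> 0 < \<phi> t"
  shows "\<exists>\<rho> :: 'a \<Rightarrow> real.
    \<rho> \<in> borel_measurable borel \<and> (\<forall>y. \<rho> y \<ge> 0) \<and> (\<forall>K. compact K \<longrightarrow> bounded (\<rho> ` K)) \<and>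
    (\<exists>u. solves_frac_eq \<alpha> \<rho> \<phi> u \<and> (\<forall>x. u x \<ge> 0) \<and> bounded (range u) \<and> (\<exists>x. u x \<noteq> 0)) \<and>
    (\<forall>x. (\<integral>\<^sup>+ y. ennreal (\<rho> y * norm (x - y) powr (\<alpha> - real DIM('a))) \<partial>lborel) = \<infinity>)"
proof -
  obtain w :: "'a \<Rightarrow> real" and C s0 where "flat_bump w C s0"
    using superharmonic_bump[OF N] by blast
  then interpret flat_bump w C s0 .
  have \<kappa>: "0 < 1 / (8 * C)" "1 / (8 * C) \<le> 1" using C by simp_all
  obtain \<epsilon> r R where sc: "separated_scales (1 / (8 * C)) \<epsilon> r R"
    and \<phi>\<epsilon>: "\<And>n. \<phi> (\<epsilon> (Suc n)) \<le> r n ^ DIM('a) / (real n + 1)"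
    using scale_sequences[OF \<phi>(1,3) \<kappa>, where N="DIM('a)"] by blast
  interpret separated_scales "1 / (8 * C)" \<epsilon> r R by (fact sc)
  obtain e :: 'a where e: "norm e = 1" using vector_choose_size[of 1] by auto
  interpret bump_array w C s0 \<epsilon> r R e
    by unfold_locales (fact e)
  have B0: "0 \<le> stable_generator \<alpha> solution x" for x
    using solution_super by (intro stable_generator_nonneg \<alpha>)
  obtain B where B: "\<And>x. \<bar>stable_generator \<alpha> solution x\<bar> \<le> B"
    using stable_generator_bounded[OF \<alpha> solution_measurable solution_abs_le solution_modulus] by blast
  define \<rho> where "\<rho> = (\<lambda>x. stable_generator \<alpha> solution x / \<phi> (solution x))"
  have ppos: "0 < \<phi> (solution x)" for x using \<phi>pos solution_bounds by blast
  have pc: "continuous_on UNIV (\<lambda>x. \<phi> (solution x))"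
    using solution_bounds by (intro continuous_on_compose2[OF \<phi>(1) solution_continuous]) (auto intro: less_imp_le)
  note [measurable] = measurable_stable_generator[OF solution_measurable, of \<alpha>] borel_measurable_continuous_onI[OF pc]
  have rm: "\<rho> \<in> borel_measurable borel" unfolding \<rho>_def by measurable
  have r0: "0 \<le> \<rho> x" for x unfolding \<rho>_def using B0 ppos by (intro divide_nonneg_pos)
  have rb: "bounded (\<rho> ` K)" if K: "compact K" for K
  proof (cases "K = {}")
    case False
    then obtain x0 where x0: "x0 \<in> K" "\<forall>x\<in>K. \<phi> (solution x0) \<le> \<phi> (solution x)"
      using continuous_attains_inf[OF K _ continuous_on_subset[OF pc]] by blast
    have "norm (\<rho> x) \<le> B / \<phi> (solution x0)" if "x \<in> K" for x
    proof -
      have "\<rho> x \<le> B / \<phi> (solution x0)"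
        unfolding \<rho>_def using B0[of x] B[of x] x0 that ppos by (intro frac_le) auto
      then show ?thesis using r0[of x] by simp
    qed
    then show ?thesis by (intro boundedI) auto
  qed simp
  have solves: "solves_frac_eq \<alpha> \<rho> \<phi> solution"
  proof (rule solves_frac_eqI[OF \<alpha> solution_continuous solution_abs_le solution_modulus])
    show "\<rho> x * \<phi> (solution x) = stable_generator \<alpha> solution x" for x
      using ppos[of x] by (simp add: \<rho>_def)
  qed
  have div: "(\<integral>\<^sup>+ y. ennreal (\<rho> y * norm (x - y) powr (\<alpha> - real DIM('a))) \<partial>lborel) = \<infinity>" for x
  proof (rule ennreal_eq_top_if_unbounded)
    fix M :: real
    let ?\<beta> = "\<alpha> - real DIM('a)"
    define m where "m = 1 / 4 * 2 powr (- 1 - \<alpha> / 2) * s0 powr (- \<alpha> / 2) / stable_mass \<alpha>"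
    have m: "0 < m" using s0 stable_mass_pos[OF \<alpha>] by (simp add: m_def)
    define c where "c = m * 3 powr ?\<beta> * unit_ball_vol (real DIM('a))"
    have c: "0 < c" using m by (simp add: c_def)
    obtain k1 :: nat where k1: "M / c < real k1" using reals_Archimedean2 by blast
    obtain k2 :: nat where k2: "2 * norm x < 2 ^ k2" using real_arch_pow[of 2 "2 * norm x"] by auto
    \<comment> \<open>A ball so far out that \<open>x\<close> lies outside it and its contribution \<open>c (k + 1)\<close> exceeds \<open>M\<close>.\<close>
    define k where "k = Suc (max k1 k2)"
    have "M / c \<le> real k + 1" using k1 by (simp add: k_def)
    then have Mk: "M \<le> c * (real k + 1)" using c by (simp add: pos_divide_le_eq mult.commute)
    have "(2::real) ^ k2 \<le> 2 ^ k" unfolding k_def by (intro power_increasing) auto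
    then have xR: "2 * norm x < R k" using k2 R_large[of k] by linarith
    have lr: "radius k \<le> R k / 2"
    proof -
      have "1 / (8 * C) * \<epsilon> k / 2 ^ k \<le> 1 * (1 / 2) / 1"
        using \<kappa> \<epsilon>_half[of k] \<epsilon>_pos[of k] by (intro frac_le mult_mono) auto
      then have "r k \<le> (1 / 2)\<^sup>2"
        unfolding r_def using \<kappa> \<epsilon>_pos[of k] by (intro power_mono) auto
      then have "r k \<le> 1 / 2" by (simp add: power2_eq_square)
      then show ?thesis using mult_right_mono[of "r k" "1 / 2" "R k"] R_pos[of k] by (simp add: radius_def)
    qed
    have Rk: "0 < R k" and l: "0 < radius k" by (rule R_pos radius_pos)+
    let ?z = "R k *\<^sub>R e" and ?l = "radius k"
    define A where "A = m * ?l powr - \<alpha> * ((real k + 1) / r k ^ DIM('a))"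
    have rk: "0 < r k" by (rule r_pos)
    have A0: "0 \<le> A" using m rk by (simp add: A_def)
    have Ay: "A \<le> \<rho> y" if y: "y \<in> cball ?z ?l" for y
    proof -
      have f: "m * ?l powr - \<alpha> \<le> stable_generator \<alpha> solution y"
        using solution_generator_lower_bound[OF \<alpha> y] by (simp add: m_def)
      have "\<phi> (solution y) \<le> \<phi> (\<epsilon> (Suc k))"
        using solution_small[OF y] solution_bounds[of y] \<epsilon>_pos[of "Suc k"] by (intro mono_onD[OF \<phi>(2)]) auto
      also have "\<dots> \<le> r k ^ DIM('a) / (real k + 1)" by (rule \<phi>\<epsilon>)
      finally have "(real k + 1) / r k ^ DIM('a) \<le> 1 / \<phi> (solution y)"
        using ppos[of y] rk by (simp add: field_simps)
      then have "A \<le> stable_generator \<alpha> solution y * (1 / \<phi> (solution y))"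
        unfolding A_def using f m rk B0[of y] by (intro mult_mono) auto
      then show ?thesis by (simp add: \<rho>_def)
    qed
    have D: "y \<noteq> x \<and> norm (x - y) \<le> 3 * R k" if "y \<in> cball ?z ?l" for y
    proof -
      have zy: "norm (?z - y) \<le> ?l" using that by (simp add: dist_norm)
      have "norm ?z \<le> norm (?z - y) + norm y" using norm_triangle_ineq[of "?z - y" y] by simp
      then have "R k / 2 \<le> norm y" using zy lr norm_center[of k] by linarith
      moreover have "norm y \<le> norm ?z + norm (?z - y)" using norm_triangle_ineq4[of ?z "?z - y"] by simp
      then have "norm y \<le> 2 * R k" using zy radius_le_R[of k] norm_center[of k] by linarith
      ultimately show ?thesis using xR norm_triangle_ineq4[of x y] Rk by auto
    qed
    have "ennreal (A * (3 * R k) powr ?\<beta> * (unit_ball_vol (real DIM('a)) * ?l ^ DIM('a)))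
       \<le> (\<integral>\<^sup>+ y. ennreal (\<rho> y * norm (x - y) powr ?\<beta>) \<partial>lborel)"
      using Ay A0 l D \<alpha> N by (intro riesz_potential_lower_bound[where z="?z"]) auto
    moreover have "c * (real k + 1) \<le> A * (3 * R k) powr ?\<beta> * (unit_ball_vol (real DIM('a)) * ?l ^ DIM('a))"
    proof -
      have "?l powr - \<alpha> * ?l ^ DIM('a) = ?l powr (- ?\<beta>)"
        using l by (simp add: powr_add[symmetric] powr_realpow[symmetric] add.commute)
      also have "\<dots> = r k powr (- ?\<beta>) * R k powr (- ?\<beta>)"
        unfolding radius_def using rk Rk by (simp add: powr_mult)
      finally have e1: "?l powr - \<alpha> * ?l ^ DIM('a) = r k powr (- ?\<beta>) * R k powr (- ?\<beta>)" .
      have e2: "R k powr (- ?\<beta>) * (3 * R k) powr ?\<beta> = 3 powr ?\<beta>"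
        using Rk by (simp add: powr_mult powr_add[symmetric] mult.left_commute)
      have e3: "r k powr (- ?\<beta>) / r k ^ DIM('a) = r k powr - \<alpha>"
        using rk by (simp add: powr_realpow[symmetric] powr_diff[symmetric])
      have "A * (3 * R k) powr ?\<beta> * (unit_ball_vol (real DIM('a)) * ?l ^ DIM('a))
         = m * (real k + 1) * unit_ball_vol (real DIM('a)) * ((?l powr - \<alpha> * ?l ^ DIM('a)) / r k ^ DIM('a)) * (3 * R k) powr ?\<beta>"
        by (simp add: A_def mult_ac)
      also have "\<dots> = m * (real k + 1) * unit_ball_vol (real DIM('a)) * (r k powr (- ?\<beta>) / r k ^ DIM('a)) * (R k powr (- ?\<beta>) * (3 * R k) powr ?\<beta>)"
        unfolding e1 by simp
      also have "\<dots> = (c * (real k + 1)) * r k powr - \<alpha>"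
        unfolding e2 e3 by (simp add: c_def mult_ac)
      finally have eq: "A * (3 * R k) powr ?\<beta> * (unit_ball_vol (real DIM('a)) * ?l ^ DIM('a)) = (c * (real k + 1)) * r k powr - \<alpha>" .
      have "1 \<le> r k powr - \<alpha>" using rk r_le_1[of k] \<alpha> powr_mono2'[of "- \<alpha>" "r k" 1] by simp
      then have "(c * (real k + 1)) * 1 \<le> (c * (real k + 1)) * r k powr - \<alpha>" using c by (intro mult_left_mono) auto
      then show ?thesis unfolding eq by simp
    qed
    ultimately show "\<exists>c\<ge>M. ennreal c \<le> (\<integral>\<^sup>+ y. ennreal (\<rho> y * norm (x - y) powr ?\<beta>) \<partial>lborel)"
      using Mk by (meson order_trans)
  qed
  have "bounded (range solution)" using solution_abs_le by (intro boundedI[where B=1]) auto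
  moreover have "solution 0 \<noteq> 0" using solution_bounds[of 0] by simp
  ultimately show ?thesis
    using rm r0 rb solves div solution_bounds by (intro exI[of _ \<rho>] conjI allI impI exI[of _ solution]) (auto intro: less_imp_le)
qed

theorem proposition3p16:
  fixes \<alpha> :: real and \<phi> :: "real \<Rightarrow> real"
  assumes "CARD('n::finite) \<ge> 3"
    and "0 < \<alpha>" and "\<alpha> < 2"
    and "\<phi> \<in> {0..} \<rightarrow> {0..}"
    and "continuous_on {0..} \<phi>"
    and "mono_on {0..} \<phi>"
    and "\<phi> 0 = 0"
  shows "\<exists>\<rho> :: real ^ 'n \<Rightarrow> real.
    \<rho> \<in> borel_measurable borel \<and>
    (\<forall>y. \<rho> y \<ge> 0) \<and>
    (\<forall>K. compact K \<longrightarrow> bounded (\<rho> ` K)) \<and>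
    (\<exists>u. solves_frac_eq \<alpha> \<rho> \<phi> u \<and> (\<forall>x. u x \<ge> 0) \<and> bounded (range u) \<and> (\<exists>x. u x \<noteq> 0)) \<and>
    (\<forall>x. (\<integral>\<^sup>+ y. ennreal (\<rho> y * norm (x - y) powr (\<alpha> - real CARD('n))) \<partial>lborel) = \<infinity>)"
proof -
  have dim: "DIM(real ^ 'n) = CARD('n)" by simp
  have N: "3 \<le> DIM(real ^ 'n)" using assms(1) by simp
  show ?thesis
  proof (cases "\<exists>c>0. \<phi> c = 0")
    case True
    then obtain c where c: "0 < c" "\<phi> c = 0" by blast
    show ?thesis
    proof (rule exI[of _ "\<lambda>_. 1"], intro conjI allI impI)
      show "\<exists>u::real ^ 'n \<Rightarrow> real. solves_frac_eq \<alpha> (\<lambda>_. 1) \<phi> u \<and> (\<forall>x. u x \<ge> 0) \<and> bounded (range u) \<and> (\<exists>x. u x \<noteq> 0)"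
        using c solves_frac_eq_const[of \<alpha> \<phi> c, OF assms(2,3) c(2)] by (intro exI[of _ "\<lambda>_. c"]) auto
      show "(\<integral>\<^sup>+ y. ennreal (1 * norm (x - y) powr (\<alpha> - real CARD('n))) \<partial>lborel) = \<infinity>" for x :: "real ^ 'n"
        using riesz_potential_one[OF assms(2,3) N, of x] unfolding dim .
      show "bounded ((\<lambda>_. 1 :: real) ` K)" for K :: "(real ^ 'n) set"
        by (rule bounded_subset[of "{1}"]) auto
    qed auto
  next
    case False
    have "0 < \<phi> t" if "0 < t" for t
    proof -
      have "0 \<le> \<phi> t" using assms(4) that by (auto simp: Pi_iff)
      moreover have "\<phi> t \<noteq> 0" using False that by blast
      ultimately show ?thesis by linarith
    qed
    from existence_with_divergent_potential[OF N assms(2,3,5-7) this] show ?thesis unfolding dim .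
  qed
qed

end
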